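(* Consider the complex interpolation scheme of two Banach spaces $X_0,X_1$ with a common $1$-monotone basis, let $0<\theta<1$, and let $\Omega_\theta$ be the induced quasi-linear map on $X_\theta=(X_0,X_1)_\theta$. Assume that for every block-subspace $W$ of $X_\theta$ there exist, for every $n$, a finite successive sequence $n<y_1<\dots<y_n$ in $W$ with $\|y_i\|\le1$ for $i=1,\dots,n$, and constants $\varepsilon_n,\lambda_n,M_n$ satisfying (i) $\left\|\sum_{i=1}^ny_i\right\|\ge\varepsilon_nA_{X_0}(n)^{1-\theta}A_{X_1}(n)^{\theta}$; (ii) the block sequence $\{y_1,\dots,y_n\}$ is $\lambda_n$-unconditional; (iii) the space $[y_1,\dots,y_n]$ is $M_n$-complemented in $X_\theta$; and such that $$\liminf_{n\to+\infty}\frac{\lambda_n^3M_n}{\varepsilon_n\left|\log\frac{A_{X_0}(n)}{A_{X_1}(n)}\right|}=0.$$ Then $\Omega_\theta$ is singular.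
   Context: Scalars are complex. $1$-monotone basis means a Schauder basis with basis constant $1$; the common basis $(e_k)$ is used to view all spaces as sequence spaces. A vector's range is the minimal interval of integers containing its support; $n<y_1<\dots<y_n$ means that the ranges are successive finite intervals, all beyond $n$. A block-subspace is the closed span of an infinite sequence of successive (nonzero, finitely supported) vectors. For a space $X$ with $1$-monotone basis, $$A_X(n)=\sup\{\|x_1+\dots+x_n\|:\|x_i\|\le1,\ n<x_1<\dots<x_n\}.$$ A sequence is $\lambda$-unconditional if $\|\sum\pm a_iy_i\|\le\lambda\|\sum a_iy_i\|$ for all scalars and all signs; a subspace is $M$-complemented if it is the range of a projection of norm at most $M$. Complex interpolation: $\mathbb S=\{z\in\mathbb C:0\le\mathrm{Re}\,z\le1\}$, $\Sigma=X_0+X_1$; $\mathcal H$ is the Banach space of functions $g:\mathbb S\to\Sigma$ which are $\Sigma$-bounded, $\Sigma$-continuous on $\mathbb S$, analytic in the interior, with $t\mapsto g(j+it)\in X_j$ bounded and continuous for $j=0,1$, normed by $\sup\{\|g(j+it)\|_{X_j}\}$. $X_\theta=\{g(\theta):g\in\mathcal H\}$ with the quotient norm. The induced quasi-linear map is $\Omega_\theta(x)=B_\theta(x)'(\theta)\in\Sigma$, where $B_\theta:X_\theta\to\mathcal H$ is homogeneous with $B_\theta(x)(\theta)=x$ and $\|B_\theta(x)\|_{\mathcal H}\le C\|x\|$. Different choices of $B_\theta$ change $\Omega_\theta$ by a bounded map $X_\theta\to X_\theta$. $\Omega_\theta$ is trivial on a subspace $W$ if there are a linear map $\ell:W\to\Sigma$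 and a constant $C$ with $\Omega_\theta x-\ell x\in X_\theta$, $\|\Omega_\theta x-\ell x\|_{X_\theta}\le C\|x\|$ for all $x\in W$; it is singular if it is not trivial on any infinite dimensional closed subspace of $X_\theta$. *)

theory Defs
  imports "HOL-Analysis.Analysis" "HOL-Library.Function_Algebras"
begin

section \<open>Complex sequences\<close>

type_synonym cseq = "nat \<Rightarrow> complex"

definition cscale :: "complex \<Rightarrow> cseq \<Rightarrow> cseq" where
  "cscale c x = (\<lambda>k. c * x k)"

global_interpretation cseq: vector_space cscale
  by unfold_locales (auto simp: cscale_def plus_fun_def algebra_simps)

definition unit_seq :: "nat \<Rightarrow> cseq" where
  "unit_seq k = (\<lambda>i. if i = k then 1 else 0)"

definition supp :: "cseq \<Rightarrow> nat set" where
  "supp x = {k. x k \<noteq> 0}"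

definition vrange :: "cseq \<Rightarrow> nat set" where
  "vrange x = {k. \<exists>i\<in>supp x. \<exists>j\<in>supp x. i \<le> k \<and> k \<le> j}"

definition block_vector :: "cseq \<Rightarrow> bool" where
  "block_vector x \<longleftrightarrow> x \<noteq> 0 \<and> finite (supp x)"

definition vless :: "cseq \<Rightarrow> cseq \<Rightarrow> bool" where
  "vless x y \<longleftrightarrow> (\<forall>i\<in>vrange x. \<forall>j\<in>vrange y. i < j)"

text \<open>\<open>n < y 1 < \<dots> < y n\<close>; only the values of \<open>y\<close> on \<open>{1..n}\<close> matter.\<close>

definition successive_beyond :: "nat \<Rightarrow> (nat \<Rightarrow> cseq) \<Rightarrow> bool" where
  "successive_beyond n y \<longleftrightarrow>
     (\<forall>i\<in>{1..n}. block_vector (y i) \<and> (\<forall>k\<in>vrange (y i). n < k)) \<and>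
     (\<forall>i\<in>{1..n}. \<forall>j\<in>{1..n}. i < j \<longrightarrow> vless (y i) (y j))"

definition linear_on :: "cseq set \<Rightarrow> (cseq \<Rightarrow> cseq) \<Rightarrow> bool" where
  "linear_on V f \<longleftrightarrow>
     (\<forall>x\<in>V. \<forall>y\<in>V. f (x + y) = f x + f y) \<and> (\<forall>c. \<forall>x\<in>V. f (cscale c x) = cscale c (f x))"


section \<open>Normed spaces of sequences\<close>

text \<open>A space is a set of sequences together with a norm; the values of the norm off the
  carrier are irrelevant.\<close>

record cspace =
  carr :: "cseq set"
  nrm :: "cseq \<Rightarrow> real"

text \<open>The locale \<open>Metric_space\<close> asks for nonnegativity and symmetry on the whole type,
  hence the case distinction.\<close>

definition sdist :: "cspace \<Rightarrow> cseq \<Rightarrow> cseq \<Rightarrow> real" where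
  "sdist X x y = (if x \<in> carr X \<and> y \<in> carr X then nrm X (x - y) else 0)"

definition norm_topology :: "cspace \<Rightarrow> cseq topology" where
  "norm_topology X = Metric_space.mtopology (carr X) (sdist X)"

definition normed_space :: "cspace \<Rightarrow> bool" where
  "normed_space X \<longleftrightarrow> cseq.subspace (carr X) \<and>
     (\<forall>x\<in>carr X. 0 \<le> nrm X x \<and> (nrm X x = 0 \<longleftrightarrow> x = 0)) \<and>
     (\<forall>c. \<forall>x\<in>carr X. nrm X (cscale c x) = cmod c * nrm X x) \<and>
     (\<forall>x\<in>carr X. \<forall>y\<in>carr X. nrm X (x + y) \<le> nrm X x + nrm X y)"

lemma normed_space_Metric_space:
  assumes "normed_space X"
  shows "Metric_space (carr X) (sdist X)"
proof -
  have sub: "x - y \<in> carr X" if "x \<in> carr X" "y \<in> carr X" for x y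
    using assms that by (auto simp: normed_space_def intro: cseq.subspace_diff)
  have pos: "0 \<le> nrm X x" "(nrm X x = 0) = (x = 0)" if "x \<in> carr X" for x
    using assms that by (simp_all add: normed_space_def)
  have scale: "nrm X (cscale c x) = cmod c * nrm X x" if "x \<in> carr X" for c x
    using assms that by (simp add: normed_space_def)
  have tri: "nrm X (x + y) \<le> nrm X x + nrm X y" if "x \<in> carr X" "y \<in> carr X" for x y
    using assms that by (simp add: normed_space_def)
  have neg: "cscale (- 1) (y - x) = x - y" for x y
    by (simp add: cscale_def fun_eq_iff)
  have sym: "nrm X (x - y) = nrm X (y - x)" if "x \<in> carr X" "y \<in> carr X" for x y
    using scale[OF sub[OF that(2,1)], of "- 1"] unfolding neg by simp
  show ?thesis
  proof
    show "0 \<le> sdist X x y" for x y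
      by (simp add: sdist_def pos sub)
    show "sdist X x y = sdist X y x" for x y
      unfolding sdist_def using sym[of x y] by presburger
    show "(sdist X x y = 0) = (x = y)" if "x \<in> carr X" "y \<in> carr X" for x y
      using that by (simp add: sdist_def pos sub)
    show "sdist X x z \<le> sdist X x y + sdist X y z"
      if "x \<in> carr X" "y \<in> carr X" "z \<in> carr X" for x y z
      using tri[OF sub[OF that(1,2)] sub[OF that(2,3)]] that by (simp add: sdist_def)
  qed
qed

definition banach_space :: "cspace \<Rightarrow> bool" where
  "banach_space X \<longleftrightarrow> normed_space X \<and> Metric_space.mcomplete (carr X) (sdist X)"

text \<open>The unit sequences form a Schauder basis, and the elements of the space are identified
  with their coordinate sequences: \<open>x\<close> itself is the unique sequence of coefficients of the
  expansion of \<open>x\<close>.\<close>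

definition schauder_basis :: "cspace \<Rightarrow> bool" where
  "schauder_basis X \<longleftrightarrow> (\<forall>k. unit_seq k \<in> carr X) \<and>
     (\<forall>x\<in>carr X. \<forall>a.
        limitin (norm_topology X) (\<lambda>n. \<Sum>k<n. cscale (a k) (unit_seq k)) x sequentially \<longleftrightarrow> a = x)"

definition monotone_basis_space :: "cspace \<Rightarrow> bool" where
  "monotone_basis_space X \<longleftrightarrow> banach_space X \<and> schauder_basis X \<and>
     (\<forall>x\<in>carr X. \<forall>n. nrm X (\<Sum>k<n. cscale (x k) (unit_seq k)) \<le> nrm X x)"

definition closed_subspace :: "cspace \<Rightarrow> cseq set \<Rightarrow> bool" where
  "closed_subspace X W \<longleftrightarrow> W \<subseteq> carr X \<and> cseq.subspace W \<and> closedin (norm_topology X) W"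

definition infinite_dim :: "cseq set \<Rightarrow> bool" where
  "infinite_dim W \<longleftrightarrow> \<not> (\<exists>F. finite F \<and> W \<subseteq> cseq.span F)"

definition block_subspace :: "cspace \<Rightarrow> cseq set \<Rightarrow> bool" where
  "block_subspace X W \<longleftrightarrow>
     (\<exists>w. (\<forall>i::nat. block_vector (w i) \<and> vless (w i) (w (Suc i))) \<and>
          W = norm_topology X closure_of cseq.span (range w))"

definition A_fun :: "cspace \<Rightarrow> nat \<Rightarrow> real" where
  "A_fun X n = Sup {nrm X (\<Sum>i=1..n. x i) | x. successive_beyond n x \<and> (\<forall>i\<in>{1..n}. nrm X (x i) \<le> 1)}"

definition unconditional :: "cspace \<Rightarrow> nat \<Rightarrow> (nat \<Rightarrow> cseq) \<Rightarrow> real \<Rightarrow> bool" where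
  "unconditional X n y lam \<longleftrightarrow>
     (\<forall>a :: nat \<Rightarrow> complex. \<forall>s :: nat \<Rightarrow> complex. (\<forall>i\<in>{1..n}. s i \<in> {-1, 1}) \<longrightarrow>
        nrm X (\<Sum>i=1..n. cscale (s i * a i) (y i)) \<le> lam * nrm X (\<Sum>i=1..n. cscale (a i) (y i)))"

definition complemented :: "cspace \<Rightarrow> cseq set \<Rightarrow> real \<Rightarrow> bool" where
  "complemented X V M \<longleftrightarrow>
     (\<exists>P. linear_on (carr X) P \<and> P ` carr X = V \<and> V \<subseteq> carr X \<and>
          (\<forall>x\<in>carr X. P (P x) = P x) \<and> (\<forall>x\<in>carr X. nrm X (P x) \<le> M * nrm X x))"


section \<open>Complex interpolation\<close>

definition sum_space :: "cspace \<Rightarrow> cspace \<Rightarrow> cspace" where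
  "sum_space X0 X1 = \<lparr>
     carr = {a + b | a b. a \<in> carr X0 \<and> b \<in> carr X1},
     nrm = (\<lambda>x. Inf {nrm X0 a + nrm X1 b | a b. a \<in> carr X0 \<and> b \<in> carr X1 \<and> x = a + b})\<rparr>"

definition strip :: "complex set" where
  "strip = {z. 0 \<le> Re z \<and> Re z \<le> 1}"

definition has_deriv :: "cspace \<Rightarrow> (complex \<Rightarrow> cseq) \<Rightarrow> cseq \<Rightarrow> complex \<Rightarrow> bool" where
  "has_deriv Y g d z \<longleftrightarrow> limitin (norm_topology Y) (\<lambda>w. cscale (inverse (w - z)) (g w - g z)) d (at z)"

definition vderiv :: "cspace \<Rightarrow> (complex \<Rightarrow> cseq) \<Rightarrow> complex \<Rightarrow> cseq" where
  "vderiv Y g z = (THE d. has_deriv Y g d z)"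

definition boundary_ok :: "cspace \<Rightarrow> (complex \<Rightarrow> cseq) \<Rightarrow> real \<Rightarrow> bool" where
  "boundary_ok X g j \<longleftrightarrow>
     (\<forall>t. g (Complex j t) \<in> carr X) \<and> (\<exists>C. \<forall>t. nrm X (g (Complex j t)) \<le> C) \<and>
     continuous_map euclideanreal (norm_topology X) (\<lambda>t. g (Complex j t))"

text \<open>The values of \<open>g\<close> off the strip are irrelevant.\<close>

definition H_space :: "cspace \<Rightarrow> cspace \<Rightarrow> (complex \<Rightarrow> cseq) set" where
  "H_space X0 X1 = {g.
     (\<forall>z\<in>strip. g z \<in> carr (sum_space X0 X1)) \<and>
     (\<exists>C. \<forall>z\<in>strip. nrm (sum_space X0 X1) (g z) \<le> C) \<and>
     continuous_map (top_of_set strip) (norm_topology (sum_space X0 X1)) g \<and>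
     (\<forall>z\<in>interior strip. \<exists>d. has_deriv (sum_space X0 X1) g d z) \<and>
     boundary_ok X0 g 0 \<and> boundary_ok X1 g 1}"

definition H_norm :: "cspace \<Rightarrow> cspace \<Rightarrow> (complex \<Rightarrow> cseq) \<Rightarrow> real" where
  "H_norm X0 X1 g =
     Sup (range (\<lambda>t. nrm X0 (g (Complex 0 t))) \<union> range (\<lambda>t. nrm X1 (g (Complex 1 t))))"

definition interp_space :: "cspace \<Rightarrow> cspace \<Rightarrow> real \<Rightarrow> cspace" where
  "interp_space X0 X1 \<theta> = \<lparr>
     carr = {g (of_real \<theta>) | g. g \<in> H_space X0 X1},
     nrm = (\<lambda>x. Inf {H_norm X0 X1 g | g. g \<in> H_space X0 X1 \<and> g (of_real \<theta>) = x})\<rparr>"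

text \<open>Elements of \<open>H_space\<close> are functions on the strip, so homogeneity of the selection is
  required on the strip only.\<close>

definition bounded_selection ::
  "cspace \<Rightarrow> cspace \<Rightarrow> real \<Rightarrow> (cseq \<Rightarrow> complex \<Rightarrow> cseq) \<Rightarrow> bool" where
  "bounded_selection X0 X1 \<theta> B \<longleftrightarrow>
     (\<forall>x\<in>carr (interp_space X0 X1 \<theta>). B x \<in> H_space X0 X1 \<and> B x (of_real \<theta>) = x) \<and>
     (\<forall>c. \<forall>x\<in>carr (interp_space X0 X1 \<theta>). \<forall>z\<in>strip. B (cscale c x) z = cscale c (B x z)) \<and>
     (\<exists>C. \<forall>x\<in>carr (interp_space X0 X1 \<theta>). H_norm X0 X1 (B x) \<le> C * nrm (interp_space X0 X1 \<theta>) x)"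

definition Omega ::
  "cspace \<Rightarrow> cspace \<Rightarrow> real \<Rightarrow> (cseq \<Rightarrow> complex \<Rightarrow> cseq) \<Rightarrow> cseq \<Rightarrow> cseq" where
  "Omega X0 X1 \<theta> B x = vderiv (sum_space X0 X1) (B x) (of_real \<theta>)"

text \<open>In the next two definitions \<open>X\<close> is the interpolation space and \<open>Y\<close> the sum space.\<close>

definition trivial_on :: "cspace \<Rightarrow> cspace \<Rightarrow> (cseq \<Rightarrow> cseq) \<Rightarrow> cseq set \<Rightarrow> bool" where
  "trivial_on X Y \<Omega> W \<longleftrightarrow>
     (\<exists>l C. linear_on W l \<and> l ` W \<subseteq> carr Y \<and>
        (\<forall>x\<in>W. \<Omega> x - l x \<in> carr X \<and> nrm X (\<Omega> x - l x) \<le> C * nrm X x))"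

definition singular :: "cspace \<Rightarrow> cspace \<Rightarrow> (cseq \<Rightarrow> cseq) \<Rightarrow> bool" where
  "singular X Y \<Omega> \<longleftrightarrow>
     (\<forall>W. closed_subspace X W \<and> infinite_dim W \<longrightarrow> \<not> trivial_on X Y \<Omega> W)"

end

theory Submission
  imports Defs "HOL-Complex_Analysis.Complex_Analysis"
begin

text \<open>If \<open>g\<close> is admissible for the interpolation scheme and \<open>g \<theta> = 0\<close>, then \<open>g z / (z - \<theta>)\<close> is
  admissible too, so the derivative of \<open>g\<close> at \<open>\<theta>\<close> lies in the interpolation space, with a norm
  bound. Hence \<open>\<Omega> x\<close> may be computed, up to a bounded error, from any admissible function through
  \<open>x\<close>. For successive vectors \<open>n < y 1 < \<dots> < y n\<close> and \<open>A i = A_fun X\<^sub>i n\<close>, take \<open>d i\<close> to be the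
  derivative at \<open>\<theta>\<close> of the selection of \<open>y i\<close> restricted to the range of \<open>y i\<close>. The function
  \<open>(A 0 / A 1) powr (z - \<theta>)\<close> times the sum of the restricted selections then shows that
  \<open>\<Omega> (\<Sum> y i) - \<Sum> d i - ln (A 0 / A 1) \<Sum> y i\<close> is bounded by a multiple of
  \<open>(A 0) powr (1 - \<theta>) * (A 1) powr \<theta>\<close>, and the same holds after changing signs.

  If \<open>\<Omega>\<close> is trivial on an infinite-dimensional subspace, a gliding hump makes it trivial on the
  span of a block sequence. There \<open>\<Omega>\<close> may be replaced by a linear map \<open>v\<close>, and the vectors
  \<open>v (y i) - d i\<close> are bounded. Projecting onto the span of the \<open>y i\<close> and averaging over signs
  replaces these vectors by multiples of the \<open>y i\<close>, whose sum is again bounded by a multiple of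
  \<open>(A 0) powr (1 - \<theta>) * (A 1) powr \<theta>\<close>. So \<open>\<bar>ln (A 0 / A 1)\<bar> * eps n\<close> is at most a constant times
  \<open>lam n * M n\<close>, which contradicts the hypothesis on the limit inferior.\<close>

section \<open>Coordinate restrictions\<close>

text \<open>Analyticity refers to the norm of the sum space, while Cauchy's formula is applied to
  single coordinates. Monotonicity of the basis brings the two together: a norm is the supremum of
  the norms of initial segments, and on finitely many coordinates convergence of coordinates is
  convergence in norm.

  Triviality is carried over only to the spans of finitely many blocks \<open>w 0\<close>, ...,
  \<open>w (m - 1)\<close>, with constants independent of \<open>m\<close>. This suffices because a
  finitely supported vector of the closed block-subspace already lies in the algebraic span; the
  linear map \<open>v\<close> may then change with \<open>n\<close>.

  The vectors \<open>v (y i) - d i\<close> are bounded one at a time, and the triangle inequality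
  for their sum would cost a factor \<open>n\<close>. Averaging is needed to turn them into
  multiples of the \<open>y i\<close>, because sums of such multiples are again controlled by the
  interpolated quantity. This removes the unknown map \<open>v\<close> and leaves only the
  logarithm. The projection costs one factor \<open>M\<close> and the signs one factor
  \<open>lam\<close>; since \<open>lam \<ge> 1\<close>, this compares with the power of
  \<open>lam\<close> in the hypothesis.\<close>

definition restr :: "nat set \<Rightarrow> cseq \<Rightarrow> cseq" where
  "restr E x = (\<lambda>k. if k \<in> E then x k else 0)"

lemma sum_seq_apply: "(\<Sum>i\<in>I. f i) k = (\<Sum>i\<in>I. (f i :: cseq) k)"
  by (induction I rule: infinite_finite_induct) auto

lemma sum_unit_seq: "finite E \<Longrightarrow> (\<Sum>k\<in>E. cscale (x k) (unit_seq k)) = restr E x"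
proof (rule ext)
  fix i
  assume "finite E"
  have "(\<Sum>k\<in>E. cscale (x k) (unit_seq k)) i = (\<Sum>k\<in>E. if i = k then x k else 0)"
    unfolding sum_seq_apply by (intro sum.cong) (auto simp: cscale_def unit_seq_def)
  also have "\<dots> = restr E x i"
    using \<open>finite E\<close> by (simp add: restr_def)
  finally show "(\<Sum>k\<in>E. cscale (x k) (unit_seq k)) i = restr E x i" .
qed

lemma restr_add: "restr E (x + y) = restr E x + restr E y"
  by (auto simp: restr_def)

lemma restr_diff: "restr E (x - y) = restr E x - restr E y"
  by (auto simp: restr_def)

lemma restr_cscale: "restr E (cscale c x) = cscale c (restr E x)"
  by (auto simp: restr_def cscale_def)

lemma restr_supp: "supp x \<subseteq> E \<Longrightarrow> restr E x = x"
  by (auto simp: restr_def supp_def fun_eq_iff)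

lemma supp_restr: "supp (restr E x) \<subseteq> E"
  by (auto simp: restr_def supp_def)

lemma cscale_1 [simp]: "cscale 1 x = x"
  and cscale_0 [simp]: "cscale 0 x = 0"
  and cscale_zero [simp]: "cscale c 0 = 0"
  and cscale_cscale [simp]: "cscale a (cscale b x) = cscale (a * b) x"
  and cscale_apply [simp]: "cscale c x k = c * x k"
  by (auto simp: cscale_def)

lemmas cscale_add = cseq.scale_right_distrib
lemmas cscale_diff = cseq.scale_right_diff_distrib
lemmas cscale_sum = cseq.scale_sum_right

lemma supp_cscale: "supp (cscale c x) \<subseteq> supp x"
  by (auto simp: supp_def)

lemma vrange_supp: "supp x \<subseteq> vrange x"
  by (auto simp: vrange_def)

lemma vrange_mono: "supp x \<subseteq> vrange y \<Longrightarrow> vrange x \<subseteq> vrange y"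
proof
  fix k
  assume x: "supp x \<subseteq> vrange y" and "k \<in> vrange x"
  then obtain i j where "i \<in> vrange y" "j \<in> vrange y" "i \<le> k" "k \<le> j"
    unfolding vrange_def[of x] by blast
  then show "k \<in> vrange y"
    unfolding vrange_def mem_Collect_eq by (meson le_trans)
qed

text \<open>The half-open form matches differences of initial segment projections, so that
  restricting to the range of a block is an operation of norm at most 2.\<close>

lemma vrange_interval:
  assumes "block_vector y"
  obtains a b where "vrange y = {a..<b}"
proof
  have "supp y \<noteq> {}"
    using assms by (auto simp: block_vector_def supp_def)
  moreover have "finite (supp y)"
    using assms by (auto simp: block_vector_def)
  ultimately have "Min (supp y) \<in> supp y" "Max (supp y) \<in> supp y"
    "\<And>i. i \<in> supp y \<Longrightarrow> Min (supp y) \<le> i \<and> i \<le> Max (supp y)"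
    by simp_all
  then show "vrange y = {Min (supp y)..<Suc (Max (supp y))}"
    unfolding vrange_def atLeastLessThan_def lessThan_Suc_atMost set_eq_iff
    by simp (meson le_trans)
qed


section \<open>Norm convergence and the projections of a monotone basis\<close>

section \<open>Normed sequence spaces\<close>

text \<open>Convergence in \<open>norm_topology Y\<close> (see \<open>tends_iff\<close>), stated so that the calculus of
  real limits applies.\<close>

definition tends :: "cspace \<Rightarrow> ('a \<Rightarrow> cseq) \<Rightarrow> cseq \<Rightarrow> 'a filter \<Rightarrow> bool" where
  "tends Y f l F \<longleftrightarrow>
     l \<in> carr Y \<and> (\<forall>\<^sub>F w in F. f w \<in> carr Y) \<and> ((\<lambda>w. nrm Y (f w - l)) \<longlongrightarrow> 0) F"

lemma tends_cong:
  assumes "\<forall>\<^sub>F w in F. f w = g w" "tends Y f l F"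
  shows "tends Y g l F"
proof -
  have "\<forall>\<^sub>F w in F. g w \<in> carr Y"
    using assms unfolding tends_def by (auto elim: eventually_elim2)
  moreover have "((\<lambda>w. nrm Y (g w - l)) \<longlongrightarrow> 0) F"
    by (rule Lim_transform_eventually[of "\<lambda>w. nrm Y (f w - l)"])
      (use assms in \<open>auto simp: tends_def elim: eventually_mono\<close>)
  ultimately show ?thesis
    using assms by (auto simp: tends_def)
qed

locale nspace =
  fixes Y :: cspace
  assumes normed: "normed_space Y"
begin

lemma subspace: "cseq.subspace (carr Y)"
  using normed by (simp add: normed_space_def)

lemma add_mem: "x \<in> carr Y \<Longrightarrow> y \<in> carr Y \<Longrightarrow> x + y \<in> carr Y"
  and diff_mem: "x \<in> carr Y \<Longrightarrow> y \<in> carr Y \<Longrightarrow> x - y \<in> carr Y"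
  and scale_mem: "x \<in> carr Y \<Longrightarrow> cscale c x \<in> carr Y"
  and zero_mem: "0 \<in> carr Y"
  and sum_mem: "(\<And>i. i \<in> I \<Longrightarrow> f i \<in> carr Y) \<Longrightarrow> sum f I \<in> carr Y"
  using subspace
  by (simp_all add: cseq.subspace_add cseq.subspace_diff cseq.subspace_scale cseq.subspace_0
      cseq.subspace_sum)

lemmas mem = add_mem diff_mem scale_mem zero_mem sum_mem

lemma nrm_ge0: "x \<in> carr Y \<Longrightarrow> 0 \<le> nrm Y x"
  and nrm_eq0: "x \<in> carr Y \<Longrightarrow> nrm Y x = 0 \<longleftrightarrow> x = 0"
  and nrm_scale: "x \<in> carr Y \<Longrightarrow> nrm Y (cscale c x) = cmod c * nrm Y x"
  and nrm_add: "x \<in> carr Y \<Longrightarrow> y \<in> carr Y \<Longrightarrow> nrm Y (x + y) \<le> nrm Y x + nrm Y y"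
  using normed by (simp_all add: normed_space_def)

lemma nrm_zero [simp]: "nrm Y 0 = 0"
  using nrm_eq0 zero_mem by blast

lemma nrm_pos: "x \<in> carr Y \<Longrightarrow> x \<noteq> 0 \<Longrightarrow> 0 < nrm Y x"
  using nrm_eq0 nrm_ge0 by (metis order_le_less)

lemma nrm_minus_commute: "x \<in> carr Y \<Longrightarrow> y \<in> carr Y \<Longrightarrow> nrm Y (x - y) = nrm Y (y - x)"
  using nrm_scale[OF diff_mem[of y x], of "-1"] by simp

lemma nrm_diff: "x \<in> carr Y \<Longrightarrow> y \<in> carr Y \<Longrightarrow> nrm Y (x - y) \<le> nrm Y x + nrm Y y"
  using nrm_add[of x "cscale (-1) y"] nrm_scale[of y "-1"] scale_mem[of y "-1"] by simp

lemma nrm_triangle: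
  "x \<in> carr Y \<Longrightarrow> y \<in> carr Y \<Longrightarrow> z \<in> carr Y \<Longrightarrow> nrm Y (x - z) \<le> nrm Y (x - y) + nrm Y (y - z)"
  using nrm_add[of "x - y" "y - z"] by (simp add: diff_mem)

lemma nrm_le_add_diff: "x \<in> carr Y \<Longrightarrow> y \<in> carr Y \<Longrightarrow> nrm Y x \<le> nrm Y y + nrm Y (x - y)"
  using nrm_add[of y "x - y"] by (simp add: diff_mem)

lemma nrm_sum:
  "(\<And>i. i \<in> I \<Longrightarrow> f i \<in> carr Y) \<Longrightarrow> nrm Y (sum f I) \<le> (\<Sum>i\<in>I. nrm Y (f i))"
proof (induction I rule: infinite_finite_induct)
  case (insert i I)
  then have "nrm Y (f i + sum f I) \<le> nrm Y (f i) + nrm Y (sum f I)"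
    by (intro nrm_add mem) auto
  moreover have "nrm Y (sum f I) \<le> (\<Sum>i\<in>I. nrm Y (f i))"
    using insert by blast
  ultimately show ?case
    unfolding sum.insert[OF insert.hyps] by linarith
qed simp_all

sublocale M: Metric_space "carr Y" "sdist Y"
  by (rule normed_space_Metric_space[OF normed])

lemma tends_iff: "limitin (norm_topology Y) f l F \<longleftrightarrow> tends Y f l F"
proof
  assume "limitin (norm_topology Y) f l F"
  then have l: "l \<in> carr Y"
    and ev: "\<And>e. e > 0 \<Longrightarrow> \<forall>\<^sub>F w in F. f w \<in> carr Y \<and> sdist Y (f w) l < e"
    by (auto simp: norm_topology_def M.limitin_metric)
  have "\<forall>\<^sub>F w in F. dist (nrm Y (f w - l)) 0 < e" if "e > 0" for e
    using ev[OF that] by eventually_elim (use l in \<open>auto simp: sdist_def diff_mem nrm_ge0\<close>)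
  then have "((\<lambda>w. nrm Y (f w - l)) \<longlongrightarrow> 0) F"
    by (rule tendstoI)
  moreover have "\<forall>\<^sub>F w in F. f w \<in> carr Y"
    using ev[of 1] by (auto elim: eventually_mono)
  ultimately show "tends Y f l F"
    using l by (auto simp: tends_def)
next
  assume *: "tends Y f l F"
  show "limitin (norm_topology Y) f l F"
    unfolding norm_topology_def M.limitin_metric
  proof (intro conjI allI impI)
    show "l \<in> carr Y"
      using * by (simp add: tends_def)
    fix e :: real
    assume "e > 0"
    then have "\<forall>\<^sub>F w in F. nrm Y (f w - l) < e"
      using * order_tendstoD(2)[of _ 0 F e] unfolding tends_def by auto
    moreover have "\<forall>\<^sub>F w in F. f w \<in> carr Y"
      using * by (simp add: tends_def)
    ultimately show "\<forall>\<^sub>F w in F. f w \<in> carr Y \<and> sdist Y (f w) l < e"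
      by eventually_elim (use * in \<open>auto simp: sdist_def tends_def\<close>)
  qed
qed

lemma continuous_map_iff:
  "continuous_map (top_of_set S) (norm_topology Y) f \<longleftrightarrow>
     (\<forall>z\<in>S. f z \<in> carr Y \<and> tends Y f (f z) (at z within S))"
proof -
  have "limitin (norm_topology Y) f (f z) (atin (top_of_set S) z) \<longleftrightarrow>
      f z \<in> carr Y \<and> tends Y f (f z) (at z within S)" if "z \<in> S" for z
  proof -
    have "atin (top_of_set S) z = at z within S"
      unfolding atin_subtopology_within[OF that] filter_eq_iff eventually_atin_within
        eventually_at_topological by auto
    then show ?thesis
      unfolding tends_iff[symmetric] by (auto dest: limitin_topspace simp: norm_topology_def)
  qed
  then show ?thesis
    by (simp add: continuous_map_atin)
qed

lemma tends_unique:
  assumes "tends Y f l F" "tends Y f m F" "F \<noteq> bot"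
  shows "l = m"
  using assms unfolding tends_iff[symmetric] norm_topology_def
  using M.limitin_metric_unique by blast

lemma tendsI:
  assumes "l \<in> carr Y" "\<forall>\<^sub>F w in F. f w \<in> carr Y" "\<forall>\<^sub>F w in F. nrm Y (f w - l) \<le> h w" "(h \<longlongrightarrow> 0) F"
  shows "tends Y f l F"
  unfolding tends_def
proof (intro conjI assms)
  have "\<forall>\<^sub>F w in F. 0 \<le> nrm Y (f w - l)"
    using assms(2) by eventually_elim (simp add: nrm_ge0 diff_mem assms(1))
  then show "((\<lambda>w. nrm Y (f w - l)) \<longlongrightarrow> 0) F"
    by (rule tendsto_sandwich[OF _ assms(3) tendsto_const assms(4)])
qed

lemma tends_const: "l \<in> carr Y \<Longrightarrow> tends Y (\<lambda>_. l) l F"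
  by (simp add: tends_def)

lemma tends_add:
  assumes "tends Y f l F" "tends Y g m F"
  shows "tends Y (\<lambda>w. f w + g w) (l + m) F"
proof (rule tendsI[where h = "\<lambda>w. nrm Y (f w - l) + nrm Y (g w - m)"])
  have ev: "\<forall>\<^sub>F w in F. f w \<in> carr Y" "\<forall>\<^sub>F w in F. g w \<in> carr Y"
    and lm: "l \<in> carr Y" "m \<in> carr Y"
    using assms by (auto simp: tends_def)
  show "l + m \<in> carr Y"
    by (intro mem lm)
  show "\<forall>\<^sub>F w in F. f w + g w \<in> carr Y"
    using ev by eventually_elim (simp add: mem)
  show "\<forall>\<^sub>F w in F. nrm Y (f w + g w - (l + m)) \<le> nrm Y (f w - l) + nrm Y (g w - m)"
    using ev
  proof eventually_elim
    case (elim w)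
    then show ?case
      using nrm_add[of "f w - l" "g w - m"] lm by (simp add: mem algebra_simps)
  qed
  show "((\<lambda>w. nrm Y (f w - l) + nrm Y (g w - m)) \<longlongrightarrow> 0) F"
    using assms by (intro tendsto_add_zero) (auto simp: tends_def)
qed

lemma tends_nrm:
  assumes "tends Y f l F"
  shows "((\<lambda>w. nrm Y (f w)) \<longlongrightarrow> nrm Y l) F"
proof -
  have l: "l \<in> carr Y" and ev: "\<forall>\<^sub>F w in F. f w \<in> carr Y"
    and lim: "((\<lambda>w. nrm Y (f w - l)) \<longlongrightarrow> 0) F"
    using assms by (auto simp: tends_def)
  have "\<forall>\<^sub>F w in F. norm (nrm Y (f w) - nrm Y l) \<le> nrm Y (f w - l)"
    using ev
  proof eventually_elim
    case (elim w)
    then show ?case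
      using nrm_le_add_diff[OF elim l] nrm_le_add_diff[OF l elim] nrm_minus_commute[OF elim l]
      unfolding real_norm_def by linarith
  qed
  then have "((\<lambda>w. nrm Y (f w) - nrm Y l) \<longlongrightarrow> 0) F"
    by (rule Lim_null_comparison[OF _ lim])
  then show ?thesis
    by (simp add: LIM_zero_iff)
qed

lemma tends_scale:
  assumes "(c \<longlongrightarrow> c0) F" "tends Y f l F"
  shows "tends Y (\<lambda>w. cscale (c w) (f w)) (cscale c0 l) F"
proof -
  have l: "l \<in> carr Y" and ev: "\<forall>\<^sub>F w in F. f w \<in> carr Y"
    and lim: "((\<lambda>w. nrm Y (f w - l)) \<longlongrightarrow> 0) F"
    using assms by (auto simp: tends_def)
  show ?thesis
  proof (rule tendsI[where h = "\<lambda>w. cmod (c w - c0) * nrm Y (f w) + cmod c0 * nrm Y (f w - l)"])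
    show "cscale c0 l \<in> carr Y"
      by (intro mem l)
    show "\<forall>\<^sub>F w in F. cscale (c w) (f w) \<in> carr Y"
      using ev by eventually_elim (simp add: mem)
    show "\<forall>\<^sub>F w in F. nrm Y (cscale (c w) (f w) - cscale c0 l)
        \<le> cmod (c w - c0) * nrm Y (f w) + cmod c0 * nrm Y (f w - l)"
      using ev
    proof eventually_elim
      case (elim w)
      have "cscale (c w) (f w) - cscale c0 l = cscale (c w - c0) (f w) + cscale c0 (f w - l)"
        by (auto simp: algebra_simps)
      then show ?case
        using nrm_add[of "cscale (c w - c0) (f w)" "cscale c0 (f w - l)"] elim l
        by (simp add: mem nrm_scale)
    qed
    have "((\<lambda>w. cmod (c w - c0)) \<longlongrightarrow> 0) F"
      using assms(1) LIM_zero tendsto_norm_zero by blast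
    from tendsto_add[OF tendsto_mult[OF this tends_nrm[OF assms(2)]]
        tendsto_mult[OF tendsto_const[of "cmod c0"] lim]]
    show "((\<lambda>w. cmod (c w - c0) * nrm Y (f w) + cmod c0 * nrm Y (f w - l)) \<longlongrightarrow> 0) F"
      by simp
  qed
qed

lemma tends_bounded_linear:
  assumes "nspace Z" and "tends Z f l F" and "\<And>x. x \<in> carr Z \<Longrightarrow> T x \<in> carr Y"
    and "\<And>x. x \<in> carr Z \<Longrightarrow> nrm Y (T x) \<le> c * nrm Z x" and "\<And>x y. T (x - y) = T x - T y"
  shows "tends Y (\<lambda>w. T (f w)) (T l) F"
proof -
  interpret Z: nspace Z by fact
  have l: "l \<in> carr Z" and ev: "\<forall>\<^sub>F w in F. f w \<in> carr Z"
    and lim: "((\<lambda>w. nrm Z (f w - l)) \<longlongrightarrow> 0) F"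
    using assms(2) by (auto simp: tends_def)
  show ?thesis
  proof (rule tendsI[where h = "\<lambda>w. c * nrm Z (f w - l)"])
    show "\<forall>\<^sub>F w in F. nrm Y (T (f w) - T l) \<le> c * nrm Z (f w - l)"
      using ev by eventually_elim (simp add: assms(5)[symmetric] assms(4) Z.diff_mem l)
    show "\<forall>\<^sub>F w in F. T (f w) \<in> carr Y"
      using ev by eventually_elim (rule assms)
    show "((\<lambda>w. c * nrm Z (f w - l)) \<longlongrightarrow> 0) F"
      using tendsto_mult[OF tendsto_const lim, of c] by simp
  qed (rule assms(3)[OF l])
qed

end


section \<open>Spaces with a monotone basis\<close>

text \<open>Completeness is kept apart in \<open>bspace\<close>. The interpolation space is shown to
  satisfy the present properties, and the gliding hump and the closure argument for blocks are
  carried out from them.\<close>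

locale mspace = nspace +
  assumes unit_mem: "unit_seq k \<in> carr Y"
    and init_mem: "x \<in> carr Y \<Longrightarrow> restr {..<n} x \<in> carr Y"
    and nrm_init: "x \<in> carr Y \<Longrightarrow> nrm Y (restr {..<n} x) \<le> nrm Y x"
    and tends_init: "x \<in> carr Y \<Longrightarrow> tends Y (\<lambda>n. restr {..<n} x) x sequentially"
begin

lemma finite_supp_mem: "finite (supp x) \<Longrightarrow> x \<in> carr Y"
  using sum_mem[of "supp x" "\<lambda>k. cscale (x k) (unit_seq k)"] scale_mem[OF unit_mem]
  by (simp add: sum_unit_seq restr_supp)

lemma restr_finite_mem: "finite E \<Longrightarrow> restr E x \<in> carr Y"
  by (meson finite_supp_mem finite_subset supp_restr)

lemma nrm_restr_interval:
  assumes "x \<in> carr Y"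
  shows "nrm Y (restr {m..<n} x) \<le> 2 * nrm Y x"
proof (cases "m \<le> n")
  case True
  then have "restr {m..<n} x = restr {..<n} x - restr {..<m} x"
    by (auto simp: restr_def fun_eq_iff)
  then show ?thesis
    using nrm_diff[OF init_mem[OF assms] init_mem[OF assms], of n m]
      nrm_init[OF assms, of m] nrm_init[OF assms, of n] by simp
next
  case False
  then have "restr {m..<n} x = 0"
    by (auto simp: restr_def fun_eq_iff)
  then show ?thesis
    using nrm_ge0[OF assms] by simp
qed

lemma unit_pos: "0 < nrm Y (unit_seq k)"
proof -
  have "unit_seq k k \<noteq> 0 k"
    by (simp add: unit_seq_def)
  then have "unit_seq k \<noteq> 0"
    by metis
  then show ?thesis
    using nrm_pos unit_mem by blast
qed

lemma coord_bound:
  assumes "x \<in> carr Y"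
  shows "cmod (x k) \<le> 2 / nrm Y (unit_seq k) * nrm Y x"
proof -
  have "restr {k..<Suc k} x = cscale (x k) (unit_seq k)"
    by (auto simp: restr_def unit_seq_def fun_eq_iff)
  then have "cmod (x k) * nrm Y (unit_seq k) \<le> 2 * nrm Y x"
    using nrm_restr_interval[OF assms, of k "Suc k"] by (simp add: nrm_scale unit_mem)
  then show ?thesis
    using unit_pos[of k] by (simp add: field_simps)
qed

lemma tends_coord:
  assumes "tends Y f l F"
  shows "((\<lambda>w. f w k) \<longlongrightarrow> l k) F"
proof -
  have l: "l \<in> carr Y" and ev: "\<forall>\<^sub>F w in F. f w \<in> carr Y"
    and lim: "((\<lambda>w. nrm Y (f w - l)) \<longlongrightarrow> 0) F"
    using assms by (auto simp: tends_def)
  have "\<forall>\<^sub>F w in F. norm (f w k - l k) \<le> 2 / nrm Y (unit_seq k) * nrm Y (f w - l)"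
    using ev
  proof eventually_elim
    case (elim w)
    then show ?case
      using coord_bound[OF diff_mem[OF elim l], of k] by simp
  qed
  moreover have "((\<lambda>w. 2 / nrm Y (unit_seq k) * nrm Y (f w - l)) \<longlongrightarrow> 0) F"
    using tendsto_mult[OF tendsto_const lim, of "2 / nrm Y (unit_seq k)"] by simp
  ultimately have "((\<lambda>w. f w k - l k) \<longlongrightarrow> 0) F"
    by (rule Lim_null_comparison)
  then show ?thesis
    by (simp add: LIM_zero_iff)
qed

text \<open>Arzela--Ascoli type argument: pointwise convergence of uniformly bounded operators is
  uniform on the compact set formed by the values of \<open>u\<close>.\<close>

lemma uniform_tends_init:
  fixes u :: "real \<Rightarrow> cseq"
  assumes u: "\<And>t. u t \<in> carr Y" and cont: "\<And>t. tends Y u (u t) (at t)"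
    and vanish: "\<And>e. e > 0 \<Longrightarrow> \<exists>T. \<forall>t. \<bar>t\<bar> > T \<longrightarrow> nrm Y (u t) \<le> e"
    and "e > 0"
  shows "\<exists>N. \<forall>n\<ge>N. \<forall>t. nrm Y (restr {..<n} (u t) - u t) \<le> e"
proof (rule ccontr)
  assume "\<not> ?thesis"
  then obtain m s where ms: "\<And>N. m N \<ge> N" "\<And>N. nrm Y (restr {..<m N} (u (s N)) - u (s N)) > e"
    by (metis linorder_not_le)
  \<comment> \<open>The error of a projection is at most twice the norm, so \<open>e / 2\<close>
    confines every bad parameter \<open>s N\<close> to a compact interval, where a subsequence
    converges.\<close>
  obtain T where T: "\<And>t. \<bar>t\<bar> > T \<Longrightarrow> nrm Y (u t) \<le> e / 2"
    using vanish[of "e/2"] \<open>e > 0\<close> by auto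
  have "s N \<in> {-T..T}" for N
  proof (rule ccontr)
    assume "\<not> ?thesis"
    then have "nrm Y (u (s N)) \<le> e / 2"
      by (intro T) auto
    moreover have "nrm Y (restr {..<m N} (u (s N)) - u (s N)) \<le> nrm Y (u (s N)) + nrm Y (u (s N))"
      by (intro order.trans[OF nrm_diff] add_right_mono nrm_init init_mem u)
    ultimately show False
      using ms(2)[of N] by linarith
  qed
  then obtain t r where r: "strict_mono (r :: nat \<Rightarrow> nat)" "(s \<circ> r) \<longlonglongrightarrow> t"
    using compact_Icc[of "-T" T] unfolding compact_def by meson
  have lim: "(\<lambda>N. nrm Y (u (s (r N)) - u t)) \<longlonglongrightarrow> 0"
  proof -
    have "isCont (\<lambda>v. nrm Y (u v - u t)) t"
      using cont[of t] unfolding isCont_def tends_def by simp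
    from isCont_tendsto_compose[OF this r(2)] show ?thesis
      by simp
  qed
  have mr: "filterlim (\<lambda>N. m (r N)) at_top sequentially"
    by (intro filterlim_at_top_mono[OF filterlim_subseq[OF r(1)]]) (use ms in auto)
  have "(\<lambda>N. nrm Y (restr {..<m (r N)} (u t) - u t)) \<longlonglongrightarrow> 0"
    using tends_init[OF u, of t] filterlim_compose[OF _ mr] unfolding tends_def by blast
  from tendsto_add[OF tendsto_mult[OF tendsto_const[of 2] lim] this]
  have "(\<lambda>N. 2 * nrm Y (u (s (r N)) - u t) + nrm Y (restr {..<m (r N)} (u t) - u t)) \<longlonglongrightarrow> 0"
    by simp
  then have "\<forall>\<^sub>F N in sequentially. 
      2 * nrm Y (u (s (r N)) - u t) + nrm Y (restr {..<m (r N)} (u t) - u t) < e"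
    using \<open>e > 0\<close> order_tendstoD(2) by blast
  then obtain N where 
    N: "2 * nrm Y (u (s (r N)) - u t) + nrm Y (restr {..<m (r N)} (u t) - u t) < e"
    using eventually_happens' sequentially_bot by blast
  let ?P = "restr {..<m (r N)}" and ?x = "u (s (r N))"
  have "nrm Y (?P ?x - ?x) \<le> nrm Y (?P (?x - u t)) + nrm Y (?P (u t) - ?x)"
    using nrm_add[of "?P (?x - u t)" "?P (u t) - ?x"]
    by (simp add: restr_diff u mem init_mem)
  also have "\<dots> \<le> nrm Y (?x - u t) + (nrm Y (?P (u t) - u t) + nrm Y (u t - ?x))"
    by (intro add_mono nrm_init nrm_triangle u mem init_mem)
  also have "\<dots> < e"
    using N nrm_minus_commute[OF u u] by (smt (verit))
  finally show False
    using ms(2)[of "r N"] by simp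
qed

end


section \<open>Analytic tools: Riemann sums, maximum principle, Cauchy estimate\<close>

section \<open>Scalar tools\<close>

text \<open>On each subinterval the increment of a primitive differs from the corresponding term by
  at most \<open>e / 2 / N\<close>, by uniform continuity; the increments telescope. In
  \<open>Cauchy_lipschitz\<close> this replaces a vector-valued integral by finite linear
  combinations, to which the triangle inequality applies.\<close>

lemma riemann_sums_tendsto:
  fixes f :: "real \<Rightarrow> complex"
  assumes cont: "continuous_on {0..1} f"
  shows "(\<lambda>N. \<Sum>j<N. f (real j / N) / N) \<longlonglongrightarrow> integral {0..1} f"
proof (rule LIMSEQ_I)
  fix e :: real
  assume "e > 0"
  have "uniformly_continuous_on {0..1} f"
    using cont compact_uniformly_continuous by blast
  then obtain d where "d > 0" and d: "\<And>x y. x \<in> {0..1} \<Longrightarrow> y \<in> {0..1} \<Longrightarrow> dist y x < d \<Longrightarrow> dist (f y) (f x) < e / 2"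
    unfolding uniformly_continuous_on_def using half_gt_zero[OF \<open>e > 0\<close>] by metis
  obtain N0 where N0: "1 / real N0 < d" "N0 > 0"
    using \<open>d > 0\<close> by (metis nat_approx_posE of_nat_0_less_iff zero_less_Suc)
  define G where "G x = integral {0..x} f" for x
  have G: "(G has_vector_derivative f x) (at x within {0..1})" if "x \<in> {0..1}" for x
    unfolding G_def by (rule integral_has_vector_derivative[OF cont that])
  show "\<exists>N0::nat. \<forall>N\<ge>N0. norm ((\<Sum>j<N. f (real j / N) / N) - integral {0..1} f) < e"
  proof (intro exI allI impI)
    fix N :: nat
    assume "N \<ge> N0"
    then have N: "N > 0" "1 / real N < d"
      using N0 by (simp_all, smt (verit) frac_le of_nat_0_less_iff of_nat_le_iff)
    have step: "norm (G (Suc j / N) - G (j / N) - f (j / N) / N) \<le> e / 2 / N" if "j < N" for j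
    proof -
      have seg: "closed_segment (j / N) (Suc j / N) = {j / N..Suc j / N}"
        by (simp add: closed_segment_eq_real_ivl divide_right_mono)
      have sub: "{j / N..Suc j / N} \<subseteq> {0..1}"
        using that N by (auto simp: field_simps intro: order_trans)
      have "norm (G (Suc j / N) - G (j / N) - (Suc j / N - j / N) *\<^sub>R f (j / N))
          \<le> norm (Suc j / N - j / N) * (e / 2)"
      proof (rule vector_differentiable_bound_linearization[where S = "{j / N..Suc j / N}"])
        fix x assume x: "x \<in> {j / N..Suc j / N}"
        show "(G has_vector_derivative f x) (at x within {j / N..Suc j / N})"
          using has_vector_derivative_within_subset[OF G sub] x sub by blast
        have "dist x (j / N) < d"
          using x N by (auto simp: dist_real_def add_divide_distrib)
        moreover have "j / real N \<in> {j / N..Suc j / N}"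
          by (simp add: divide_right_mono)
        ultimately have "dist (f x) (f (j / N)) < e / 2"
          using x sub by (intro d) blast+
        then show "norm (f x - f (j / N)) \<le> e / 2"
          by (simp add: dist_norm)
      qed (simp_all add: seg divide_right_mono del: of_nat_Suc)
      moreover have "Suc j / N - j / N = 1 / N"
        by (simp add: diff_divide_distrib[symmetric])
      ultimately show ?thesis
        by (simp only: scaleR_conv_of_real) simp
    qed
    have "(\<Sum>j<N. G (Suc j / N) - G (j / N)) = G 1 - G 0"
      using N by (subst sum_lessThan_telescope) simp
    then have "norm ((\<Sum>j<N. f (j / N) / N) - integral {0..1} f)
        = norm (\<Sum>j<N. G (Suc j / N) - G (j / N) - f (j / N) / N)"
      by (simp add: G_def sum_subtractf norm_minus_commute)
    also have "\<dots> \<le> (\<Sum>j<N. e / 2 / N)"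
      by (intro sum_norm_le step) auto
    also have "\<dots> < e"
      using N \<open>e > 0\<close> by simp
    finally show "norm ((\<Sum>j<N. f (j / N) / N) - integral {0..1} f) < e" .
  qed
qed

lemma open_strip_subset_interior: "{z. 0 < Re z \<and> Re z < 1} \<subseteq> interior strip"
  by (rule interior_maximal)
    (auto simp: strip_def intro!: open_Collect_conj open_Collect_less continuous_intros)

text \<open>A Phragmen-Lindelof argument: a decaying factor reduces the unbounded strip to a
  rectangle. The bound \<open>K\<close> serves only to control the horizontal sides and does not
  enter the conclusion.\<close>

lemma strip_maximum_principle:
  assumes cont: "continuous_on strip f" and hol: "f holomorphic_on interior strip"
    and K: "\<And>z. z \<in> strip \<Longrightarrow> cmod (f z) \<le> K"
    and M: "\<And>t. cmod (f (Complex 0 t)) \<le> M" "\<And>t. cmod (f (Complex 1 t)) \<le> M"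
    and z: "z \<in> strip"
  shows "cmod (f z) \<le> M"
proof (rule field_le_epsilon)
  fix \<eta> :: real
  assume "\<eta> > 0"
  have "M \<ge> 0"
    using M(1)[of 0] norm_ge_zero order_trans by blast
  have "K \<ge> 0"
    using K[OF z] norm_ge_zero order_trans by blast
  \<comment> \<open>The factor \<open>exp (\<epsilon> * (w^2 - 1))\<close> has modulus at most 1 on the strip and decays at both ends.\<close>
  have bound: "cmod (f z * exp (of_real \<epsilon> * (z\<^sup>2 - 1))) \<le> M + \<eta>" if "\<epsilon> > 0" for \<epsilon>
  proof -
    define F where "F w = f w * exp (of_real \<epsilon> * (w\<^sup>2 - 1))" for w
    have modulus: "cmod (F w) = cmod (f w) * exp (\<epsilon> * ((Re w)\<^sup>2 - (Im w)\<^sup>2 - 1))" for w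
      by (simp add: F_def norm_mult norm_exp_eq_Re power2_eq_square)
    have le: "cmod (F w) \<le> cmod (f w) * exp (- \<epsilon> * (Im w)\<^sup>2)" if "w \<in> strip" for w
    proof -
      have "\<epsilon> * (Re w)\<^sup>2 \<le> \<epsilon>"
        using that \<open>\<epsilon> > 0\<close> by (simp add: strip_def power_le_one)
      then show ?thesis
        unfolding modulus by (intro mult_left_mono) (auto simp: algebra_simps)
    qed
    \<comment> \<open>On the horizontal sides only \<open>cmod (f w) \<le> K\<close> is known, so
      the height must be large enough for the decay to beat \<open>K\<close>.\<close>
    obtain T0 where T0: "\<And>t. t \<ge> T0 \<Longrightarrow> K * exp (- \<epsilon> * t\<^sup>2) < \<eta>"
    proof -
      have "filterlim (\<lambda>t::real. \<epsilon> * t\<^sup>2) at_top at_top"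
        using \<open>\<epsilon> > 0\<close> by (intro filterlim_tendsto_pos_mult_at_top[OF tendsto_const] filterlim_pow_at_top filterlim_ident) auto
      then have "((\<lambda>t. exp (- (\<epsilon> * t\<^sup>2))) \<longlongrightarrow> 0) at_top"
        by (intro filterlim_compose[OF exp_at_bot]) (simp add: filterlim_uminus_at_top[symmetric])
      from tendsto_mult[OF tendsto_const[of K] this]
      have "\<forall>\<^sub>F t in at_top. K * exp (- \<epsilon> * t\<^sup>2) < \<eta>"
        using order_tendstoD(2) \<open>\<eta> > 0\<close> by fastforce
      then show thesis
        using that unfolding eventually_at_top_linorder by blast
    qed
    define T where "T = max T0 (\<bar>Im z\<bar> + 1)"
    define R where "R = cbox (Complex 0 (-T)) (Complex 1 T)"
    have R: "R \<subseteq> strip"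
      by (auto simp: R_def strip_def in_cbox_complex_iff)
    have "cmod (F z) \<le> M + \<eta>"
    proof (rule maximum_modulus_frontier[of F R])
      have "interior R \<subseteq> interior strip"
        by (intro interior_mono R)
      then show "F holomorphic_on interior R"
        unfolding F_def by (intro holomorphic_intros holomorphic_on_subset[OF hol])
      have "closure R = R"
        by (simp add: R_def)
      then show "continuous_on (closure R) F"
        unfolding F_def using R by (auto intro!: continuous_intros continuous_on_subset[OF cont])
      show "bounded R"
        by (simp add: R_def)
      show "z \<in> R"
        using z by (auto simp: R_def strip_def in_cbox_complex_iff T_def)
      fix w
      assume "w \<in> frontier R"
      then have w: "w \<in> R" "w \<notin> box (Complex 0 (-T)) (Complex 1 T)"
        by (auto simp: R_def frontier_cbox)
      then have ws: "w \<in> strip"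
        using R by blast
      have "w = Complex 0 (Im w) \<or> w = Complex 1 (Im w) \<or> \<bar>Im w\<bar> = T"
        using w unfolding R_def in_box_complex_iff in_cbox_complex_iff
        by (auto simp: complex_eq_iff)
      then show "cmod (F w) \<le> M + \<eta>"
      proof (elim disjE)
        assume "\<bar>Im w\<bar> = T"
        then have "K * exp (- \<epsilon> * (Im w)\<^sup>2) < \<eta>"
          using T0[of T] by (metis T_def max.cobounded1 power2_abs)
        moreover have "cmod (F w) \<le> K * exp (- \<epsilon> * (Im w)\<^sup>2)"
          by (rule order.trans[OF le[OF ws]]) (intro mult_right_mono K ws, simp)
        ultimately show ?thesis
          using \<open>M \<ge> 0\<close> by linarith
      next
        assume "w = Complex 0 (Im w)"
        then have "cmod (f w) \<le> M"
          using M(1) by metis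
        moreover have "cmod (F w) \<le> cmod (f w) * 1"
          by (rule order.trans[OF le[OF ws]]) (intro mult_left_mono, use \<open>\<epsilon> > 0\<close> in auto)
        ultimately show ?thesis
          using \<open>\<eta> > 0\<close> by linarith
      next
        assume "w = Complex 1 (Im w)"
        then have "cmod (f w) \<le> M"
          using M(2) by metis
        moreover have "cmod (F w) \<le> cmod (f w) * 1"
          by (rule order.trans[OF le[OF ws]]) (intro mult_left_mono, use \<open>\<epsilon> > 0\<close> in auto)
        ultimately show ?thesis
          using \<open>\<eta> > 0\<close> by linarith
      qed
    qed
    then show ?thesis
      by (simp add: F_def)
  qed
  \<comment> \<open>With \<open>z\<close> fixed, the auxiliary factor tends to 1 as
    \<open>\<epsilon>\<close> decreases to 0.\<close>
  have "((\<lambda>\<epsilon>::real. cmod (f z * exp (of_real \<epsilon> * (z\<^sup>2 - 1)))) \<longlongrightarrow> cmod (f z * exp (of_real 0 * (z\<^sup>2 - 1)))) (at_right 0)"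
    by (intro tendsto_intros)
  moreover have "\<forall>\<^sub>F \<epsilon>::real in at_right 0. cmod (f z * exp (of_real \<epsilon> * (z\<^sup>2 - 1))) \<le> M + \<eta>"
    using bound eventually_at_right_less[of 0] by (auto elim: eventually_mono)
  ultimately show "cmod (f z) \<le> M + \<eta>"
    using tendsto_upperbound[of _ _ "at_right (0::real)"] by fastforce
qed


section \<open>A Cauchy estimate for vector-valued functions\<close>

context mspace
begin

text \<open>On finitely many coordinates, convergence of each coordinate forces convergence in
  norm.\<close>

lemma nrm_restr_le_coords: "nrm Y (restr {..<n} v) \<le> (\<Sum>k<n. cmod (v k) * nrm Y (unit_seq k))"
proof -
  have "nrm Y (\<Sum>k<n. cscale (v k) (unit_seq k)) \<le> (\<Sum>k<n. nrm Y (cscale (v k) (unit_seq k)))"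
    by (intro nrm_sum scale_mem unit_mem)
  then show ?thesis
    by (simp add: sum_unit_seq nrm_scale unit_mem)
qed

text \<open>Each coordinate is given by Cauchy's formula. The integral is replaced by Riemann sums,
  which are linear combinations of values of \<open>F\<close>, and the bound for their norms passes to the
  limit because the norm of a vector is the supremum of the norms of its initial segments.\<close>

lemma Cauchy_lipschitz:
  fixes F :: "complex \<Rightarrow> cseq"
  assumes "r > 0" and hol: "\<And>k. (\<lambda>z. F z k) holomorphic_on cball a r"
    and bound: "\<And>z. z \<in> sphere a r \<Longrightarrow> F z \<in> carr Y \<and> nrm Y (F z) \<le> M"
    and w: "w \<in> ball a (r / 2)" "w' \<in> ball a (r / 2)" "F w \<in> carr Y" "F w' \<in> carr Y"
  shows "nrm Y (F w - F w') \<le> 4 * M / r * cmod (w - w')"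
proof -
  define \<gamma> where "\<gamma> = circlepath a r"
  \<comment> \<open>This is the derivative of the circle path times the difference of the two Cauchy
    kernels, with the factor \<open>2 * of_real pi * \<i>\<close> cancelled. Hence the integral of
    \<open>F (\<gamma> t) k * \<kappa> t\<close> over the unit interval is
    \<open>F w k - F w' k\<close>.\<close>
  define \<kappa> where "\<kappa> t = of_real r * exp (2 * of_real pi * \<i> * of_real t) * (1 / (\<gamma> t - w) - 1 / (\<gamma> t - w'))"
    for t
  define x where "x = F w - F w'"
  have x: "x \<in> carr Y"
    unfolding x_def by (intro mem w)
  have M0: "M \<ge> 0"
    using bound[of "a + of_real r"] nrm_ge0[of "F (a + of_real r)"] \<open>r > 0\<close> by (auto simp: dist_norm)
  have \<gamma>: "\<gamma> t \<in> sphere a r" for t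
    using \<open>r > 0\<close> by (auto simp: \<gamma>_def circlepath dist_norm norm_mult norm_exp_eq_Re)
  have far: "cmod (\<gamma> t - v) \<ge> r / 2" if "v \<in> ball a (r / 2)" for t v
  proof -
    have "dist a (\<gamma> t) \<le> dist a v + dist v (\<gamma> t)"
      by (rule dist_triangle)
    then show ?thesis
      using that \<gamma>[of t] by (simp add: dist_norm norm_minus_commute)
  qed
  have ne: "\<gamma> t \<noteq> w" "\<gamma> t \<noteq> w'" for t
    using far[OF w(1), of t] far[OF w(2), of t] \<open>r > 0\<close> by auto
  \<comment> \<open>The constant \<open>4 / r\<close> is the radius divided by the square of
    \<open>r / 2\<close>, the least distance from the circle to points of the half-size
    disc.\<close>
  have \<kappa>: "cmod (\<kappa> t) \<le> 4 / r * cmod (w - w')" for t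
  proof -
    have "cmod (\<kappa> t) = r * (cmod (w - w') / (cmod (\<gamma> t - w) * cmod (\<gamma> t - w')))"
      using ne[of t] \<open>r > 0\<close> unfolding \<kappa>_def
      by (simp add: norm_mult norm_exp_eq_Re diff_frac_eq norm_divide)
    also have "\<dots> \<le> r * (cmod (w - w') / (r / 2 * (r / 2)))"
      using far[OF w(1), of t] far[OF w(2), of t] \<open>r > 0\<close>
      by (intro mult_left_mono divide_left_mono mult_mono mult_pos_pos) auto
    also have "\<dots> = 4 / r * cmod (w - w')"
      using \<open>r > 0\<close> by (simp add: field_simps)
    finally show ?thesis .
  qed
  have cont: "continuous_on {0..1} (\<lambda>t. F (\<gamma> t) k * \<kappa> t)" for k
  proof -
    have "continuous_on {0..1} \<gamma>"
      unfolding \<gamma>_def circlepath by (intro continuous_intros)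
    moreover have "continuous_on {0..1} (\<lambda>t. F (\<gamma> t) k)"
      by (rule continuous_on_compose2[OF holomorphic_on_imp_continuous_on[OF hol[of k]] calculation])
        (use \<gamma> sphere_cball in blast)
    ultimately show ?thesis
      unfolding \<kappa>_def using ne by (intro continuous_intros) auto
  qed
  have int: "integral {0..1} (\<lambda>t. F (\<gamma> t) k * \<kappa> t) = x k" for k
  proof -
    have C: "((\<lambda>u. F u k / (u - v)) has_contour_integral ((2 * of_real pi * \<i>) * F v k)) \<gamma>"
      if "v \<in> ball a (r / 2)" for v
      unfolding \<gamma>_def by (rule Cauchy_integral_circlepath_simple[OF hol])
        (use that \<open>r > 0\<close> in \<open>simp add: dist_norm norm_minus_commute\<close>)
    from has_contour_integral_lmul[OF has_contour_integral_diff[OF C[OF w(1)] C[OF w(2)]], of "1 / (2 * of_real pi * \<i>)"]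
    have "((\<lambda>u. 1 / (2 * of_real pi * \<i>) * (F u k / (u - w) - F u k / (u - w'))) has_contour_integral x k) \<gamma>"
      by (simp add: x_def right_diff_distrib[symmetric] mult.assoc)
    then have "((\<lambda>t. 1 / (2 * of_real pi * \<i>) * (F (\<gamma> t) k / (\<gamma> t - w) - F (\<gamma> t) k / (\<gamma> t - w'))
        * vector_derivative \<gamma> (at t within {0..1})) has_integral x k) {0..1}"
      by (simp add: has_contour_integral_def)
    moreover have cancel: "1 / c * (A / p - A / q) * (c * R * E) = A * (R * E * (1 / p - 1 / q))"
      if "c \<noteq> 0" for c A p q R E :: complex
    proof -
      have "1 / c * (A / p - A / q) * (c * R * E) = (1 / c * c) * (A * (R * E * (1 / p - 1 / q)))"
        by (simp add: divide_inverse algebra_simps)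
      with that show ?thesis
        by simp
    qed
    ultimately have "((\<lambda>t. F (\<gamma> t) k * \<kappa> t) has_integral x k) {0..1}"
    proof (elim has_integral_eq[rotated])
      fix t :: real
      assume "t \<in> {0..1}"
      then have "vector_derivative \<gamma> (at t within {0..1}) = 2 * of_real pi * \<i> * of_real r * exp (2 * of_real pi * \<i> * of_real t)"
        unfolding \<gamma>_def by (subst vector_derivative_circlepath01) auto
      then show "1 / (2 * of_real pi * \<i>) * (F (\<gamma> t) k / (\<gamma> t - w) - F (\<gamma> t) k / (\<gamma> t - w'))
        * vector_derivative \<gamma> (at t within {0..1}) = F (\<gamma> t) k * \<kappa> t"
        unfolding \<kappa>_def using cancel[of "2 * of_real pi * \<i>"] by simp
    qed
    then show ?thesis
      by (rule integral_unique)
  qed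
  define S where "S N = (\<Sum>j<N. cscale (\<kappa> (j / N) / N) (F (\<gamma> (j / N))))" for N :: nat
  have F: "F (\<gamma> t) \<in> carr Y" "nrm Y (F (\<gamma> t)) \<le> M" for t
    using bound[OF \<gamma>] by auto
  have S: "S N \<in> carr Y" for N
    unfolding S_def by (intro mem F)
  let ?K = "4 * M / r * cmod (w - w')"
  have K0: "?K \<ge> 0"
    using M0 \<open>r > 0\<close> by simp
  have S_le: "nrm Y (S N) \<le> ?K" for N
  proof -
    have "nrm Y (S N) \<le> (\<Sum>j<N. nrm Y (cscale (\<kappa> (j / N) / N) (F (\<gamma> (j / N)))))"
      unfolding S_def by (intro nrm_sum mem F)
    also have "\<dots> \<le> (\<Sum>j<N. 4 / r * cmod (w - w') / N * M)"
    proof (rule sum_mono)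
      fix j
      have "cmod (\<kappa> (j / N)) / N * nrm Y (F (\<gamma> (j / N))) \<le> 4 / r * cmod (w - w') / N * M"
        using \<open>r > 0\<close> by (intro mult_mono divide_right_mono \<kappa> F nrm_ge0) auto
      then show "nrm Y (cscale (\<kappa> (j / N) / N) (F (\<gamma> (j / N)))) \<le> 4 / r * cmod (w - w') / N * M"
        by (simp add: nrm_scale F norm_divide)
    qed
    also have "\<dots> \<le> ?K"
      using K0 by (cases "N = 0") (auto simp: field_simps)
    finally show ?thesis .
  qed
  have lim: "(\<lambda>N. S N k) \<longlonglongrightarrow> x k" for k
  proof -
    have "S N k = (\<Sum>j<N. F (\<gamma> (j / N)) k * \<kappa> (j / N) / N)" for N :: nat
      unfolding S_def sum_seq_apply by (simp add: mult.commute)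
    then show ?thesis
      using riemann_sums_tendsto[OF cont[of k]] by (simp add: int)
  qed
  \<comment> \<open>The Riemann sums are bounded in norm but known to converge only coordinatewise.
    Cutting to \<open>n\<close> coordinates turns this into norm convergence, with a bound
    independent of \<open>n\<close>.\<close>
  have init_le: "nrm Y (restr {..<n} x) \<le> ?K" for n
  proof -
    have "(\<lambda>N. ?K + (\<Sum>k<n. cmod (x k - S N k) * nrm Y (unit_seq k))) \<longlonglongrightarrow>
        ?K + (\<Sum>k<n. cmod (x k - x k) * nrm Y (unit_seq k))"
      by (intro tendsto_intros lim)
    moreover have "nrm Y (restr {..<n} x) \<le> ?K + (\<Sum>k<n. cmod (x k - S N k) * nrm Y (unit_seq k))" for N
    proof -
      have "nrm Y (restr {..<n} x) \<le> nrm Y (restr {..<n} (S N)) + nrm Y (restr {..<n} (x - S N))"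
        unfolding restr_diff by (intro nrm_le_add_diff init_mem x S)
      also have "\<dots> \<le> ?K + (\<Sum>k<n. cmod ((x - S N) k) * nrm Y (unit_seq k))"
        by (intro add_mono nrm_restr_le_coords order.trans[OF nrm_init S_le] S)
      finally show ?thesis
        by simp
    qed
    ultimately show ?thesis
      using LIMSEQ_le_const by fastforce
  qed
  have "(\<lambda>n. nrm Y (restr {..<n} x)) \<longlonglongrightarrow> nrm Y x"
    by (rule tends_nrm[OF tends_init[OF x]])
  then show ?thesis
    using LIMSEQ_le_const2 init_le unfolding x_def by blast
qed

end


section \<open>Completeness and the sum of a couple\<close>

section \<open>Banach spaces with a monotone basis\<close>

text \<open>Completeness is stated for geometrically fast sequences: in a sum of two spaces their
  increments can be split one by one without losing the rate.\<close>

locale bspace = mspace +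
  assumes complete: "\<And>s K. (\<And>n. s n \<in> carr Y) \<Longrightarrow>
      (\<And>n. nrm Y (s (Suc n) - s n) \<le> K * (1 / 2) ^ n) \<Longrightarrow> \<exists>l. tends Y s l sequentially"

lemma bspace_monotone_basis:
  assumes "monotone_basis_space X"
  shows "bspace X"
proof -
  interpret nspace X
    using assms by unfold_locales (simp add: monotone_basis_space_def banach_space_def)
  show ?thesis
  proof
    show unit: "unit_seq k \<in> carr X" for k
      using assms by (simp add: monotone_basis_space_def schauder_basis_def)
    show "restr {..<n} x \<in> carr X" if "x \<in> carr X" for x n
      using sum_mem[of "{..<n}" "\<lambda>k. cscale (x k) (unit_seq k)"] scale_mem[OF unit] by (simp add: sum_unit_seq)
    show "nrm X (restr {..<n} x) \<le> nrm X x" if "x \<in> carr X" for x n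
      using assms that by (simp add: monotone_basis_space_def sum_unit_seq)
    show "tends X (\<lambda>n. restr {..<n} x) x sequentially" if "x \<in> carr X" for x
      using assms that unfolding tends_iff[symmetric]
      by (simp add: monotone_basis_space_def schauder_basis_def sum_unit_seq)
    show "\<exists>l. tends X s l sequentially"
      if s: "\<And>n. s n \<in> carr X" and step: "\<And>n. nrm X (s (Suc n) - s n) \<le> K * (1 / 2) ^ n" for s K
    proof -
      define T where "T n = (\<Sum>i<n. K * (1 / 2) ^ i)" for n
      have "K \<ge> 0"
        using step[of 0] nrm_ge0[OF diff_mem[OF s s], of 1 0] by simp
      have le: "nrm X (s n - s m) \<le> T n - T m" if "m \<le> n" for m n
        using that
      proof (induction n rule: dec_induct)
        case base
        show ?case
          by (simp only: diff_self nrm_zero order_refl)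
      next
        case (step n)
        have "nrm X (s (Suc n) - s m) \<le> nrm X (s (Suc n) - s n) + nrm X (s n - s m)"
          by (intro nrm_triangle s)
        then show ?case
          using step.IH \<open>\<And>n. nrm X (s (Suc n) - s n) \<le> K * (1 / 2) ^ n\<close>[of n]
          unfolding T_def sum.lessThan_Suc by linarith
      qed
      have "summable (\<lambda>i. K * (1 / 2 :: real) ^ i)"
        by (intro summable_mult summable_geometric) simp
      then have "Cauchy T"
        unfolding T_def summable_iff_convergent by (rule convergent_Cauchy)
      have "M.MCauchy s"
        unfolding M.MCauchy_def
      proof (intro conjI allI impI)
        show "range s \<subseteq> carr X"
          using s by blast
        fix e :: real
        assume "e > 0"
        with \<open>Cauchy T\<close> obtain N where N: "\<And>m n. m \<ge> N \<Longrightarrow> n \<ge> N \<Longrightarrow> dist (T m) (T n) < e"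
          unfolding Cauchy_def by blast
        have "sdist X (s n) (s m) < e" if "m \<ge> N" "n \<ge> N" for m n
        proof (cases "m \<le> n")
          case True
          then show ?thesis
            using le[OF True] N[OF that(1,2)] by (simp add: sdist_def s dist_real_def)
        next
          case False
          then show ?thesis
            using le[of n m] N[OF that(1,2)] nrm_minus_commute[OF s s, of n m]
            by (simp add: sdist_def s dist_real_def)
        qed
        then show "\<exists>N. \<forall>n n'. N \<le> n \<longrightarrow> N \<le> n' \<longrightarrow> sdist X (s n) (s n') < e"
          by blast
      qed
      moreover have "M.mcomplete"
        using assms by (simp add: monotone_basis_space_def banach_space_def)
      ultimately show ?thesis
        unfolding M.mcomplete_def tends_iff[symmetric] norm_topology_def by blast
    qed
  qed
qed


section \<open>The sum of a couple\<close>

locale couple = X0: bspace X0 + X1: bspace X1 for X0 X1 +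
  fixes \<theta> :: real
  assumes \<theta>: "0 < \<theta>" "\<theta> < 1"
begin

abbreviation S :: cspace where "S \<equiv> sum_space X0 X1"

lemma carr_sum: "carr S = {a + b | a b. a \<in> carr X0 \<and> b \<in> carr X1}"
  and nrm_sum: "nrm S x = Inf {nrm X0 a + nrm X1 b | a b. a \<in> carr X0 \<and> b \<in> carr X1 \<and> x = a + b}"
  by (simp_all add: sum_space_def)

lemma sum_memI: "a \<in> carr X0 \<Longrightarrow> b \<in> carr X1 \<Longrightarrow> a + b \<in> carr S"
  by (auto simp: carr_sum)

lemma nrm_sum_le: "a \<in> carr X0 \<Longrightarrow> b \<in> carr X1 \<Longrightarrow> nrm S (a + b) \<le> nrm X0 a + nrm X1 b"
  unfolding nrm_sum
  by (rule cInf_lower) (auto intro!: bdd_belowI[of _ 0] add_nonneg_nonneg X0.nrm_ge0 X1.nrm_ge0)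

lemma nrm_sum_approx:
  assumes "x \<in> carr S" "e > 0"
  obtains a b where "a \<in> carr X0" "b \<in> carr X1" "x = a + b" "nrm X0 a + nrm X1 b < nrm S x + e"
proof -
  let ?A = "{nrm X0 a + nrm X1 b | a b. a \<in> carr X0 \<and> b \<in> carr X1 \<and> x = a + b}"
  have "?A \<noteq> {}"
    using assms(1) by (auto simp: carr_sum)
  moreover have "Inf ?A < nrm S x + e"
    using assms(2) by (simp add: nrm_sum)
  ultimately obtain v where "v \<in> ?A" "v < nrm S x + e"
    using cInf_lessD by meson
  then show thesis
    using that by auto
qed

lemma nrm_sum_ge0:
  assumes "x \<in> carr S"
  shows "0 \<le> nrm S x"
proof (rule field_le_epsilon)
  fix e :: real
  assume "e > 0"
  then obtain a b where "a \<in> carr X0" "b \<in> carr X1" "nrm X0 a + nrm X1 b < nrm S x + e"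
    using nrm_sum_approx[OF assms] by metis
  then show "0 \<le> nrm S x + e"
    using X0.nrm_ge0[of a] X1.nrm_ge0[of b] by linarith
qed

lemma nrm_sum_add:
  assumes "x \<in> carr S" "y \<in> carr S"
  shows "x + y \<in> carr S" "nrm S (x + y) \<le> nrm S x + nrm S y"
proof -
  have split: "x + y \<in> carr S \<and> nrm S (x + y) \<le> nrm S x + nrm S y + e" if "e > 0" for e
  proof -
    have "e / 2 > 0"
      using that by simp
    then obtain a b a' b' where ab: "a \<in> carr X0" "b \<in> carr X1" "x = a + b" "nrm X0 a + nrm X1 b < nrm S x + e / 2"
      and ab': "a' \<in> carr X0" "b' \<in> carr X1" "y = a' + b'" "nrm X0 a' + nrm X1 b' < nrm S y + e / 2"
      using nrm_sum_approx assms by metis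
    have eq: "x + y = (a + a') + (b + b')"
      using ab ab' by simp
    have m: "a + a' \<in> carr X0" "b + b' \<in> carr X1"
      using ab ab' by (simp_all add: X0.mem X1.mem)
    have "nrm S (x + y) \<le> nrm X0 (a + a') + nrm X1 (b + b')"
      unfolding eq by (rule nrm_sum_le[OF m])
    also have "\<dots> \<le> (nrm X0 a + nrm X0 a') + (nrm X1 b + nrm X1 b')"
      by (intro add_mono X0.nrm_add X1.nrm_add ab ab')
    finally have "nrm S (x + y) \<le> nrm S x + nrm S y + e"
      using ab(4) ab'(4) by linarith
    then show ?thesis
      using sum_memI[OF m] eq by metis
  qed
  show "x + y \<in> carr S"
    using split[of 1] by simp
  show "nrm S (x + y) \<le> nrm S x + nrm S y"
    by (rule field_le_epsilon) (use split in blast)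
qed

lemma sum_bounded_linear:
  assumes lin: "\<And>x y. T (x + y) = T x + T y"
    and T0: "\<And>x. x \<in> carr X0 \<Longrightarrow> T x \<in> carr X0 \<and> nrm X0 (T x) \<le> c * nrm X0 x"
    and T1: "\<And>x. x \<in> carr X1 \<Longrightarrow> T x \<in> carr X1 \<and> nrm X1 (T x) \<le> c * nrm X1 x"
    and c: "c \<ge> 0" and x: "x \<in> carr S"
  shows "T x \<in> carr S" "nrm S (T x) \<le> c * nrm S x"
proof -
  have split: "T x \<in> carr S \<and> nrm S (T x) \<le> c * nrm S x + e" if "e > 0" for e
  proof -
    \<comment> \<open>The denominator is \<open>c + 1\<close> because \<open>c\<close> may be 0; the
      error then becomes \<open>c * e / (c + 1)\<close>, which is at most \<open>e\<close>.\<close>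
    have "e / (c + 1) > 0"
      using that c by simp
    then obtain a b where ab: "a \<in> carr X0" "b \<in> carr X1" "x = a + b"
      "nrm X0 a + nrm X1 b < nrm S x + e / (c + 1)"
      using nrm_sum_approx[OF x] by metis
    have "nrm S (T x) \<le> nrm X0 (T a) + nrm X1 (T b)"
      unfolding ab(3) lin using T0 T1 ab by (intro nrm_sum_le) auto
    also have "\<dots> \<le> c * nrm X0 a + c * nrm X1 b"
      using T0 T1 ab by (intro add_mono) auto
    also have "\<dots> \<le> c * (nrm S x + e / (c + 1))"
      unfolding distrib_left[symmetric] using ab c by (intro mult_left_mono) auto
    also have "\<dots> \<le> c * nrm S x + e"
      using that c by (simp add: field_simps)
    finally show ?thesis
      unfolding ab(3) lin using T0 T1 ab by (intro conjI sum_memI) auto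
  qed
  show "T x \<in> carr S"
    using split[of 1] by simp
  show "nrm S (T x) \<le> c * nrm S x"
    by (rule field_le_epsilon) (use split in blast)
qed

lemma sum_scale:
  assumes "x \<in> carr S"
  shows "cscale c x \<in> carr S" "nrm S (cscale c x) \<le> cmod c * nrm S x"
  using sum_bounded_linear[of "cscale c" "cmod c" x]
  by (simp_all add: cscale_add X0.scale_mem X1.scale_mem X0.nrm_scale X1.nrm_scale assms)

text \<open>The infimum defining the sum norm is definite because every coordinate is continuous on
  both summands.\<close>

lemma sum_coord_bound:
  obtains c where "\<And>x. x \<in> carr S \<Longrightarrow> cmod (x k) \<le> c * nrm S x"
proof
  define c where "c = max (2 / nrm X0 (unit_seq k)) (2 / nrm X1 (unit_seq k))"
  have c0: "c \<ge> 0"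
    using X0.unit_pos[of k] by (simp add: c_def le_max_iff_disj)
  fix x
  assume x: "x \<in> carr S"
  show "cmod (x k) \<le> c * nrm S x"
  proof (rule field_le_epsilon)
    fix e :: real
    assume "e > 0"
    then have "e / (c + 1) > 0"
      using c0 by simp
    then obtain a b where ab: "a \<in> carr X0" "b \<in> carr X1" "x = a + b"
      "nrm X0 a + nrm X1 b < nrm S x + e / (c + 1)"
      using nrm_sum_approx[OF x] by metis
    have "cmod (x k) \<le> cmod (a k) + cmod (b k)"
      using norm_triangle_ineq by (simp add: ab(3))
    also have "\<dots> \<le> c * nrm X0 a + c * nrm X1 b"
    proof (intro add_mono)
      show "cmod (a k) \<le> c * nrm X0 a"
        by (rule order.trans[OF X0.coord_bound[OF ab(1)] mult_right_mono])
          (auto simp: c_def X0.nrm_ge0 ab)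
      show "cmod (b k) \<le> c * nrm X1 b"
        by (rule order.trans[OF X1.coord_bound[OF ab(2)] mult_right_mono])
          (auto simp: c_def X1.nrm_ge0 ab)
    qed
    also have "\<dots> \<le> c * (nrm S x + e / (c + 1))"
      unfolding distrib_left[symmetric] using ab c0 by (intro mult_left_mono) auto
    also have "\<dots> \<le> c * nrm S x + e"
      using \<open>e > 0\<close> c0 by (simp add: field_simps)
    finally show "cmod (x k) \<le> c * nrm S x + e" .
  qed
qed

sublocale S: nspace S
proof (unfold_locales, unfold normed_space_def, intro conjI ballI allI)
  have zero: "0 \<in> carr S"
    using sum_memI[OF X0.zero_mem X1.zero_mem] by simp
  show "cseq.subspace (carr S)"
    unfolding cseq.subspace_def using zero nrm_sum_add(1) sum_scale(1) by blast
  fix x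
  assume x: "x \<in> carr S"
  show "0 \<le> nrm S x"
    by (rule nrm_sum_ge0[OF x])
  show "nrm S x = 0 \<longleftrightarrow> x = 0"
  proof
    assume "nrm S x = 0"
    then have "cmod (x k) \<le> 0" for k
      using sum_coord_bound[of k] x by (metis mult_zero_right)
    then show "x = 0"
      by (auto simp: fun_eq_iff)
  next
    assume "x = 0"
    moreover have "nrm S 0 \<le> 0"
      using nrm_sum_le[OF X0.zero_mem X1.zero_mem] by simp
    ultimately show "nrm S x = 0"
      using nrm_sum_ge0[OF zero] by simp
  qed
  fix c
  show "nrm S (cscale c x) = cmod c * nrm S x"
  proof (cases "c = 0")
    case True
    have "nrm S 0 \<le> 0"
      using nrm_sum_le[OF X0.zero_mem X1.zero_mem] by simp
    with True show ?thesis
      using nrm_sum_ge0[OF zero] by simp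
  next
    case False
    have "nrm S x \<le> cmod (inverse c) * nrm S (cscale c x)"
      using sum_scale(2)[OF sum_scale(1)[OF x, of c], of "inverse c"] False by simp
    then have "cmod c * nrm S x \<le> cmod c * (cmod (inverse c) * nrm S (cscale c x))"
      by (intro mult_left_mono) auto
    also have "\<dots> = nrm S (cscale c x)"
      using False by (simp add: norm_inverse)
    finally have "cmod c * nrm S x \<le> nrm S (cscale c x)" .
    then show ?thesis
      using sum_scale(2)[OF x, of c] by linarith
  qed
next
  fix x y
  assume "x \<in> carr S" "y \<in> carr S"
  then show "nrm S (x + y) \<le> nrm S x + nrm S y"
    by (rule nrm_sum_add(2))
qed

lemma X0_sum: "x \<in> carr X0 \<Longrightarrow> x \<in> carr S" "x \<in> carr X0 \<Longrightarrow> nrm S x \<le> nrm X0 x"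
  using sum_memI[OF _ X1.zero_mem] nrm_sum_le[OF _ X1.zero_mem] by fastforce+

lemma X1_sum: "x \<in> carr X1 \<Longrightarrow> x \<in> carr S" "x \<in> carr X1 \<Longrightarrow> nrm S x \<le> nrm X1 x"
  using sum_memI[OF X0.zero_mem] nrm_sum_le[OF X0.zero_mem] by fastforce+

lemma tends_X0_sum: "tends X0 f l F \<Longrightarrow> tends S f l F"
  using S.tends_bounded_linear[OF X0.nspace_axioms, of f l F "\<lambda>x. x" 1] X0_sum by simp

lemma tends_X1_sum: "tends X1 f l F \<Longrightarrow> tends S f l F"
  using S.tends_bounded_linear[OF X1.nspace_axioms, of f l F "\<lambda>x. x" 1] X1_sum by simp

sublocale S: bspace S
proof
  show "unit_seq k \<in> carr S" for k
    by (rule X0_sum(1)[OF X0.unit_mem])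
  show "restr {..<n} x \<in> carr S" if "x \<in> carr S" for x n
    using sum_bounded_linear(1)[of "restr {..<n}" 1 x]
    by (simp add: restr_add X0.init_mem X1.init_mem X0.nrm_init X1.nrm_init that)
  show "nrm S (restr {..<n} x) \<le> nrm S x" if "x \<in> carr S" for x n
    using sum_bounded_linear(2)[of "restr {..<n}" 1 x]
    by (simp add: restr_add X0.init_mem X1.init_mem X0.nrm_init X1.nrm_init that)
  show "tends S (\<lambda>n. restr {..<n} x) x sequentially" if x: "x \<in> carr S" for x
  proof -
    obtain a b where ab: "a \<in> carr X0" "b \<in> carr X1" "x = a + b"
      by (rule nrm_sum_approx[OF x zero_less_one])
    show ?thesis
      unfolding ab(3) restr_add
      by (intro S.tends_add tends_X0_sum tends_X1_sum X0.tends_init X1.tends_init ab)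
  qed
  fix s K
  assume s: "\<And>n. s n \<in> carr S" and step: "\<And>n. nrm S (s (Suc n) - s n) \<le> K * (1 / 2) ^ n"
  \<comment> \<open>Splitting each increment up to an error \<open>(1 / 2) ^ n\<close> keeps the
    geometric rate, with \<open>K + 1\<close> in place of \<open>K\<close>, so both series of
    components converge.\<close>
  have "\<exists>a b. a \<in> carr X0 \<and> b \<in> carr X1 \<and> s (Suc n) - s n = a + b
      \<and> nrm X0 a + nrm X1 b < (K + 1) * (1 / 2) ^ n" for n
  proof -
    have "(1 / 2 :: real) ^ n > 0"
      by simp
    then obtain a b where "a \<in> carr X0" "b \<in> carr X1" "s (Suc n) - s n = a + b"
      "nrm X0 a + nrm X1 b < nrm S (s (Suc n) - s n) + (1 / 2) ^ n"
      using nrm_sum_approx[OF S.diff_mem[OF s s]] by metis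
    then show ?thesis
      using step[of n] by (intro exI[of _ a] exI[of _ b]) (simp add: distrib_right)
  qed
  then obtain a b where ab: "\<And>n. a n \<in> carr X0" "\<And>n. b n \<in> carr X1" "\<And>n. s (Suc n) - s n = a n + b n"
    "\<And>n. nrm X0 (a n) + nrm X1 (b n) < (K + 1) * (1 / 2) ^ n"
    by metis
  have "nrm X0 (a n) \<le> (K + 1) * (1 / 2) ^ n" "nrm X1 (b n) \<le> (K + 1) * (1 / 2) ^ n" for n
    using ab(4)[of n] X0.nrm_ge0[OF ab(1)[of n]] X1.nrm_ge0[OF ab(2)[of n]] by linarith+
  then obtain la lb where "tends X0 (\<lambda>N. \<Sum>n<N. a n) la sequentially" "tends X1 (\<lambda>N. \<Sum>n<N. b n) lb sequentially"
    using X0.complete[of "\<lambda>N. \<Sum>n<N. a n" "K + 1"] X1.complete[of "\<lambda>N. \<Sum>n<N. b n" "K + 1"]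
    by (auto simp: X0.sum_mem X1.sum_mem ab)
  then have "tends S (\<lambda>N. s 0 + ((\<Sum>n<N. a n) + (\<Sum>n<N. b n))) (s 0 + (la + lb)) sequentially"
    by (intro S.tends_add S.tends_const s tends_X0_sum tends_X1_sum)
  moreover have "s 0 + ((\<Sum>n<N. a n) + (\<Sum>n<N. b n)) = s N" for N
    using sum_lessThan_telescope[of s N] by (simp add: ab(3) sum.distrib[symmetric])
  ultimately show "\<exists>l. tends S s l sequentially"
    by auto
qed

end


section \<open>Admissible functions and the interpolation space\<close>

section \<open>Derivatives and boundary values\<close>

context nspace
begin

lemma has_deriv_iff:
  "has_deriv Y g d z \<longleftrightarrow> tends Y (\<lambda>w. cscale (inverse (w - z)) (g w - g z)) d (at z)"
  by (simp add: has_deriv_def tends_iff)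

lemma has_deriv_unique: "has_deriv Y g d z \<Longrightarrow> has_deriv Y g d' z \<Longrightarrow> d = d'"
  unfolding has_deriv_iff by (rule tends_unique) auto

lemma vderiv_eq: "has_deriv Y g d z \<Longrightarrow> vderiv Y g z = d"
  unfolding vderiv_def using has_deriv_unique by blast

lemma has_deriv_mem: "has_deriv Y g d z \<Longrightarrow> d \<in> carr Y"
  by (simp add: has_deriv_iff tends_def)

lemma has_deriv_add:
  assumes "has_deriv Y g d z" "has_deriv Y h e z"
  shows "has_deriv Y (\<lambda>w. g w + h w) (d + e) z"
proof -
  have "tends Y (\<lambda>w. cscale (inverse (w - z)) (g w - g z) + cscale (inverse (w - z)) (h w - h z)) (d + e) (at z)"
    using assms unfolding has_deriv_iff by (rule tends_add)
  moreover have "cscale (inverse (w - z)) (g w - g z) + cscale (inverse (w - z)) (h w - h z)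
      = cscale (inverse (w - z)) (g w + h w - (g z + h z))" for w
    by (auto simp: fun_eq_iff algebra_simps)
  ultimately show ?thesis
    unfolding has_deriv_iff by simp
qed

lemma has_deriv_mult:
  assumes "(\<phi> has_field_derivative \<phi>') (at z)" and "has_deriv Y g d z" and "g z \<in> carr Y"
  shows "has_deriv Y (\<lambda>w. cscale (\<phi> w) (g w)) (cscale (\<phi> z) d + cscale \<phi>' (g z)) z"
proof -
  have "tends Y (\<lambda>w. cscale (\<phi> w) (cscale (inverse (w - z)) (g w - g z))
      + cscale ((\<phi> w - \<phi> z) / (w - z)) (g z)) (cscale (\<phi> z) d + cscale \<phi>' (g z)) (at z)"
    using assms DERIV_isCont[OF assms(1)] unfolding has_deriv_iff
    by (intro tends_add tends_scale tends_const) (auto simp: isCont_def has_field_derivative_iff)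
  moreover have "cscale (\<phi> w) (cscale (inverse (w - z)) (g w - g z)) + cscale ((\<phi> w - \<phi> z) / (w - z)) (g z)
      = cscale (inverse (w - z)) (cscale (\<phi> w) (g w) - cscale (\<phi> z) (g z))" for w
    by (auto simp: fun_eq_iff algebra_simps divide_inverse)
  ultimately show ?thesis
    unfolding has_deriv_iff by simp
qed

lemma has_deriv_cong:
  assumes "\<forall>\<^sub>F w in at z. g w = h w" "g z = h z" "has_deriv Y g d z"
  shows "has_deriv Y h d z"
  using assms(3) unfolding has_deriv_iff
  by (rule tends_cong[rotated]) (use assms(1,2) in \<open>auto elim: eventually_mono\<close>)

lemma boundary_ok_iff:
  "boundary_ok Y g j \<longleftrightarrow> (\<forall>t. g (Complex j t) \<in> carr Y) \<and> (\<exists>C. \<forall>t. nrm Y (g (Complex j t)) \<le> C)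
     \<and> (\<forall>t. tends Y (\<lambda>s. g (Complex j s)) (g (Complex j t)) (at t))"
  using continuous_map_iff[of UNIV "\<lambda>t. g (Complex j t)"] by (auto simp: boundary_ok_def)

end

lemma (in mspace) has_deriv_coord:
  assumes "has_deriv Y g d z"
  shows "((\<lambda>w. g w k) has_field_derivative d k) (at z)"
  using tends_coord[OF assms[unfolded has_deriv_iff], of k]
  by (simp add: has_field_derivative_iff divide_inverse mult.commute)


section \<open>Analytic functions on the strip\<close>

lemma Complex_strip: "Complex 0 t \<in> strip" "Complex 1 t \<in> strip"
  by (simp_all add: strip_def)

context couple
begin

abbreviation H :: "(complex \<Rightarrow> cseq) set" where "H \<equiv> H_space X0 X1"
abbreviation Hnorm :: "(complex \<Rightarrow> cseq) \<Rightarrow> real" where "Hnorm \<equiv> H_norm X0 X1"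
abbreviation \<Theta> :: complex where "\<Theta> \<equiv> complex_of_real \<theta>"

lemma \<Theta>_interior: "\<Theta> \<in> interior strip"
  using open_strip_subset_interior \<theta> by auto

lemma \<Theta>_strip: "\<Theta> \<in> strip"
  using \<Theta>_interior interior_subset by blast

lemma H_iff:
  "g \<in> H \<longleftrightarrow> (\<forall>z\<in>strip. g z \<in> carr S) \<and> (\<exists>C. \<forall>z\<in>strip. nrm S (g z) \<le> C)
     \<and> (\<forall>z\<in>strip. tends S g (g z) (at z within strip))
     \<and> (\<forall>z\<in>interior strip. \<exists>d. has_deriv S g d z) \<and> boundary_ok X0 g 0 \<and> boundary_ok X1 g 1"
  unfolding H_space_def mem_Collect_eq S.continuous_map_iff by blast

lemma HI:
  assumes "\<And>z. z \<in> strip \<Longrightarrow> g z \<in> carr S" "\<And>z. z \<in> strip \<Longrightarrow> nrm S (g z) \<le> C"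
    and "\<And>z. z \<in> strip \<Longrightarrow> tends S g (g z) (at z within strip)"
    and "\<And>z. z \<in> interior strip \<Longrightarrow> \<exists>d. has_deriv S g d z"
    and "\<And>t. g (Complex 0 t) \<in> carr X0" "\<And>t. nrm X0 (g (Complex 0 t)) \<le> C0"
    and "\<And>t. tends X0 (\<lambda>s. g (Complex 0 s)) (g (Complex 0 t)) (at t)"
    and "\<And>t. g (Complex 1 t) \<in> carr X1" "\<And>t. nrm X1 (g (Complex 1 t)) \<le> C1"
    and "\<And>t. tends X1 (\<lambda>s. g (Complex 1 s)) (g (Complex 1 t)) (at t)"
  shows "g \<in> H"
  unfolding H_iff X0.boundary_ok_iff X1.boundary_ok_iff using assms by blast

lemma H_mem: "g \<in> H \<Longrightarrow> z \<in> strip \<Longrightarrow> g z \<in> carr S"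
  and H_tends: "g \<in> H \<Longrightarrow> z \<in> strip \<Longrightarrow> tends S g (g z) (at z within strip)"
  and H_mem0: "g \<in> H \<Longrightarrow> g (Complex 0 t) \<in> carr X0"
  and H_mem1: "g \<in> H \<Longrightarrow> g (Complex 1 t) \<in> carr X1"
  and H_tends0: "g \<in> H \<Longrightarrow> tends X0 (\<lambda>s. g (Complex 0 s)) (g (Complex 0 t)) (at t)"
  and H_tends1: "g \<in> H \<Longrightarrow> tends X1 (\<lambda>s. g (Complex 1 s)) (g (Complex 1 t)) (at t)"
  by (simp_all add: H_iff X0.boundary_ok_iff X1.boundary_ok_iff)

lemma H_bound:
  assumes "g \<in> H"
  obtains C where "\<And>z. z \<in> strip \<Longrightarrow> nrm S (g z) \<le> C"
  using assms unfolding H_iff by blast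

lemma H_has_deriv: "g \<in> H \<Longrightarrow> z \<in> interior strip \<Longrightarrow> has_deriv S g (vderiv S g z) z"
  using S.vderiv_eq unfolding H_iff by metis

lemma Hnorm_bdd:
  assumes "g \<in> H"
  shows "bdd_above (range (\<lambda>t. nrm X0 (g (Complex 0 t))) \<union> range (\<lambda>t. nrm X1 (g (Complex 1 t))))"
proof -
  obtain C0 C1 where "\<And>t. nrm X0 (g (Complex 0 t)) \<le> C0" "\<And>t. nrm X1 (g (Complex 1 t)) \<le> C1"
    using assms unfolding H_iff X0.boundary_ok_iff X1.boundary_ok_iff by blast
  then show ?thesis
    by (intro bdd_aboveI[of _ "max C0 C1"]) (auto simp: le_max_iff_disj)
qed

lemma Hnorm_ge:
  assumes "g \<in> H"
  shows "nrm X0 (g (Complex 0 t)) \<le> Hnorm g" "nrm X1 (g (Complex 1 t)) \<le> Hnorm g"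
  unfolding H_norm_def by (intro cSup_upper Hnorm_bdd assms; simp)+

lemma Hnorm_ge0: "g \<in> H \<Longrightarrow> 0 \<le> Hnorm g"
  using Hnorm_ge(1)[of g 0] X0.nrm_ge0[OF H_mem0[of g 0]] by simp

lemma Hnorm_le:
  assumes "\<And>t. nrm X0 (g (Complex 0 t)) \<le> c" "\<And>t. nrm X1 (g (Complex 1 t)) \<le> c"
  shows "Hnorm g \<le> c"
  unfolding H_norm_def using assms by (intro cSup_least) auto

lemma H_const:
  assumes "x \<in> carr X0" "x \<in> carr X1"
  shows "(\<lambda>_. x) \<in> H"
proof (rule HI)
  show "\<exists>d. has_deriv S (\<lambda>_. x) d z" for z
    by (rule exI[of _ 0]) (simp add: S.has_deriv_iff S.tends_const S.zero_mem)
qed (use assms in \<open>auto intro: X0_sum S.tends_const X0.tends_const X1.tends_const\<close>)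

lemma H_add:
  assumes "g \<in> H" "h \<in> H"
  shows "(\<lambda>z. g z + h z) \<in> H" "Hnorm (\<lambda>z. g z + h z) \<le> Hnorm g + Hnorm h"
proof -
  obtain C D where C: "\<And>z. z \<in> strip \<Longrightarrow> nrm S (g z) \<le> C" and D: "\<And>z. z \<in> strip \<Longrightarrow> nrm S (h z) \<le> D"
    using H_bound[OF assms(1)] H_bound[OF assms(2)] by metis
  have le0: "nrm X0 (g (Complex 0 t) + h (Complex 0 t)) \<le> Hnorm g + Hnorm h" for t
    by (intro order.trans[OF X0.nrm_add] add_mono Hnorm_ge H_mem0 assms)
  have le1: "nrm X1 (g (Complex 1 t) + h (Complex 1 t)) \<le> Hnorm g + Hnorm h" for t
    by (intro order.trans[OF X1.nrm_add] add_mono Hnorm_ge H_mem1 assms)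
  show "(\<lambda>z. g z + h z) \<in> H"
  proof (rule HI[OF _ _ _ _ _ le0 _ _ le1])
    show "nrm S (g z + h z) \<le> C + D" if "z \<in> strip" for z
      using that by (intro order.trans[OF S.nrm_add] add_mono C D H_mem assms)
    show "\<exists>d. has_deriv S (\<lambda>z. g z + h z) d z" if "z \<in> interior strip" for z
      using S.has_deriv_add H_has_deriv that assms by blast
  qed (intro S.add_mem X0.add_mem X1.add_mem S.tends_add X0.tends_add X1.tends_add
      H_mem H_mem0 H_mem1 H_tends H_tends0 H_tends1 assms; assumption)+
  show "Hnorm (\<lambda>z. g z + h z) \<le> Hnorm g + Hnorm h"
    by (rule Hnorm_le[OF le0 le1])
qed

text \<open>Scalar factors enter through this lemma: the Gaussian that makes boundary values decay
  and the exponential that balances the two boundary lines.\<close>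

lemma H_mult:
  assumes "g \<in> H" and cont: "continuous_on strip \<phi>" and hol: "\<phi> holomorphic_on interior strip"
    and bound: "\<And>z. z \<in> strip \<Longrightarrow> cmod (\<phi> z) \<le> K"
  shows "(\<lambda>z. cscale (\<phi> z) (g z)) \<in> H"
proof -
  obtain C where C: "\<And>z. z \<in> strip \<Longrightarrow> nrm S (g z) \<le> C"
    using H_bound[OF assms(1)] by metis
  have K: "K \<ge> 0"
    using bound[OF \<Theta>_strip] norm_ge_zero order_trans by blast
  have \<phi>: "((\<lambda>s. \<phi> (Complex j s)) \<longlongrightarrow> \<phi> (Complex j t)) (at t)" if "j \<in> {0, 1}" for j t
  proof -
    have "continuous_on UNIV (\<lambda>s. \<phi> (Complex j s))"
      by (rule continuous_on_compose2[OF cont])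
        (use that Complex_strip in \<open>auto intro!: continuous_intros simp: Complex_eq\<close>)
    then show ?thesis
      by (simp add: continuous_on_def)
  qed
  show ?thesis
  proof (rule HI)
    show "nrm S (cscale (\<phi> z) (g z)) \<le> K * C" if "z \<in> strip" for z
      unfolding S.nrm_scale[OF H_mem[OF assms(1) that]]
      by (intro mult_mono bound C that K S.nrm_ge0 H_mem assms)
    show "tends S (\<lambda>z. cscale (\<phi> z) (g z)) (cscale (\<phi> z) (g z)) (at z within strip)" if "z \<in> strip" for z
      using cont that by (intro S.tends_scale H_tends assms that) (simp add: continuous_on_def)
    show "\<exists>d. has_deriv S (\<lambda>z. cscale (\<phi> z) (g z)) d z" if "z \<in> interior strip" for z
      using S.has_deriv_mult[OF _ H_has_deriv[OF assms(1) that] H_mem[OF assms(1)]]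
        holomorphic_derivI[OF hol open_interior that] that interior_subset by blast
    show "nrm X0 (cscale (\<phi> (Complex 0 t)) (g (Complex 0 t))) \<le> K * Hnorm g" for t
      unfolding X0.nrm_scale[OF H_mem0[OF assms(1)]]
      by (intro mult_mono bound Complex_strip Hnorm_ge K X0.nrm_ge0 H_mem0 assms)
    show "nrm X1 (cscale (\<phi> (Complex 1 t)) (g (Complex 1 t))) \<le> K * Hnorm g" for t
      unfolding X1.nrm_scale[OF H_mem1[OF assms(1)]]
      by (intro mult_mono bound Complex_strip Hnorm_ge K X1.nrm_ge0 H_mem1 assms)
    show "tends X0 (\<lambda>s. cscale (\<phi> (Complex 0 s)) (g (Complex 0 s))) (cscale (\<phi> (Complex 0 t)) (g (Complex 0 t))) (at t)" for t
      by (intro X0.tends_scale \<phi> H_tends0 assms) simp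
    show "tends X1 (\<lambda>s. cscale (\<phi> (Complex 1 s)) (g (Complex 1 s))) (cscale (\<phi> (Complex 1 t)) (g (Complex 1 t))) (at t)" for t
      by (intro X1.tends_scale \<phi> H_tends1 assms) simp
  qed (intro S.scale_mem X0.scale_mem X1.scale_mem H_mem H_mem0 H_mem1 assms; assumption)+
qed

lemma H_scale:
  assumes "g \<in> H"
  shows "(\<lambda>z. cscale c (g z)) \<in> H" "Hnorm (\<lambda>z. cscale c (g z)) \<le> cmod c * Hnorm g"
proof -
  show "(\<lambda>z. cscale c (g z)) \<in> H"
    by (rule H_mult[OF assms, of "\<lambda>_. c" "cmod c"]) (auto intro: continuous_intros)
  show "Hnorm (\<lambda>z. cscale c (g z)) \<le> cmod c * Hnorm g"
    by (rule Hnorm_le)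
      (auto simp: X0.nrm_scale X1.nrm_scale H_mem0 H_mem1 assms intro!: mult_left_mono Hnorm_ge)
qed

lemma has_deriv_scale:
  assumes "has_deriv S g d z" "g z \<in> carr S"
  shows "has_deriv S (\<lambda>w. cscale c (g w)) (cscale c d) z"
  using S.has_deriv_mult[OF DERIV_const assms, of c] by simp

lemma H_diff:
  assumes "g \<in> H" "h \<in> H"
  shows "(\<lambda>z. g z - h z) \<in> H" "Hnorm (\<lambda>z. g z - h z) \<le> Hnorm g + Hnorm h"
proof -
  have eq: "(\<lambda>z. g z - h z) = (\<lambda>z. g z + cscale (-1) (h z))"
    by (auto simp: fun_eq_iff)
  show "(\<lambda>z. g z - h z) \<in> H"
    unfolding eq by (intro H_add H_scale assms)
  have "Hnorm (\<lambda>z. g z + cscale (-1) (h z)) \<le> Hnorm g + Hnorm (\<lambda>z. cscale (-1) (h z))"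
    by (intro H_add H_scale assms)
  then show "Hnorm (\<lambda>z. g z - h z) \<le> Hnorm g + Hnorm h"
    unfolding eq using H_scale(2)[OF assms(2), of "-1"] by simp
qed

lemma has_deriv_diff:
  assumes "has_deriv S g d z" "has_deriv S h e z" "h z \<in> carr S"
  shows "has_deriv S (\<lambda>w. g w - h w) (d - e) z"
  using S.has_deriv_add[OF assms(1) has_deriv_scale[OF assms(2,3), of "-1"]]
  by simp

lemma H_sum:
  assumes "\<And>i. i \<in> I \<Longrightarrow> g i \<in> H" "finite I"
  shows "(\<lambda>z. \<Sum>i\<in>I. g i z) \<in> H"
    and "z \<in> interior strip \<Longrightarrow> has_deriv S (\<lambda>z. \<Sum>i\<in>I. g i z) (\<Sum>i\<in>I. vderiv S (g i) z) z"
    and "Hnorm (\<lambda>z. \<Sum>i\<in>I. g i z) \<le> (\<Sum>i\<in>I. Hnorm (g i))"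
proof -
  have "(\<lambda>z. \<Sum>i\<in>I. g i z) \<in> H
    \<and> (z \<in> interior strip \<longrightarrow> has_deriv S (\<lambda>z. \<Sum>i\<in>I. g i z) (\<Sum>i\<in>I. vderiv S (g i) z) z)
    \<and> Hnorm (\<lambda>z. \<Sum>i\<in>I. g i z) \<le> (\<Sum>i\<in>I. Hnorm (g i))"
    using assms(2,1)
  proof (induction I rule: finite_induct)
    case empty
    have "Hnorm (\<lambda>z. 0) \<le> 0"
      by (rule Hnorm_le) simp_all
    moreover have "has_deriv S (\<lambda>z. 0) 0 z"
      by (simp add: S.has_deriv_iff S.tends_const S.zero_mem)
    ultimately show ?case
      using H_const[OF X0.zero_mem X1.zero_mem] unfolding sum.empty by blast
  next
    case (insert i I)
    have IH: "(\<lambda>z. \<Sum>i\<in>I. g i z) \<in> H"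
      "z \<in> interior strip \<Longrightarrow> has_deriv S (\<lambda>z. \<Sum>i\<in>I. g i z) (\<Sum>i\<in>I. vderiv S (g i) z) z"
      "Hnorm (\<lambda>z. \<Sum>i\<in>I. g i z) \<le> (\<Sum>i\<in>I. Hnorm (g i))"
      using insert by auto
    have i: "g i \<in> H"
      using insert by simp
    have "Hnorm (\<lambda>z. g i z + (\<Sum>i\<in>I. g i z)) \<le> Hnorm (g i) + (\<Sum>i\<in>I. Hnorm (g i))"
      using H_add(2)[OF i IH(1)] IH(3) by linarith
    then show ?case
      unfolding sum.insert[OF insert.hyps]
      by (intro conjI impI H_add(1)[OF i IH(1)] S.has_deriv_add[OF H_has_deriv[OF i] IH(2)])
  qed
  then show "(\<lambda>z. \<Sum>i\<in>I. g i z) \<in> H"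
    "z \<in> interior strip \<Longrightarrow> has_deriv S (\<lambda>z. \<Sum>i\<in>I. g i z) (\<Sum>i\<in>I. vderiv S (g i) z) z"
    "Hnorm (\<lambda>z. \<Sum>i\<in>I. g i z) \<le> (\<Sum>i\<in>I. Hnorm (g i))"
    by auto
qed

text \<open>Such maps act pointwise on admissible functions and hence on the interpolation space,
  with the same constant. The cases of interest are multiplication by scalars and restriction to
  intervals of coordinates.\<close>

definition bounded_op :: "(cseq \<Rightarrow> cseq) \<Rightarrow> real \<Rightarrow> bool" where
  "bounded_op T c \<longleftrightarrow> c \<ge> 0 \<and> (\<forall>x y. T (x + y) = T x + T y) \<and> (\<forall>a x. T (cscale a x) = cscale a (T x)) \<and>
     (\<forall>x\<in>carr X0. T x \<in> carr X0 \<and> nrm X0 (T x) \<le> c * nrm X0 x) \<and>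
     (\<forall>x\<in>carr X1. T x \<in> carr X1 \<and> nrm X1 (T x) \<le> c * nrm X1 x)"

lemma bounded_op_diff: "bounded_op T c \<Longrightarrow> T (x - y) = T x - T y"
  unfolding bounded_op_def by (metis add_diff_cancel diff_add_cancel)

lemma bounded_op_init: "bounded_op (restr {..<n}) 1"
  by (auto simp: bounded_op_def restr_add restr_cscale X0.init_mem X1.init_mem X0.nrm_init X1.nrm_init)

lemma bounded_op_restr: "bounded_op (restr {a..<b}) 2"
  by (auto simp: bounded_op_def restr_add restr_cscale X0.restr_finite_mem X1.restr_finite_mem
      X0.nrm_restr_interval X1.nrm_restr_interval)

lemma H_op:
  assumes "g \<in> H" and T: "bounded_op T c"
  shows "(\<lambda>z. T (g z)) \<in> H" "Hnorm (\<lambda>z. T (g z)) \<le> c * Hnorm g"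
proof -
  obtain C where C: "\<And>z. z \<in> strip \<Longrightarrow> nrm S (g z) \<le> C"
    using H_bound[OF assms(1)] by metis
  have T0: "T x \<in> carr X0" "nrm X0 (T x) \<le> c * nrm X0 x" if "x \<in> carr X0" for x
    using T that by (auto simp: bounded_op_def)
  have T1: "T x \<in> carr X1" "nrm X1 (T x) \<le> c * nrm X1 x" if "x \<in> carr X1" for x
    using T that by (auto simp: bounded_op_def)
  have TS: "T x \<in> carr S" "nrm S (T x) \<le> c * nrm S x" if "x \<in> carr S" for x
    using T that sum_bounded_linear[of T c x] by (auto simp: bounded_op_def)
  have c: "c \<ge> 0"
    using T by (simp add: bounded_op_def)
  note diff = bounded_op_diff[OF T]
  have le0: "nrm X0 (T (g (Complex 0 t))) \<le> c * Hnorm g" for t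
    by (intro order.trans[OF T0(2)] mult_left_mono Hnorm_ge H_mem0 assms c)
  have le1: "nrm X1 (T (g (Complex 1 t))) \<le> c * Hnorm g" for t
    by (intro order.trans[OF T1(2)] mult_left_mono Hnorm_ge H_mem1 assms c)
  show "(\<lambda>z. T (g z)) \<in> H"
  proof (rule HI[OF _ _ _ _ _ le0 _ _ le1])
    show "nrm S (T (g z)) \<le> c * C" if "z \<in> strip" for z
      using that by (intro order.trans[OF TS(2)] mult_left_mono C H_mem assms c)
    show "tends S (\<lambda>z. T (g z)) (T (g z)) (at z within strip)" if "z \<in> strip" for z
      by (rule S.tends_bounded_linear[OF S.nspace_axioms H_tends[OF assms(1) that] TS diff])
    show "tends X0 (\<lambda>s. T (g (Complex 0 s))) (T (g (Complex 0 t))) (at t)" for t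
      by (rule X0.tends_bounded_linear[OF X0.nspace_axioms H_tends0[OF assms(1)] T0 diff])
    show "tends X1 (\<lambda>s. T (g (Complex 1 s))) (T (g (Complex 1 t))) (at t)" for t
      by (rule X1.tends_bounded_linear[OF X1.nspace_axioms H_tends1[OF assms(1)] T1 diff])
    show "\<exists>d. has_deriv S (\<lambda>z. T (g z)) d z" if "z \<in> interior strip" for z
    proof -
      have "tends S (\<lambda>w. T (cscale (inverse (w - z)) (g w - g z))) (T (vderiv S g z)) (at z)"
        using H_has_deriv[OF assms(1) that] unfolding S.has_deriv_iff
        by (rule S.tends_bounded_linear[OF S.nspace_axioms _ TS diff])
      then show ?thesis
        using T unfolding S.has_deriv_iff diff[symmetric] bounded_op_def by auto
    qed
  qed (intro TS T0 T1 H_mem H_mem0 H_mem1 assms; assumption)+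
  show "Hnorm (\<lambda>z. T (g z)) \<le> c * Hnorm g"
    by (rule Hnorm_le[OF le0 le1])
qed


section \<open>Functions vanishing at the interpolation point\<close>

text \<open>Dividing by \<open>z - \<theta>\<close> rather than by a conformal map costs only a constant. The quotient
  is differentiable at \<open>\<theta>\<close> because its difference quotients satisfy a Lipschitz
  estimate near \<open>\<theta>\<close>, by Cauchy's formula, and the sum space is complete.\<close>

lemma quotient_has_deriv:
  assumes g: "g \<in> H" and g0: "g \<Theta> = 0"
  defines "h \<equiv> \<lambda>z. if z = \<Theta> then vderiv S g \<Theta> else cscale (inverse (z - \<Theta>)) (g z)"
  shows "\<exists>q. has_deriv S h q \<Theta>"
proof -
  let ?U = "{z. 0 < Re z \<and> Re z < 1}"
  have U: "open ?U" "?U \<subseteq> interior strip" "?U \<subseteq> strip"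
    using open_strip_subset_interior interior_subset
    by (auto intro!: open_Collect_conj open_Collect_less continuous_intros)
  define d where "d = vderiv S g \<Theta>"
  have d: "has_deriv S g d \<Theta>"
    unfolding d_def by (rule H_has_deriv[OF g \<Theta>_interior])
  have dS: "d \<in> carr S"
    by (rule S.has_deriv_mem[OF d])
  have hS: "h z \<in> carr S" if "z \<in> ?U" for z
    using that U H_mem[OF g] dS by (auto simp: h_def d_def S.scale_mem)
  have gk: "(\<lambda>z. g z k) holomorphic_on ?U" for k
    unfolding holomorphic_on_open[OF U(1)]
    using S.has_deriv_coord[OF H_has_deriv[OF g]] U(2) by blast
  have hk: "(\<lambda>z. h z k) holomorphic_on ?U" for k
  proof -
    have "deriv (\<lambda>z. g z k) \<Theta> = d k"
      by (rule DERIV_imp_deriv[OF S.has_deriv_coord[OF d]])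
    then have "h z k = (if z = \<Theta> then deriv (\<lambda>z. g z k) \<Theta> else (g z k - g \<Theta> k) / (z - \<Theta>))" for z
      by (simp add: h_def d_def g0 divide_inverse mult.commute)
    then show ?thesis
      using pole_lemma_open[OF gk[of k] U(1), of \<Theta>] by simp
  qed
  \<comment> \<open>The second difference quotient, with its removable singularity filled in
    coordinatewise. The value at \<open>\<Theta>\<close> is not yet known to belong to the sum
    space, so norm estimates below avoid that point.\<close>
  define Q where "Q z = (if z = \<Theta> then (\<lambda>k. deriv (\<lambda>z. h z k) \<Theta>) else cscale (inverse (z - \<Theta>)) (h z - h \<Theta>))"
    for z
  have Qk: "(\<lambda>z. Q z k) holomorphic_on ?U" for k
  proof -
    have "Q z k = (if z = \<Theta> then deriv (\<lambda>z. h z k) \<Theta> else (h z k - h \<Theta> k) / (z - \<Theta>))" for z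
      by (simp add: Q_def divide_inverse mult.commute)
    then show ?thesis
      using pole_lemma_open[OF hk[of k] U(1), of \<Theta>] by simp
  qed
  have h\<Theta>: "h \<Theta> \<in> carr S"
    using dS by (simp add: h_def d_def)
  have QS: "Q z \<in> carr S" if "z \<in> ?U" "z \<noteq> \<Theta>" for z
    using that hS h\<Theta> by (simp add: Q_def S.mem)
  define r where "r = min \<theta> (1 - \<theta>) / 2"
  have r: "r > 0"
    using \<theta> by (simp add: r_def)
  have ball: "cball \<Theta> r \<subseteq> ?U"
  proof
    fix z
    assume "z \<in> cball \<Theta> r"
    then have "\<bar>Re (\<Theta> - z)\<bar> \<le> r"
      using abs_Re_le_cmod[of "\<Theta> - z"] by (simp add: dist_norm)
    moreover have "r \<le> \<theta> / 2" "r \<le> (1 - \<theta>) / 2"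
      by (simp_all add: r_def)
    ultimately show "z \<in> ?U"
      using \<theta> by (simp add: abs_le_iff)
  qed
  obtain C where C: "\<And>z. z \<in> strip \<Longrightarrow> nrm S (g z) \<le> C"
    using H_bound[OF g] by metis
  define M where "M = inverse r * (inverse r * C + nrm S (h \<Theta>))"
  have Q_sphere: "Q z \<in> carr S \<and> nrm S (Q z) \<le> M" if "z \<in> sphere \<Theta> r" for z
  proof -
    have z: "z \<in> ?U" "z \<noteq> \<Theta>" "cmod (z - \<Theta>) = r" "z \<in> strip"
      using that ball r U(3) by (auto simp: dist_norm norm_minus_commute)
    have "nrm S (h z) = inverse r * nrm S (g z)"
      using z by (simp add: h_def S.nrm_scale H_mem[OF g] norm_inverse)
    also have "\<dots> \<le> inverse r * C"
      using C z(4) r by (intro mult_left_mono) auto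
    finally have "nrm S (h z - h \<Theta>) \<le> inverse r * C + nrm S (h \<Theta>)"
      using S.nrm_diff[OF hS[OF z(1)] h\<Theta>] by linarith
    moreover have "nrm S (Q z) = inverse r * nrm S (h z - h \<Theta>)"
      using z S.nrm_scale[OF S.diff_mem[OF hS[OF z(1)] h\<Theta>]] by (simp add: Q_def norm_inverse)
    ultimately show ?thesis
      using QS[OF z(1,2)] r by (simp add: M_def)
  qed
  define K where "K = 4 * M / r"
  have lip: "nrm S (Q w - Q w') \<le> K * cmod (w - w')"
    if "w \<in> ball \<Theta> (r / 2)" "w' \<in> ball \<Theta> (r / 2)" "w \<noteq> \<Theta>" "w' \<noteq> \<Theta>" for w w'
  proof -
    have "ball \<Theta> (r / 2) \<subseteq> cball \<Theta> r"
      using r by auto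
    then have "w \<in> ?U" "w' \<in> ?U"
      using that ball by blast+
    then show ?thesis
      unfolding K_def using that
      by (intro S.Cauchy_lipschitz[OF r holomorphic_on_subset[OF Qk ball] Q_sphere] QS)
  qed
  \<comment> \<open>A sequence approaching \<open>\<Theta>\<close> geometrically: the Lipschitz
    bound makes the increments of \<open>Q (u n)\<close> geometric as well, and completeness yields
    the candidate \<open>q\<close> for the derivative.\<close>
  define u where "u n = \<Theta> + of_real (r / 4 * (1 / 2) ^ n)" for n :: nat
  have u: "u n \<noteq> \<Theta>" "u n \<in> ball \<Theta> (r / 2)" for n
  proof -
    have "r / 4 * (1 / 2) ^ n \<le> r / 4 * 1"
      using r by (intro mult_left_mono) (auto simp: power_le_one)
    then show "u n \<in> ball \<Theta> (r / 2)"
      using r by (simp add: u_def dist_norm norm_mult norm_power norm_divide)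
    show "u n \<noteq> \<Theta>"
      using r by (simp add: u_def)
  qed
  have uU: "u n \<in> ?U" for n
    using u(2)[of n] ball r by (auto simp: subset_iff)
  have Qu: "Q (u n) \<in> carr S" for n
    using QS uU u(1) by blast
  have u_lim: "u \<longlonglongrightarrow> \<Theta>"
  proof -
    have "(\<lambda>n. \<Theta> + of_real (r / 4 * (1 / 2) ^ n)) \<longlonglongrightarrow> \<Theta> + of_real (r / 4 * 0)"
      by (intro tendsto_intros LIMSEQ_power_zero) simp
    then show ?thesis
      by (simp add: u_def[abs_def])
  qed
  have "nrm S (Q (u (Suc n)) - Q (u n)) \<le> K * (r / 8) * (1 / 2) ^ n" for n
  proof -
    have "u (Suc n) - u n = - of_real (r / 8 * (1 / 2) ^ n)"
      by (simp add: u_def)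
    then have "cmod (u (Suc n) - u n) = r / 8 * (1 / 2) ^ n"
      using r by (simp add: norm_mult norm_power norm_divide)
    then show ?thesis
      using lip[OF u(2) u(2) u(1) u(1), of "Suc n" n] by (simp only: mult.assoc)
  qed
  from S.complete[OF Qu this] obtain q where q: "tends S (\<lambda>n. Q (u n)) q sequentially"
    by blast
  have qS: "q \<in> carr S"
    using q by (simp add: tends_def)
  \<comment> \<open>The Lipschitz bound cannot be used with \<open>\<Theta>\<close> as second point,
    so it is used with \<open>u n\<close> and passed to the limit.\<close>
  have near: "nrm S (Q w - q) \<le> K * cmod (w - \<Theta>)" if w: "w \<in> ball \<Theta> (r / 2)" "w \<noteq> \<Theta>" for w
  proof -
    have wU: "w \<in> ?U"
      using w(1) ball r by (auto simp: subset_iff)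
    have "(\<lambda>n. K * cmod (w - u n) + nrm S (Q (u n) - q)) \<longlonglongrightarrow> K * cmod (w - \<Theta>) + 0"
      using q by (intro tendsto_intros u_lim) (simp add: tends_def)
    moreover have "nrm S (Q w - q) \<le> K * cmod (w - u n) + nrm S (Q (u n) - q)" for n
      using S.nrm_triangle[OF QS[OF wU w(2)] Qu[of n] qS] lip[OF w(1) u(2) w(2) u(1), of n] by linarith
    ultimately show ?thesis
      using LIMSEQ_le_const by fastforce
  qed
  have ev: "\<forall>\<^sub>F w in at \<Theta>. w \<in> ball \<Theta> (r / 2) \<and> w \<noteq> \<Theta>"
    using r eventually_at_ball[of "r / 2" \<Theta> UNIV] eventually_neq_at_within[of \<Theta> \<Theta> UNIV]
    by (auto elim: eventually_elim2)
  have "tends S Q q (at \<Theta>)"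
  proof (rule S.tendsI[where h = "\<lambda>w. K * cmod (w - \<Theta>)"])
    show "\<forall>\<^sub>F w in at \<Theta>. Q w \<in> carr S"
      using ev by eventually_elim (use QS ball r in \<open>auto simp: subset_iff\<close>)
    show "\<forall>\<^sub>F w in at \<Theta>. nrm S (Q w - q) \<le> K * cmod (w - \<Theta>)"
      using ev by eventually_elim (use near in auto)
    have "((\<lambda>w. K * cmod (w - \<Theta>)) \<longlongrightarrow> K * cmod (\<Theta> - \<Theta>)) (at \<Theta>)"
      by (intro tendsto_intros)
    then show "((\<lambda>w. K * cmod (w - \<Theta>)) \<longlongrightarrow> 0) (at \<Theta>)"
      by simp
  qed (rule qS)
  moreover have "\<forall>\<^sub>F w in at \<Theta>. Q w = cscale (inverse (w - \<Theta>)) (h w - h \<Theta>)"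
    using ev by eventually_elim (simp add: Q_def)
  ultimately have "has_deriv S h q \<Theta>"
    unfolding S.has_deriv_iff by (rule tends_cong[rotated])
  then show ?thesis
    by blast
qed

text \<open>On both boundary lines the distance to \<open>\<theta>\<close> is at least
  \<open>min \<theta> (1 - \<theta>)\<close>, which gives the norm bound. Since
  \<open>g \<Theta> = 0\<close>, continuity of \<open>h\<close> at \<open>\<theta>\<close> is the
  definition of the derivative; boundedness near that point follows from it.\<close>

lemma H_quotient:
  assumes g: "g \<in> H" and g0: "g \<Theta> = 0"
  defines "h \<equiv> \<lambda>z. if z = \<Theta> then vderiv S g \<Theta> else cscale (inverse (z - \<Theta>)) (g z)"
  shows "h \<in> H" "Hnorm h \<le> Hnorm g / min \<theta> (1 - \<theta>)"
proof -
  define d where "d = vderiv S g \<Theta>"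
  have d: "has_deriv S g d \<Theta>"
    unfolding d_def by (rule H_has_deriv[OF g \<Theta>_interior])
  have h_off: "h z = cscale (inverse (z - \<Theta>)) (g z)" if "z \<noteq> \<Theta>" for z
    using that by (simp add: h_def)
  have h_at: "h \<Theta> = d"
    by (simp add: h_def d_def)
  have hS: "h z \<in> carr S" if "z \<in> strip" for z
    using that H_mem[OF g] S.has_deriv_mem[OF d] by (auto simp: h_def d_def S.scale_mem)
  have lim\<Theta>: "tends S h d (at \<Theta>)"
    using d unfolding S.has_deriv_iff
    by (rule tends_cong[rotated]) (simp add: g0 h_def eventually_at_filter)
  define \<delta> where "\<delta> = min \<theta> (1 - \<theta>)"
  have \<delta>: "\<delta> > 0"
    using \<theta> by (simp add: \<delta>_def)
  have far: "Complex j t \<noteq> \<Theta>" "cmod (inverse (Complex j t - \<Theta>)) \<le> inverse \<delta>" if "j \<in> {0, 1}" for j t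
  proof -
    have "\<delta> \<le> \<bar>Re (Complex j t - \<Theta>)\<bar>"
      using that \<theta> by (auto simp: \<delta>_def)
    then have *: "\<delta> \<le> cmod (Complex j t - \<Theta>)"
      using abs_Re_le_cmod order_trans by blast
    then show "Complex j t \<noteq> \<Theta>"
      using \<delta> by auto
    show "cmod (inverse (Complex j t - \<Theta>)) \<le> inverse \<delta>"
      unfolding norm_inverse using * \<delta> by (rule le_imp_inverse_le)
  qed
  have le0: "nrm X0 (h (Complex 0 t)) \<le> Hnorm g / \<delta>" for t
  proof -
    have "cmod (inverse (Complex 0 t - \<Theta>)) * nrm X0 (g (Complex 0 t)) \<le> inverse \<delta> * Hnorm g"
      using \<delta> by (intro mult_mono far Hnorm_ge g X0.nrm_ge0 H_mem0) auto
    then show ?thesis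
      by (simp add: h_off far X0.nrm_scale H_mem0[OF g] field_simps)
  qed
  have le1: "nrm X1 (h (Complex 1 t)) \<le> Hnorm g / \<delta>" for t
  proof -
    have "cmod (inverse (Complex 1 t - \<Theta>)) * nrm X1 (g (Complex 1 t)) \<le> inverse \<delta> * Hnorm g"
      using \<delta> by (intro mult_mono far Hnorm_ge g X1.nrm_ge0 H_mem1) auto
    then show ?thesis
      by (simp add: h_off far X1.nrm_scale H_mem1[OF g] field_simps)
  qed
  show "Hnorm h \<le> Hnorm g / min \<theta> (1 - \<theta>)"
    using Hnorm_le[OF le0 le1] by (simp add: \<delta>_def)
  have "\<forall>\<^sub>F w in at \<Theta>. nrm S (h w) < nrm S d + 1"
    using S.tends_nrm[OF lim\<Theta>] by (rule order_tendstoD(2)) simp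
  then obtain e where e: "e > 0" "\<And>w. w \<noteq> \<Theta> \<Longrightarrow> dist w \<Theta> < e \<Longrightarrow> nrm S (h w) < nrm S d + 1"
    unfolding eventually_at by blast
  obtain C where C: "\<And>z. z \<in> strip \<Longrightarrow> nrm S (g z) \<le> C"
    using H_bound[OF g] by metis
  have bound: "nrm S (h z) \<le> max (nrm S d + 1) (inverse e * C)" if z: "z \<in> strip" for z
  proof (cases "dist z \<Theta> < e")
    case True
    then show ?thesis
      using e(2)[of z] h_at by (cases "z = \<Theta>") auto
  next
    case False
    then have "z \<noteq> \<Theta>"
      using e(1) by auto
    moreover have "cmod (inverse (z - \<Theta>)) * nrm S (g z) \<le> inverse e * C"
    proof (intro mult_mono C z S.nrm_ge0 H_mem g)
      show "cmod (inverse (z - \<Theta>)) \<le> inverse e"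
        unfolding norm_inverse using False e(1) by (intro le_imp_inverse_le) (auto simp: dist_norm)
    qed (use e(1) in auto)
    ultimately show ?thesis
      by (simp add: h_off S.nrm_scale H_mem[OF g z])
  qed
  have inv: "((\<lambda>w. inverse (w - \<Theta>)) \<longlongrightarrow> inverse (z - \<Theta>)) (at z within A)" if "z \<noteq> \<Theta>" for z A
    using that by (intro tendsto_intros) auto
  have off: "\<forall>\<^sub>F w in at z within A. cscale (inverse (w - \<Theta>)) (g w) = h w" if "z \<noteq> \<Theta>" for z A
    using eventually_neq_at_within[of \<Theta> z A] by eventually_elim (simp add: h_off)
  show "h \<in> H"
  proof (rule HI[OF hS bound _ _ _ le0 _ _ le1])
    show "tends S h (h z) (at z within strip)" if z: "z \<in> strip" for z
    proof (cases "z = \<Theta>")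
      case True
      have "at \<Theta> within strip = at \<Theta>"
        by (rule at_within_interior[OF \<Theta>_interior])
      then show ?thesis
        using lim\<Theta> True h_at by simp
    next
      case False
      show ?thesis
        unfolding h_off[OF False]
        by (rule tends_cong[OF off[OF False]]) (intro S.tends_scale inv False H_tends g z)
    qed
    show "\<exists>e. has_deriv S h e z" if z: "z \<in> interior strip" for z
    proof (cases "z = \<Theta>")
      case True
      then show ?thesis
        using quotient_has_deriv[OF g g0] by (simp add: h_def)
    next
      case False
      have "((\<lambda>w. inverse (w - \<Theta>)) has_field_derivative (- (inverse (z - \<Theta>))\<^sup>2)) (at z)"
        using False by (auto intro!: derivative_eq_intros simp: power2_eq_square)
      then have "has_deriv S (\<lambda>w. cscale (inverse (w - \<Theta>)) (g w))
          (cscale (inverse (z - \<Theta>)) (vderiv S g z) + cscale (- (inverse (z - \<Theta>))\<^sup>2) (g z)) z"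
        using z interior_subset by (intro S.has_deriv_mult H_has_deriv g H_mem) auto
      then show ?thesis
        using S.has_deriv_cong[OF off[OF False] h_off[OF False, symmetric]] by blast
    qed
    show "h (Complex 0 t) \<in> carr X0" "h (Complex 1 t) \<in> carr X1" for t
      by (simp_all add: h_off far X0.scale_mem X1.scale_mem H_mem0 H_mem1 g)
    have inv_bd: "((\<lambda>s. inverse (Complex j s - \<Theta>)) \<longlongrightarrow> inverse (Complex j t - \<Theta>)) (at t)" if "j \<in> {0, 1}" for j t
      using far(1)[OF that] by (auto intro!: tendsto_intros simp: Complex_eq)
    show "tends X0 (\<lambda>s. h (Complex 0 s)) (h (Complex 0 t)) (at t)" for t
      using X0.tends_scale[OF inv_bd H_tends0[OF g], of 0 t] by (simp add: h_off far)
    show "tends X1 (\<lambda>s. h (Complex 1 s)) (h (Complex 1 t)) (at t)" for t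
      using X1.tends_scale[OF inv_bd H_tends1[OF g], of 1 t] by (simp add: h_off far)
  qed
qed

end


section \<open>The interpolation space\<close>

context couple
begin

abbreviation X :: cspace where "X \<equiv> interp_space X0 X1 \<theta>"

lemma carr_interp: "x \<in> carr X \<longleftrightarrow> (\<exists>g\<in>H. g \<Theta> = x)"
  by (auto simp: interp_space_def)

lemma nrm_interp: "nrm X x = Inf {Hnorm g | g. g \<in> H \<and> g \<Theta> = x}"
  by (simp add: interp_space_def)

lemma interp_memI:
  assumes "g \<in> H"
  shows "g \<Theta> \<in> carr X" "nrm X (g \<Theta>) \<le> Hnorm g"
proof -
  show "g \<Theta> \<in> carr X"
    using assms by (auto simp: carr_interp)
  show "nrm X (g \<Theta>) \<le> Hnorm g"
    unfolding nrm_interp using assms Hnorm_ge0 by (intro cInf_lower bdd_belowI[of _ 0]) auto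
qed

lemma interp_approx:
  assumes "x \<in> carr X" "e > 0"
  obtains g where "g \<in> H" "g \<Theta> = x" "Hnorm g < nrm X x + e"
proof -
  let ?A = "{Hnorm g | g. g \<in> H \<and> g \<Theta> = x}"
  have "?A \<noteq> {}"
    using assms(1) by (auto simp: carr_interp)
  moreover have "Inf ?A < nrm X x + e"
    using assms(2) by (simp add: nrm_interp)
  ultimately obtain v where "v \<in> ?A" "v < nrm X x + e"
    using cInf_lessD by meson
  then show thesis
    using that by auto
qed

lemma interp_ge0:
  assumes "x \<in> carr X"
  shows "0 \<le> nrm X x"
proof (rule field_le_epsilon)
  fix e :: real
  assume "e > 0"
  then obtain g where "g \<in> H" "Hnorm g < nrm X x + e"
    using interp_approx[OF assms] by metis
  then show "0 \<le> nrm X x + e"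
    using Hnorm_ge0[of g] by linarith
qed

lemma interp_add:
  assumes "x \<in> carr X" "y \<in> carr X"
  shows "x + y \<in> carr X" "nrm X (x + y) \<le> nrm X x + nrm X y"
proof -
  have split: "x + y \<in> carr X \<and> nrm X (x + y) \<le> nrm X x + nrm X y + e" if "e > 0" for e
  proof -
    have "e / 2 > 0"
      using that by simp
    then obtain g h where g: "g \<in> H" "g \<Theta> = x" "Hnorm g < nrm X x + e / 2"
      and h: "h \<in> H" "h \<Theta> = y" "Hnorm h < nrm X y + e / 2"
      using interp_approx assms by metis
    have "nrm X (g \<Theta> + h \<Theta>) \<le> Hnorm g + Hnorm h"
      using interp_memI(2)[OF H_add(1)[OF g(1) h(1)]] H_add(2)[OF g(1) h(1)] by linarith
    then show ?thesis
      using interp_memI(1)[OF H_add(1)[OF g(1) h(1)]] g h by auto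
  qed
  show "x + y \<in> carr X"
    using split[of 1] by simp
  show "nrm X (x + y) \<le> nrm X x + nrm X y"
    by (rule field_le_epsilon) (use split in blast)
qed

lemma interp_op:
  assumes T: "bounded_op T c" and x: "x \<in> carr X"
  shows "T x \<in> carr X" "nrm X (T x) \<le> c * nrm X x"
proof -
  have c: "c \<ge> 0"
    using T by (simp add: bounded_op_def)
  have split: "T x \<in> carr X \<and> nrm X (T x) \<le> c * nrm X x + e" if "e > 0" for e
  proof -
    have "e / (c + 1) > 0"
      using that c by simp
    then obtain g where g: "g \<in> H" "g \<Theta> = x" "Hnorm g < nrm X x + e / (c + 1)"
      using interp_approx[OF x] by metis
    have "nrm X (T (g \<Theta>)) \<le> c * Hnorm g"
      using interp_memI(2)[OF H_op(1)[OF g(1) T]] H_op(2)[OF g(1) T] by linarith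
    also have "\<dots> \<le> c * (nrm X x + e / (c + 1))"
      using g c by (intro mult_left_mono) auto
    also have "\<dots> \<le> c * nrm X x + e"
      using that c by (simp add: field_simps)
    finally show ?thesis
      using interp_memI(1)[OF H_op(1)[OF g(1) T]] g(2) by simp
  qed
  show "T x \<in> carr X"
    using split[of 1] by simp
  show "nrm X (T x) \<le> c * nrm X x"
    by (rule field_le_epsilon) (use split in blast)
qed

lemma bounded_op_scale: "bounded_op (cscale a) (cmod a)"
  by (auto simp: bounded_op_def cscale_add X0.scale_mem X1.scale_mem X0.nrm_scale X1.nrm_scale mult.commute)

text \<open>The maximum principle, applied to one scalar coordinate, carries a bound from the two
  boundary lines to \<open>\<theta>\<close>. This is what makes the quotient norm definite.\<close>

lemma H_coord_bound:
  assumes g: "g \<in> H"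
  shows "cmod (g \<Theta> k) \<le> max (2 / nrm X0 (unit_seq k)) (2 / nrm X1 (unit_seq k)) * Hnorm g"
    (is "_ \<le> ?c * _")
proof -
  obtain C where C: "\<And>z. z \<in> strip \<Longrightarrow> nrm S (g z) \<le> C"
    using H_bound[OF g] by metis
  show ?thesis
  proof (rule strip_maximum_principle[OF _ _ _ _ _ \<Theta>_strip, of "\<lambda>z. g z k"])
    show "continuous_on strip (\<lambda>z. g z k)"
      unfolding continuous_on_def using S.tends_coord[OF H_tends[OF g]] by blast
    show "(\<lambda>z. g z k) holomorphic_on interior strip"
      unfolding holomorphic_on_open[OF open_interior]
      using S.has_deriv_coord[OF H_has_deriv[OF g]] by blast
    show "cmod (g z k) \<le> 2 / nrm S (unit_seq k) * C" if "z \<in> strip" for z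
      using S.unit_pos[of k]
      by (intro order.trans[OF S.coord_bound[OF H_mem[OF g that]]] mult_left_mono C that) simp
    show "cmod (g (Complex 0 t) k) \<le> ?c * Hnorm g" for t
      using X0.unit_pos[of k]
      by (intro order.trans[OF X0.coord_bound[OF H_mem0[OF g]]] mult_mono Hnorm_ge g)
        (auto simp: X0.nrm_ge0 H_mem0 g le_max_iff_disj)
    show "cmod (g (Complex 1 t) k) \<le> ?c * Hnorm g" for t
      using X1.unit_pos[of k]
      by (intro order.trans[OF X1.coord_bound[OF H_mem1[OF g]]] mult_mono Hnorm_ge g)
        (auto simp: X1.nrm_ge0 H_mem1 g le_max_iff_disj)
  qed
qed

sublocale X: nspace X
proof (unfold_locales, unfold normed_space_def, intro conjI ballI allI)
  have zero: "0 \<in> carr X" "nrm X 0 \<le> 0"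
    using interp_memI[OF H_const[OF X0.zero_mem X1.zero_mem]] Hnorm_le[of "\<lambda>_. 0" 0] by simp_all
  show "cseq.subspace (carr X)"
    unfolding cseq.subspace_def using zero interp_add(1) interp_op(1)[OF bounded_op_scale] by blast
  fix x
  assume x: "x \<in> carr X"
  show "0 \<le> nrm X x"
    by (rule interp_ge0[OF x])
  show "nrm X x = 0 \<longleftrightarrow> x = 0"
  proof
    assume x0: "nrm X x = 0"
    have "cmod (x k) \<le> 0" for k
    proof (rule field_le_epsilon)
      fix e :: real
      assume "e > 0"
      define c where "c = max (2 / nrm X0 (unit_seq k)) (2 / nrm X1 (unit_seq k))"
      have c: "c > 0"
        using X0.unit_pos[of k] by (simp add: c_def less_max_iff_disj)
      then have "e / c > 0"
        using \<open>e > 0\<close> by simp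
      then obtain g where g: "g \<in> H" "g \<Theta> = x" "Hnorm g < 0 + e / c"
        using interp_approx[OF x] x0 by metis
      have "cmod (x k) \<le> c * Hnorm g"
        using H_coord_bound[OF g(1), of k] by (simp add: c_def g(2))
      also have "\<dots> \<le> c * (e / c)"
        using g(3) c by (intro mult_left_mono) auto
      finally show "cmod (x k) \<le> 0 + e"
        using c by simp
    qed
    then show "x = 0"
      by (auto simp: fun_eq_iff)
  next
    assume "x = 0"
    then show "nrm X x = 0"
      using zero interp_ge0[OF zero(1)] by simp
  qed
  fix c
  show "nrm X (cscale c x) = cmod c * nrm X x"
  proof (cases "c = 0")
    case True
    then show ?thesis
      using zero interp_ge0[OF zero(1)] by simp
  next
    case False
    have "nrm X x \<le> cmod (inverse c) * nrm X (cscale c x)"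
      using interp_op(2)[OF bounded_op_scale interp_op(1)[OF bounded_op_scale x], of "inverse c" c] False
      by simp
    then have "cmod c * nrm X x \<le> cmod c * (cmod (inverse c) * nrm X (cscale c x))"
      by (intro mult_left_mono) auto
    also have "\<dots> = nrm X (cscale c x)"
      using False by (simp add: norm_inverse)
    finally show ?thesis
      using interp_op(2)[OF bounded_op_scale x, of c] by linarith
  qed
next
  fix x y
  assume "x \<in> carr X" "y \<in> carr X"
  then show "nrm X (x + y) \<le> nrm X x + nrm X y"
    by (rule interp_add(2))
qed

text \<open>A representing function may be multiplied by \<open>exp (z^2 - \<theta>^2)\<close>. Its boundary values then
  vanish at infinity, so that they form a relatively compact set on which the initial segment
  projections converge uniformly.\<close>

lemma interp_tends_init:
  assumes x: "x \<in> carr X"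
  shows "tends X (\<lambda>n. restr {..<n} x) x sequentially"
proof -
  obtain g0 where g0: "g0 \<in> H" "g0 \<Theta> = x"
    using x by (auto simp: carr_interp)
  define \<phi> where "\<phi> z = exp (z\<^sup>2 - \<Theta>\<^sup>2)" for z
  define g where "g z = cscale (\<phi> z) (g0 z)" for z
  have modulus: "cmod (\<phi> z) = exp ((Re z)\<^sup>2 - (Im z)\<^sup>2 - \<theta>\<^sup>2)" for z
    by (simp add: \<phi>_def norm_exp_eq_Re power2_eq_square)
  have "cmod (\<phi> z) \<le> exp 1" if "z \<in> strip" for z
  proof -
    have "(Re z)\<^sup>2 \<le> 1"
      using that by (simp add: strip_def power_le_one)
    then have "(Re z)\<^sup>2 - (Im z)\<^sup>2 - \<theta>\<^sup>2 \<le> 1"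
      using zero_le_power2[of "Im z"] zero_le_power2[of \<theta>] by linarith
    then show ?thesis
      unfolding modulus by simp
  qed
  then have g: "g \<in> H"
    unfolding g_def
    by (intro H_mult[OF g0(1)]) (auto simp: \<phi>_def intro!: continuous_intros holomorphic_intros)
  have gx: "g \<Theta> = x"
    by (simp add: g_def \<phi>_def g0)
  have decay: "\<exists>T. \<forall>t. \<bar>t\<bar> > T \<longrightarrow> exp (1 - t\<^sup>2) * Hnorm g0 \<le> e" if "e > 0" for e
  proof -
    have "filterlim (\<lambda>t::real. t\<^sup>2 - 1) at_top at_top"
      by real_asymp
    then have "((\<lambda>t::real. exp (- (t\<^sup>2 - 1))) \<longlongrightarrow> 0) at_top"
      by (intro filterlim_compose[OF exp_at_bot]) (simp only: filterlim_uminus_at_top[symmetric])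
    from tendsto_mult[OF this tendsto_const[of "Hnorm g0"]]
    have "\<forall>\<^sub>F t in at_top. exp (- (t\<^sup>2 - 1)) * Hnorm g0 < e"
      using that order_tendstoD(2) by fastforce
    then obtain T where T: "\<And>t. t \<ge> T \<Longrightarrow> exp (- (t\<^sup>2 - 1)) * Hnorm g0 < e"
      unfolding eventually_at_top_linorder by blast
    have "exp (1 - t\<^sup>2) * Hnorm g0 \<le> e" if "\<bar>t\<bar> > T" for t
      using T[of "\<bar>t\<bar>"] that by simp
    then show ?thesis
      by blast
  qed
  have b0: "nrm X0 (g (Complex 0 t)) \<le> exp (1 - t\<^sup>2) * Hnorm g0" for t
    unfolding g_def X0.nrm_scale[OF H_mem0[OF g0(1)]]
    by (intro mult_mono Hnorm_ge g0 X0.nrm_ge0 H_mem0)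
      (auto simp: modulus intro: order_trans[OF _ zero_le_power2])
  have b1: "nrm X1 (g (Complex 1 t)) \<le> exp (1 - t\<^sup>2) * Hnorm g0" for t
    unfolding g_def X1.nrm_scale[OF H_mem1[OF g0(1)]]
    by (intro mult_mono Hnorm_ge g0 X1.nrm_ge0 H_mem1) (simp_all add: modulus)
  have conv: "\<exists>N. \<forall>n\<ge>N. nrm X (restr {..<n} x - x) \<le> e" if e: "e > 0" for e
  proof -
    have v0: "\<exists>T. \<forall>t. \<bar>t\<bar> > T \<longrightarrow> nrm X0 (g (Complex 0 t)) \<le> e'" if "e' > 0" for e'
      using decay[OF that] b0 order_trans by meson
    have v1: "\<exists>T. \<forall>t. \<bar>t\<bar> > T \<longrightarrow> nrm X1 (g (Complex 1 t)) \<le> e'" if "e' > 0" for e'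
      using decay[OF that] b1 order_trans by meson
    obtain N0 where N0: "\<And>n t. n \<ge> N0 \<Longrightarrow> nrm X0 (restr {..<n} (g (Complex 0 t)) - g (Complex 0 t)) \<le> e"
      using X0.uniform_tends_init[OF H_mem0[OF g] H_tends0[OF g] v0 e] by blast
    obtain N1 where N1: "\<And>n t. n \<ge> N1 \<Longrightarrow> nrm X1 (restr {..<n} (g (Complex 1 t)) - g (Complex 1 t)) \<le> e"
      using X1.uniform_tends_init[OF H_mem1[OF g] H_tends1[OF g] v1 e] by blast
    have "nrm X (restr {..<n} x - x) \<le> e" if "n \<ge> max N0 N1" for n
    proof -
      \<comment> \<open>An admissible function through the error vector. Its norm involves boundary
        values only, so uniform convergence on the two lines is enough.\<close>
      let ?h = "\<lambda>z. restr {..<n} (g z) - g z"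
      have "?h \<in> H"
        by (intro H_diff H_op[OF _ bounded_op_init] g)
      from interp_memI(2)[OF this] have "nrm X (restr {..<n} x - x) \<le> Hnorm ?h"
        by (simp add: gx)
      also have "\<dots> \<le> e"
        using that by (intro Hnorm_le N0 N1) auto
      finally show ?thesis .
    qed
    then show ?thesis
      by blast
  qed
  have mem: "restr {..<n} x \<in> carr X" for n
    by (rule interp_op(1)[OF bounded_op_init x])
  have "(\<lambda>n. nrm X (restr {..<n} x - x)) \<longlonglongrightarrow> 0"
  proof (rule LIMSEQ_I)
    fix e :: real
    assume "e > 0"
    then obtain N where N: "\<And>n. n \<ge> N \<Longrightarrow> nrm X (restr {..<n} x - x) \<le> e / 2"
      using conv[of "e / 2"] by auto
    have "norm (nrm X (restr {..<n} x - x) - 0) < e" if "n \<ge> N" for n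
      using N[OF that] X.nrm_ge0[OF X.diff_mem[OF mem[of n] x]] \<open>e > 0\<close> by simp
    then show "\<exists>N. \<forall>n\<ge>N. norm (nrm X (restr {..<n} x - x) - 0) < e"
      by blast
  qed
  then show ?thesis
    using x mem by (simp add: tends_def)
qed

sublocale X: mspace X
proof
  show "unit_seq k \<in> carr X" for k
    by (rule interp_memI(1)[OF H_const[OF X0.unit_mem X1.unit_mem]])
  show "restr {..<n} x \<in> carr X" "nrm X (restr {..<n} x) \<le> nrm X x" if "x \<in> carr X" for x n
    using interp_op[OF bounded_op_init that, of n] by simp_all
qed (rule interp_tends_init)

text \<open>The derivative is the value at \<open>\<theta>\<close> of the admissible quotient, which
  is why it lies in the smaller space and not merely in the sum.\<close>

lemma vderiv_bound:
  assumes "g \<in> H" "g \<Theta> = 0"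
  shows "vderiv S g \<Theta> \<in> carr X" "nrm X (vderiv S g \<Theta>) \<le> Hnorm g / min \<theta> (1 - \<theta>)"
proof -
  let ?h = "\<lambda>z. if z = \<Theta> then vderiv S g \<Theta> else cscale (inverse (z - \<Theta>)) (g z)"
  note h = interp_memI[OF H_quotient(1)[OF assms]]
  show "vderiv S g \<Theta> \<in> carr X"
    using h(1) by simp
  have "nrm X (vderiv S g \<Theta>) \<le> Hnorm ?h"
    using h(2) by (simp only: if_True refl)
  then show "nrm X (vderiv S g \<Theta>) \<le> Hnorm g / min \<theta> (1 - \<theta>)"
    using H_quotient(2)[OF assms] by linarith
qed

end


section \<open>The logarithm on sums of successive vectors\<close>

section \<open>Sums of successive vectors\<close>

lemma successive_coord:
  assumes y: "successive_beyond n y" and i: "i \<in> {1..n}" and k: "k \<in> vrange (y i)"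
    and x: "\<And>j. j \<in> {1..n} \<Longrightarrow> supp (x j) \<subseteq> vrange (y j)"
  shows "(\<Sum>j=1..n. x j) k = x i k"
proof -
  have "x j k = 0" if "j \<in> {1..n}" "j \<noteq> i" for j
  proof (rule ccontr)
    assume "x j k \<noteq> 0"
    then have "k \<in> vrange (y j)"
      using x[OF that(1)] by (auto simp: supp_def)
    moreover have "vless (y i) (y j) \<or> vless (y j) (y i)"
      using y i that unfolding successive_beyond_def by (meson linorder_neqE_nat)
    ultimately show False
      using k unfolding vless_def by blast
  qed
  then have "(\<Sum>j=1..n. x j k) = (\<Sum>j\<in>{i}. x j k)"
    using i by (intro sum.mono_neutral_right) auto
  then show ?thesis
    by (simp add: sum_seq_apply)
qed

lemma successive_nonzero:
  assumes "successive_beyond n y" "i \<in> {1..n}"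
  obtains k where "k \<in> vrange (y i)" "y i k \<noteq> 0"
proof -
  have "y i \<noteq> 0"
    using assms by (auto simp: successive_beyond_def block_vector_def)
  then obtain k where "y i k \<noteq> 0"
    by (auto simp: fun_eq_iff)
  then show thesis
    using that vrange_supp[of "y i"] by (auto simp: supp_def)
qed

lemma successive_sum_nonzero:
  assumes "successive_beyond n y" "n \<ge> 1"
  shows "(\<Sum>i=1..n. y i) \<noteq> 0"
proof -
  have 1: "1 \<in> {1..n}"
    using assms(2) by simp
  obtain k where "k \<in> vrange (y 1)" "y 1 k \<noteq> 0"
    by (rule successive_nonzero[OF assms(1) 1])
  then have "(\<Sum>i=1..n. y i) k \<noteq> 0"
    using successive_coord[OF assms(1) 1] vrange_supp by simp
  then show ?thesis
    by auto
qed

context mspace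
begin

text \<open>The supremum in \<open>A_fun\<close> only runs over nonzero vectors, so zero vectors are replaced by
  small multiples of unit sequences.\<close>

lemma nrm_sum_le_A_fun_1:
  assumes y: "successive_beyond n y" and supp: "\<And>i. i \<in> {1..n} \<Longrightarrow> supp (x i) \<subseteq> vrange (y i)"
    and le: "\<And>i. i \<in> {1..n} \<Longrightarrow> nrm Y (x i) \<le> 1"
  shows "nrm Y (\<Sum>i=1..n. x i) \<le> A_fun Y n"
proof (rule field_le_epsilon)
  fix e :: real
  assume "e > 0"
  \<comment> \<open>The bound 1 keeps the replacement vectors admissible for the supremum, and
    \<open>e / (n + 1)\<close> keeps the total perturbation of \<open>n\<close> terms below
    \<open>e\<close>.\<close>
  define \<eta> where "\<eta> = min 1 (e / (n + 1))"
  have \<eta>: "0 < \<eta>" "\<eta> \<le> 1" "n * \<eta> \<le> e"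
  proof -
    show "0 < \<eta>" "\<eta> \<le> 1"
      using \<open>e > 0\<close> by (simp_all add: \<eta>_def)
    have "n * \<eta> \<le> n * (e / (n + 1))"
      by (intro mult_left_mono) (simp_all add: \<eta>_def)
    also have "\<dots> \<le> e"
      using \<open>e > 0\<close> by (simp add: field_simps)
    finally show "n * \<eta> \<le> e" .
  qed
  have fin: "finite (vrange (y i))" if "i \<in> {1..n}" for i
    using vrange_interval[of "y i"] y that unfolding successive_beyond_def by (metis finite_atLeastLessThan)
  have x: "x i \<in> carr Y" if "i \<in> {1..n}" for i
    using finite_subset[OF supp[OF that] fin[OF that]] finite_supp_mem by blast
  obtain \<kappa> where \<kappa>: "\<And>i. i \<in> {1..n} \<Longrightarrow> \<kappa> i \<in> vrange (y i)"
  proof -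
    have "\<exists>k. k \<in> vrange (y i)" if i: "i \<in> {1..n}" for i
      by (rule successive_nonzero[OF y i]) blast
    then show thesis
      using that by metis
  qed
  define u where "u i = cscale (of_real (\<eta> / nrm Y (unit_seq (\<kappa> i)))) (unit_seq (\<kappa> i))" for i
  have u: "u i \<in> carr Y" "nrm Y (u i) = \<eta>" for i
    using unit_pos[of "\<kappa> i"] \<eta> by (simp_all add: u_def scale_mem unit_mem nrm_scale norm_divide)
  have supp_u: "supp (u i) \<subseteq> {\<kappa> i}" for i
    by (auto simp: u_def supp_def unit_seq_def)
  define x' where "x' i = (if x i = 0 then u i else x i)" for i
  have x': "x' i \<in> carr Y" "nrm Y (x' i) \<le> 1" "supp (x' i) \<subseteq> vrange (y i)" "x' i \<noteq> 0"
    if i: "i \<in> {1..n}" for i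
  proof -
    show "x' i \<in> carr Y" "nrm Y (x' i) \<le> 1"
      using x[OF i] le[OF i] u \<eta> by (auto simp: x'_def)
    show "supp (x' i) \<subseteq> vrange (y i)"
      using supp[OF i] supp_u[of i] \<kappa>[OF i] by (auto simp: x'_def)
    show "x' i \<noteq> 0"
      using u(2)[of i] \<eta> by (auto simp: x'_def)
  qed
  have succ: "successive_beyond n x'"
    unfolding successive_beyond_def
  proof (intro conjI ballI impI)
    fix i
    assume i: "i \<in> {1..n}"
    show "block_vector (x' i)"
      using x'(3,4)[OF i] fin[OF i] finite_subset unfolding block_vector_def by blast
    show "n < k" if "k \<in> vrange (x' i)" for k
      using that vrange_mono[OF x'(3)[OF i]] y i unfolding successive_beyond_def by blast
    fix j
    assume j: "j \<in> {1..n}" "i < j"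
    then have "vless (y i) (y j)"
      using y i unfolding successive_beyond_def by blast
    then show "vless (x' i) (x' j)"
      unfolding vless_def using vrange_mono[OF x'(3)[OF i]] vrange_mono[OF x'(3)[OF j(1)]] by blast
  qed
  have "nrm Y (\<Sum>i=1..n. x' i) \<le> A_fun Y n"
    unfolding A_fun_def
  proof (rule cSup_upper)
    \<comment> \<open>The supremum is a conditional one in the reals; the triangle inequality
      supplies the upper bound \<open>n\<close>.\<close>
    show "bdd_above {nrm Y (\<Sum>i=1..n. x i) | x. successive_beyond n x \<and> (\<forall>i\<in>{1..n}. nrm Y (x i) \<le> 1)}"
    proof (rule bdd_aboveI[of _ "real n"], safe)
      fix v
      assume v: "successive_beyond n v" "\<forall>i\<in>{1..n}. nrm Y (v i) \<le> 1"
      then have "nrm Y (\<Sum>i=1..n. v i) \<le> (\<Sum>i=1..n. nrm Y (v i))"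
        by (intro nrm_sum finite_supp_mem) (auto simp: successive_beyond_def block_vector_def)
      also have "\<dots> \<le> (\<Sum>i=1..n. 1)"
        using v by (intro sum_mono) auto
      finally show "nrm Y (\<Sum>i=1..n. v i) \<le> real n"
        by simp
    qed
  qed (use succ x'(2) in auto)
  moreover have "nrm Y (\<Sum>i=1..n. x i) \<le> nrm Y (\<Sum>i=1..n. x' i) + nrm Y (\<Sum>i=1..n. x i - x' i)"
    unfolding sum_subtractf by (intro nrm_le_add_diff sum_mem x x')
  moreover have "nrm Y (\<Sum>i=1..n. x i - x' i) \<le> (\<Sum>i=1..n. nrm Y (x i - x' i))"
    by (intro nrm_sum diff_mem x x')
  moreover have "\<dots> \<le> (\<Sum>i=1..n. \<eta>)"
  proof (rule sum_mono)
    fix i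
    show "nrm Y (x i - x' i) \<le> \<eta>"
      using u[of i] \<eta> nrm_minus_commute[OF zero_mem u(1)[of i]] by (auto simp: x'_def)
  qed
  ultimately show "nrm Y (\<Sum>i=1..n. x i) \<le> A_fun Y n + e"
    using \<eta>(3) by simp
qed

lemma nrm_sum_le_A_fun:
  assumes y: "successive_beyond n y" and supp: "\<And>i. i \<in> {1..n} \<Longrightarrow> supp (x i) \<subseteq> vrange (y i)"
    and le: "\<And>i. i \<in> {1..n} \<Longrightarrow> nrm Y (x i) \<le> K" and K: "K \<ge> 0"
  shows "nrm Y (\<Sum>i=1..n. x i) \<le> K * A_fun Y n"
proof -
  have x: "x i \<in> carr Y" if "i \<in> {1..n}" for i
    using finite_subset[OF supp[OF that]] vrange_interval[of "y i"] finite_supp_mem y that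
    unfolding successive_beyond_def by (metis finite_atLeastLessThan)
  show ?thesis
  proof (cases "K = 0")
    case True
    have "x i = 0" if "i \<in> {1..n}" for i
      using le[OF that] True nrm_ge0[OF x[OF that]] nrm_eq0[OF x[OF that]] by simp
    then have "(\<Sum>i=1..n. x i) = 0"
      by (intro sum.neutral) blast
    then show ?thesis
      using True by simp
  next
    case False
    then have K: "K > 0"
      using K by simp
    have s: "(\<Sum>i=1..n. x i) \<in> carr Y"
      by (intro sum_mem x)
    have "nrm Y (\<Sum>i=1..n. cscale (of_real (1 / K)) (x i)) \<le> A_fun Y n"
    proof (rule nrm_sum_le_A_fun_1[OF y])
      fix i
      assume i: "i \<in> {1..n}"
      show "supp (cscale (of_real (1 / K)) (x i)) \<subseteq> vrange (y i)"
        using supp[OF i] supp_cscale by blast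
      show "nrm Y (cscale (of_real (1 / K)) (x i)) \<le> 1"
        using le[OF i] K by (simp add: nrm_scale x[OF i] norm_divide)
    qed
    then have "nrm Y (\<Sum>i=1..n. x i) / K \<le> A_fun Y n"
      unfolding cscale_sum[symmetric] nrm_scale[OF s] using K by (simp add: norm_divide)
    then show ?thesis
      using K by (simp add: field_simps)
  qed
qed

text \<open>The vectors \<open>y i\<close> themselves, scaled by the sum of their norms, show that
  the supremum is positive. Positivity is what allows \<open>A_fun\<close> to be written as an
  exponential of its logarithm.\<close>

lemma A_fun_pos:
  assumes y: "successive_beyond n y" and n: "n \<ge> 1"
  shows "A_fun Y n > 0"
proof -
  have mem: "y i \<in> carr Y" if "i \<in> {1..n}" for i
    using y that by (intro finite_supp_mem) (auto simp: successive_beyond_def block_vector_def)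
  define K where "K = (\<Sum>i=1..n. nrm Y (y i))"
  have K: "K \<ge> 0"
    unfolding K_def by (intro sum_nonneg nrm_ge0 mem)
  have "nrm Y (y i) \<le> K" if "i \<in> {1..n}" for i
    unfolding K_def by (rule member_le_sum) (use that in \<open>auto intro!: nrm_ge0 mem\<close>)
  then have "nrm Y (\<Sum>i=1..n. y i) \<le> K * A_fun Y n"
    using vrange_supp K by (intro nrm_sum_le_A_fun[OF y]) auto
  moreover have "nrm Y (\<Sum>i=1..n. y i) > 0"
    by (intro nrm_pos sum_mem mem successive_sum_nonzero y n)
  ultimately show ?thesis
    using K by (smt (verit) mult_nonneg_nonpos)
qed

end


section \<open>The derivative of a bounded selection on sums of successive vectors\<close>

locale selection = couple X0 X1 \<theta> for X0 X1 \<theta> +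
  fixes B :: "cseq \<Rightarrow> complex \<Rightarrow> cseq" and C :: real
  assumes B_H: "x \<in> carr X \<Longrightarrow> B x \<in> H" and B_\<Theta>: "x \<in> carr X \<Longrightarrow> B x \<Theta> = x"
    and B_norm: "x \<in> carr X \<Longrightarrow> Hnorm (B x) \<le> C * nrm X x" and C0: "C \<ge> 0"
begin

abbreviation \<Omega> :: "cseq \<Rightarrow> cseq" where "\<Omega> \<equiv> Omega X0 X1 \<theta> B"

abbreviation \<delta> :: real where "\<delta> \<equiv> min \<theta> (1 - \<theta>)"

lemma \<delta>_pos: "\<delta> > 0"
  using \<theta> by simp

lemma Omega_close:
  assumes V: "V \<in> H" "V \<Theta> = x" and d: "has_deriv S V d \<Theta>"
  shows "\<Omega> x - d \<in> carr X" "nrm X (\<Omega> x - d) \<le> (C * nrm X x + Hnorm V) / \<delta>"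
proof -
  have x: "x \<in> carr X"
    using interp_memI(1)[OF V(1)] V(2) by simp
  let ?g = "\<lambda>z. B x z - V z"
  have g: "?g \<in> H" "?g \<Theta> = 0"
    using H_diff(1)[OF B_H[OF x] V(1)] B_\<Theta>[OF x] V(2) by simp_all
  have "has_deriv S ?g (\<Omega> x - d) \<Theta>"
    unfolding Omega_def using V \<Theta>_strip
    by (intro has_deriv_diff H_has_deriv B_H x \<Theta>_interior d H_mem)
  then have eq: "vderiv S ?g \<Theta> = \<Omega> x - d"
    by (rule S.vderiv_eq)
  show "\<Omega> x - d \<in> carr X"
    using vderiv_bound(1)[OF g] unfolding eq .
  have "nrm X (\<Omega> x - d) \<le> Hnorm ?g / \<delta>"
    using vderiv_bound(2)[OF g] unfolding eq .
  also have "\<dots> \<le> (C * nrm X x + Hnorm V) / \<delta>"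
    using H_diff(2)[OF B_H[OF x] V(1)] B_norm[OF x] \<delta>_pos by (intro divide_right_mono) auto
  finally show "nrm X (\<Omega> x - d) \<le> (C * nrm X x + Hnorm V) / \<delta>" .
qed

text \<open>The values of \<open>B y\<close> need not be supported in the range of \<open>y\<close>.
  Cutting them at every \<open>z\<close> makes the lifts of successive vectors fit the ranges that
  \<open>A_fun\<close> measures; the price is a factor 2.\<close>

definition local_lift :: "cseq \<Rightarrow> complex \<Rightarrow> cseq" where
  "local_lift y z = restr (vrange y) (B y z)"

definition local_deriv :: "cseq \<Rightarrow> cseq" where
  "local_deriv y = vderiv S (local_lift y) \<Theta>"

lemma local_lift:
  assumes y: "block_vector y"
  shows "local_lift y \<in> H" "local_lift y \<Theta> = y" "Hnorm (local_lift y) \<le> 2 * C * nrm X y"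
    and "supp (local_lift y z) \<subseteq> vrange y"
    and "\<Omega> y - local_deriv y \<in> carr X" "nrm X (\<Omega> y - local_deriv y) \<le> 3 * C / \<delta> * nrm X y"
proof -
  have yX: "y \<in> carr X"
    using y by (auto simp: block_vector_def intro: X.finite_supp_mem)
  obtain a b where ab: "vrange y = {a..<b}"
    using vrange_interval[OF y] by metis
  show F: "local_lift y \<in> H"
    unfolding local_lift_def[abs_def] ab by (intro H_op[OF _ bounded_op_restr] B_H yX)
  show F\<Theta>: "local_lift y \<Theta> = y"
    unfolding local_lift_def B_\<Theta>[OF yX] by (rule restr_supp[OF vrange_supp])
  have "Hnorm (local_lift y) \<le> 2 * Hnorm (B y)"
    unfolding local_lift_def[abs_def] ab by (intro H_op[OF _ bounded_op_restr] B_H yX)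
  then show le: "Hnorm (local_lift y) \<le> 2 * C * nrm X y"
    using B_norm[OF yX] by simp
  show "supp (local_lift y z) \<subseteq> vrange y"
    unfolding local_lift_def by (rule supp_restr)
  note close = Omega_close[OF F F\<Theta> H_has_deriv[OF F \<Theta>_interior]]
  show "\<Omega> y - local_deriv y \<in> carr X"
    using close(1) by (simp add: local_deriv_def)
  have "nrm X (\<Omega> y - local_deriv y) \<le> (C * nrm X y + Hnorm (local_lift y)) / \<delta>"
    using close(2) by (simp add: local_deriv_def)
  also have "\<dots> \<le> (C * nrm X y + 2 * C * nrm X y) / \<delta>"
    using le \<delta>_pos by (intro divide_right_mono) auto
  finally show "nrm X (\<Omega> y - local_deriv y) \<le> 3 * C / \<delta> * nrm X y"
    by (simp add: field_simps)
qed

text \<open>The exponential factor balances the two boundary estimates, and its derivative at \<open>\<theta>\<close>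
  produces the logarithmic term.\<close>

lemma successive_estimate:
  fixes c :: "nat \<Rightarrow> complex"
  assumes y: "successive_beyond n y" and n: "n \<ge> 1"
    and cK: "\<And>i. i \<in> {1..n} \<Longrightarrow> cmod (c i) * nrm X (y i) \<le> K" and K: "K \<ge> 0"
  defines "A \<equiv> A_fun X0 n powr (1 - \<theta>) * A_fun X1 n powr \<theta>"
    and "L \<equiv> ln (A_fun X0 n / A_fun X1 n)"
    and "s \<equiv> \<Sum>i=1..n. cscale (c i) (y i)"
  shows "nrm X s \<le> 2 * C * K * A"
    and "\<Omega> s - ((\<Sum>i=1..n. cscale (c i) (local_deriv (y i))) + cscale (of_real L) s) \<in> carr X"
    and "nrm X (\<Omega> s - ((\<Sum>i=1..n. cscale (c i) (local_deriv (y i))) + cscale (of_real L) s))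
      \<le> (C + 1) * (2 * C * K * A) / \<delta>"
proof -
  define A0 where "A0 = A_fun X0 n"
  define A1 where "A1 = A_fun X1 n"
  have pos: "A0 > 0" "A1 > 0"
    unfolding A0_def A1_def by (rule X0.A_fun_pos[OF y n], rule X1.A_fun_pos[OF y n])
  have L: "L = ln A0 - ln A1"
    using pos by (simp add: L_def A0_def[symmetric] A1_def[symmetric] ln_div)
  have A: "A = exp ((1 - \<theta>) * ln A0 + \<theta> * ln A1)"
    using pos by (simp add: A_def A0_def[symmetric] A1_def[symmetric] powr_def exp_add)
  have bv: "block_vector (y i)" if "i \<in> {1..n}" for i
    using y that by (simp add: successive_beyond_def)
  note lift = local_lift[OF bv]
  define G where "G z = (\<Sum>i=1..n. cscale (c i) (local_lift (y i) z))" for z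
  have cH: "(\<lambda>z. cscale (c i) (local_lift (y i) z)) \<in> H" if "i \<in> {1..n}" for i
    by (intro H_scale lift(1) that)
  have G: "G \<in> H"
    unfolding G_def by (intro H_sum(1) cH finite_atLeastAtMost)
  have Gs: "G \<Theta> = s"
    unfolding G_def s_def by (intro sum.cong refl) (simp add: lift(2))
  have dG: "has_deriv S G (\<Sum>i=1..n. cscale (c i) (local_deriv (y i))) \<Theta>"
  proof -
    have "has_deriv S G (\<Sum>i=1..n. vderiv S (\<lambda>z. cscale (c i) (local_lift (y i) z)) \<Theta>) \<Theta>"
      unfolding G_def by (intro H_sum(2) cH finite_atLeastAtMost \<Theta>_interior)
    moreover have "vderiv S (\<lambda>z. cscale (c i) (local_lift (y i) z)) \<Theta> = cscale (c i) (local_deriv (y i))"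
      if "i \<in> {1..n}" for i
      unfolding local_deriv_def
      by (intro S.vderiv_eq has_deriv_scale H_has_deriv \<Theta>_interior lift(1) H_mem \<Theta>_strip that)
    ultimately show ?thesis
      by (metis (no_types, lifting) sum.cong)
  qed
  \<comment> \<open>Coefficients matter only through \<open>cmod (c i) * nrm X (y i)\<close>. The
    estimate thus covers signs, with \<open>K = 1\<close>, as well as the diagonal coefficients that
    arise from averaging.\<close>
  have comp: "cmod (c i) * Hnorm (local_lift (y i)) \<le> 2 * C * K" if "i \<in> {1..n}" for i
  proof -
    have "cmod (c i) * Hnorm (local_lift (y i)) \<le> cmod (c i) * (2 * C * nrm X (y i))"
      by (intro mult_left_mono lift(3) that) simp
    also have "\<dots> = 2 * C * (cmod (c i) * nrm X (y i))"
      by simp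
    also have "\<dots> \<le> 2 * C * K"
      using cK[OF that] C0 by (intro mult_left_mono) auto
    finally show ?thesis .
  qed
  have supp: "supp (cscale (c i) (local_lift (y i) z)) \<subseteq> vrange (y i)" if "i \<in> {1..n}" for i z
    using lift(4)[OF that] supp_cscale by blast
  have CK: "2 * C * K \<ge> 0"
    using C0 K by simp
  have G0: "nrm X0 (G (Complex 0 t)) \<le> 2 * C * K * A0" for t
    unfolding G_def A0_def
  proof (rule X0.nrm_sum_le_A_fun[OF y supp _ CK])
    fix i
    assume i: "i \<in> {1..n}"
    have "cmod (c i) * nrm X0 (local_lift (y i) (Complex 0 t)) \<le> cmod (c i) * Hnorm (local_lift (y i))"
      by (intro mult_left_mono Hnorm_ge lift(1) i) simp
    then show "nrm X0 (cscale (c i) (local_lift (y i) (Complex 0 t))) \<le> 2 * C * K"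
      using comp[OF i] unfolding X0.nrm_scale[OF H_mem0[OF lift(1)[OF i]]] by linarith
  qed
  have G1: "nrm X1 (G (Complex 1 t)) \<le> 2 * C * K * A1" for t
    unfolding G_def A1_def
  proof (rule X1.nrm_sum_le_A_fun[OF y supp _ CK])
    fix i
    assume i: "i \<in> {1..n}"
    have "cmod (c i) * nrm X1 (local_lift (y i) (Complex 1 t)) \<le> cmod (c i) * Hnorm (local_lift (y i))"
      by (intro mult_left_mono Hnorm_ge lift(1) i) simp
    then show "nrm X1 (cscale (c i) (local_lift (y i) (Complex 1 t))) \<le> 2 * C * K"
      using comp[OF i] unfolding X1.nrm_scale[OF H_mem1[OF lift(1)[OF i]]] by linarith
  qed
  \<comment> \<open>The modulus is \<open>exp (- \<theta> * L)\<close> on the left line and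
    \<open>exp ((1 - \<theta>) * L)\<close> on the right one, which turns both \<open>A0\<close> and
    \<open>A1\<close> into \<open>A\<close>. Moreover \<open>E \<Theta> = 1\<close> and the
    derivative there is \<open>L\<close>.\<close>
  define E where "E z = exp ((z - \<Theta>) * of_real L)" for z
  have modulus: "cmod (E z) = exp ((Re z - \<theta>) * L)" for z
    by (simp add: E_def norm_exp_eq_Re)
  define V where "V z = cscale (E z) (G z)" for z
  have V: "V \<in> H"
    unfolding V_def
  proof (rule H_mult[OF G])
    show "continuous_on strip E" "E holomorphic_on interior strip"
      unfolding E_def by (auto intro!: continuous_intros holomorphic_intros)
    show "cmod (E z) \<le> exp \<bar>L\<bar>" if "z \<in> strip" for z
    proof -
      have "(Re z - \<theta>) * L \<le> \<bar>Re z - \<theta>\<bar> * \<bar>L\<bar>"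
        by (metis abs_ge_self abs_mult)
      also have "\<dots> \<le> 1 * \<bar>L\<bar>"
        using that \<theta> by (intro mult_right_mono) (auto simp: strip_def)
      finally show ?thesis
        unfolding modulus by simp
    qed
  qed
  have V\<Theta>: "V \<Theta> = s"
    by (simp add: V_def E_def Gs)
  have "(E has_field_derivative of_real L) (at \<Theta>)"
    unfolding E_def by (auto intro!: derivative_eq_intros)
  from S.has_deriv_mult[OF this dG H_mem[OF G \<Theta>_strip]]
  have dV: "has_deriv S V ((\<Sum>i=1..n. cscale (c i) (local_deriv (y i))) + cscale (of_real L) s) \<Theta>"
    unfolding V_def[abs_def] Gs by (simp add: E_def)
  have HV: "Hnorm V \<le> 2 * C * K * A"
  proof (rule Hnorm_le)
    fix t
    have "exp (- \<theta> * L) * A0 = exp (- \<theta> * L + ln A0)"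
      unfolding exp_add using pos by simp
    then have "exp (- \<theta> * L) * A0 = A"
      unfolding A L by (simp add: algebra_simps)
    then have "exp (- \<theta> * L) * (2 * C * K * A0) = 2 * C * K * A"
      by (metis mult.left_commute)
    moreover have "nrm X0 (V (Complex 0 t)) = exp (- \<theta> * L) * nrm X0 (G (Complex 0 t))"
      by (simp add: V_def X0.nrm_scale H_mem0[OF G] modulus)
    moreover have "exp (- \<theta> * L) * nrm X0 (G (Complex 0 t)) \<le> exp (- \<theta> * L) * (2 * C * K * A0)"
      by (intro mult_left_mono G0) simp
    ultimately show "nrm X0 (V (Complex 0 t)) \<le> 2 * C * K * A"
      by linarith
  next
    fix t
    have "exp ((1 - \<theta>) * L) * A1 = exp ((1 - \<theta>) * L + ln A1)"
      unfolding exp_add using pos by simp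
    then have "exp ((1 - \<theta>) * L) * A1 = A"
      unfolding A L by (simp add: algebra_simps)
    then have "exp ((1 - \<theta>) * L) * (2 * C * K * A1) = 2 * C * K * A"
      by (metis mult.left_commute)
    moreover have "nrm X1 (V (Complex 1 t)) = exp ((1 - \<theta>) * L) * nrm X1 (G (Complex 1 t))"
      by (simp add: V_def X1.nrm_scale H_mem1[OF G] modulus)
    moreover have "exp ((1 - \<theta>) * L) * nrm X1 (G (Complex 1 t)) \<le> exp ((1 - \<theta>) * L) * (2 * C * K * A1)"
      by (intro mult_left_mono G1) simp
    ultimately show "nrm X1 (V (Complex 1 t)) \<le> 2 * C * K * A"
      by linarith
  qed
  show s: "nrm X s \<le> 2 * C * K * A"
    using interp_memI(2)[OF V] HV V\<Theta> by simp
  show "\<Omega> s - ((\<Sum>i=1..n. cscale (c i) (local_deriv (y i))) + cscale (of_real L) s) \<in> carr X"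
    by (rule Omega_close(1)[OF V V\<Theta> dV])
  have "nrm X (\<Omega> s - ((\<Sum>i=1..n. cscale (c i) (local_deriv (y i))) + cscale (of_real L) s))
      \<le> (C * nrm X s + Hnorm V) / \<delta>"
    by (rule Omega_close(2)[OF V V\<Theta> dV])
  also have "\<dots> \<le> (C * (2 * C * K * A) + 2 * C * K * A) / \<delta>"
    using s HV C0 \<delta>_pos by (intro divide_right_mono add_mono mult_left_mono) auto
  also have "\<dots> = (C + 1) * (2 * C * K * A) / \<delta>"
    by (simp add: algebra_simps)
  finally show "nrm X (\<Omega> s - ((\<Sum>i=1..n. cscale (c i) (local_deriv (y i))) + cscale (of_real L) s))
      \<le> (C + 1) * (2 * C * K * A) / \<delta>" .
qed

end


section \<open>From an arbitrary subspace to a block sequence\<close>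

section \<open>Block sequences close to a given subspace\<close>

text \<open>Each additional coordinate condition lowers the dimension by at most one: a single
  vector with nonzero \<open>N\<close>-th coordinate restores the previous space. This provides
  vectors of the subspace that start beyond any given index.\<close>

lemma infinite_dim_kernel:
  assumes "cseq.subspace V" "infinite_dim V"
  shows "infinite_dim {x \<in> V. \<forall>k<N. x k = 0}"
proof (induction N)
  case 0
  then show ?case
    using assms(2) by simp
next
  case (Suc N)
  let ?V = "\<lambda>N. {x \<in> V. \<forall>k<N. x k = 0}"
  show ?case
    unfolding infinite_dim_def
  proof
    assume "\<exists>F. finite F \<and> ?V (Suc N) \<subseteq> cseq.span F"
    then obtain F where F: "finite F" "?V (Suc N) \<subseteq> cseq.span F"
      by blast
    obtain v where v: "v \<in> ?V N" "v N \<noteq> 0"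
    proof (rule ccontr)
      assume "\<not> thesis"
      then have "\<And>v. v \<in> ?V N \<Longrightarrow> v N = 0"
        using that by blast
      then have "?V N \<subseteq> ?V (Suc N)"
        by (auto simp: less_Suc_eq)
      then show False
        using Suc F unfolding infinite_dim_def by blast
    qed
    have "x \<in> cseq.span (insert v F)" if x: "x \<in> ?V N" for x
    proof -
      let ?c = "x N / v N"
      have "x - cscale ?c v \<in> ?V (Suc N)"
        using x v cseq.subspace_diff[OF assms(1)] cseq.subspace_scale[OF assms(1)]
        by (auto simp: less_Suc_eq)
      then have "x - cscale ?c v \<in> cseq.span F"
        using F(2) by blast
      then show ?thesis
        unfolding cseq.span_insert by blast
    qed
    then have "?V N \<subseteq> cseq.span (insert v F)"
      by blast
    moreover have "finite (insert v F)"
      using F(1) by simp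
    ultimately show False
      using Suc unfolding infinite_dim_def by blast
  qed
qed

lemma infinite_dim_nonzero:
  assumes "infinite_dim V"
  obtains x where "x \<in> V" "x \<noteq> 0"
proof -
  have "\<not> V \<subseteq> cseq.span {}"
    using assms unfolding infinite_dim_def by blast
  then show thesis
    using that by auto
qed

definition block_sequence :: "(nat \<Rightarrow> cseq) \<Rightarrow> bool" where
  "block_sequence w \<longleftrightarrow> (\<forall>i. block_vector (w i) \<and> vless (w i) (w (Suc i)))"

text \<open>\<open>vless\<close> is not transitive in general, since a zero vector compares with
  everything; an index in the range of the nonzero intermediate block is what links the two
  comparisons.\<close>

lemma block_sequence_vless:
  assumes w: "block_sequence w" and "i < j"
  shows "vless (w i) (w j)"
  using \<open>i < j\<close>
proof (induction rule: strict_inc_induct)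
  case (base i)
  then show ?case
    using w by (simp add: block_sequence_def)
next
  case (step i)
  obtain k where k: "k \<in> supp (w (Suc i))"
    using w unfolding block_sequence_def block_vector_def supp_def by (auto simp: fun_eq_iff)
  then have "k \<in> vrange (w (Suc i))"
    using vrange_supp by blast
  moreover have "vless (w i) (w (Suc i))"
    using w by (simp add: block_sequence_def)
  ultimately show ?case
    using step.IH unfolding vless_def by (meson less_trans)
qed

lemma block_sequence_disjoint:
  assumes "block_sequence w" "k \<in> vrange (w i)" "k \<in> vrange (w j)"
  shows "i = j"
  using block_sequence_vless[OF assms(1), of i j] block_sequence_vless[OF assms(1), of j i] assms(2,3)
  unfolding vless_def by (metis less_irrefl linorder_neqE_nat)

context mspace
begin

text \<open>One step of the gliding hump: a unit vector of \<open>W\<close> vanishing before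
  \<open>N\<close> is truncated far out. The condition \<open>e < 1\<close> ensures that the
  truncation is nonzero.\<close>

lemma block_approximation:
  assumes W: "cseq.subspace W" "W \<subseteq> carr Y" "infinite_dim W" and e: "0 < e" "e < 1"
  shows "\<exists>x w m. x \<in> W \<and> nrm Y x = 1 \<and> nrm Y (w - x) \<le> e \<and> block_vector w \<and> vrange w \<subseteq> {N..<m}"
proof -
  obtain x0 where x0: "x0 \<in> W" "\<And>k. k < N \<Longrightarrow> x0 k = 0" "x0 \<noteq> 0"
    using infinite_dim_nonzero[OF infinite_dim_kernel[OF W(1,3), of N]] by blast
  have x0Y: "x0 \<in> carr Y"
    using x0 W by blast
  define x where "x = cscale (of_real (1 / nrm Y x0)) x0"
  have x: "x \<in> W" "x \<in> carr Y" "nrm Y x = 1" "\<And>k. k < N \<Longrightarrow> x k = 0"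
    using nrm_pos[OF x0Y x0(3)] x0 cseq.subspace_scale[OF W(1)] W(2)
    by (auto simp: x_def nrm_scale[OF x0Y] norm_divide scale_mem[OF x0Y])
  have "\<forall>\<^sub>F m in sequentially. nrm Y (restr {..<m} x - x) < e"
    using tends_init[OF x(2)] e order_tendstoD(2) unfolding tends_def by blast
  then obtain m where m: "nrm Y (restr {..<m} x - x) < e"
    using eventually_happens' sequentially_bot by blast
  have supp: "supp (restr {..<m} x) \<subseteq> {N..<m}"
    using x(4) by (auto simp: supp_def restr_def not_less[symmetric])
  have "nrm Y x \<le> nrm Y (restr {..<m} x) + nrm Y (x - restr {..<m} x)"
    by (intro nrm_le_add_diff init_mem x)
  then have "nrm Y (restr {..<m} x) > 0"
    using m e x(3) nrm_minus_commute[OF x(2) init_mem[OF x(2)], of m] by linarith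
  then have "restr {..<m} x \<noteq> 0"
    using nrm_zero by force
  then have "block_vector (restr {..<m} x)"
    unfolding block_vector_def using finite_subset[OF supp] by blast
  moreover have "vrange (restr {..<m} x) \<subseteq> {N..<m}"
    using supp unfolding vrange_def by fastforce
  ultimately show ?thesis
    using x m less_imp_le by blast
qed

lemma block_sequence_approximation:
  assumes W: "cseq.subspace W" "W \<subseteq> carr Y" "infinite_dim W"
  obtains x w where "block_sequence w" "\<And>i. x i \<in> W" "\<And>i. nrm Y (x i) = 1"
    "\<And>i. nrm Y (w i - x i) \<le> (1 / 2) ^ (i + 2)"
proof -
  \<comment> \<open>The state carries the vector of \<open>W\<close>, its truncation and the right
    end \<open>m\<close>, at which the next block may start. The tolerances
    \<open>(1 / 2) ^ (i + 2)\<close> add up to at most \<open>1 / 2\<close>.\<close>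
  define P where "P i p \<longleftrightarrow> (case p of (x, w, m) \<Rightarrow> x \<in> W \<and> nrm Y x = 1 \<and>
      nrm Y (w - x) \<le> (1 / 2) ^ (i + 2) \<and> block_vector w \<and> vrange w \<subseteq> {..<m})"
    for i and p :: "cseq \<times> cseq \<times> nat"
  define Q where "Q p q \<longleftrightarrow> (case p of (_, _, m) \<Rightarrow> case q of (_, w, _) \<Rightarrow> vrange w \<subseteq> {m..})"
    for p q :: "cseq \<times> cseq \<times> nat"
  have step: "\<exists>x w m. P i (x, w, m) \<and> vrange w \<subseteq> {N..}" for i N
  proof -
    have "(1 / 2 :: real) ^ (i + 2) < 1"
      by (rule power_less_one_iff[THEN iffD2]) auto
    then obtain x w m where "x \<in> W" "nrm Y x = 1" "nrm Y (w - x) \<le> (1 / 2) ^ (i + 2)"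
      "block_vector w" "vrange w \<subseteq> {N..<m}"
      using block_approximation[OF W, of "(1 / 2) ^ (i + 2)" N] by auto
    then have "P i (x, w, m) \<and> vrange w \<subseteq> {N..}"
      unfolding P_def by auto
    then show ?thesis
      by blast
  qed
  have "\<exists>f. \<forall>i. P i (f i) \<and> Q (f i) (f (Suc i))"
  proof (rule dependent_nat_choice)
    show "\<exists>p. P 0 p"
      using step[of 0 0] by blast
    show "\<exists>q. P (Suc i) q \<and> Q p q" for p i
      using step[of "Suc i" "snd (snd p)"] unfolding Q_def by (force split: prod.split)
  qed
  then obtain f where f: "\<And>i. P i (f i)" "\<And>i. Q (f i) (f (Suc i))"
    by blast
  define x where "x i = fst (f i)" for i
  define w where "w i = fst (snd (f i))" for i
  define m where "m i = snd (snd (f i))" for i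
  have f_eq: "f i = (x i, w i, m i)" for i
    by (simp add: x_def w_def m_def)
  have "block_sequence w"
    unfolding block_sequence_def vless_def using f unfolding P_def Q_def f_eq by fastforce
  moreover have "x i \<in> W" "nrm Y (x i) = 1" "nrm Y (w i - x i) \<le> (1 / 2) ^ (i + 2)" for i
    using f(1)[of i] unfolding P_def f_eq by auto
  ultimately show thesis
    using that by blast
qed

end


section \<open>Coordinates along a block sequence\<close>

definition block_index :: "(nat \<Rightarrow> cseq) \<Rightarrow> nat \<Rightarrow> nat" where
  "block_index w k = (SOME i. i \<in> supp (w k))"

text \<open>Reading the coefficient from a single support index makes it linear on all sequences and
  continuous for coordinatewise limits. For a block sequence, the equation
  \<open>block_proj w m y = y\<close> then says that \<open>y\<close> is in the span of the first
  \<open>m\<close> blocks.\<close>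

definition block_coeff :: "(nat \<Rightarrow> cseq) \<Rightarrow> nat \<Rightarrow> cseq \<Rightarrow> complex" where
  "block_coeff w k y = y (block_index w k) / w k (block_index w k)"

definition block_proj :: "(nat \<Rightarrow> cseq) \<Rightarrow> nat \<Rightarrow> cseq \<Rightarrow> cseq" where
  "block_proj w m y = (\<Sum>k<m. cscale (block_coeff w k y) (w k))"

lemma block_coeff_add: "block_coeff w k (y + z) = block_coeff w k y + block_coeff w k z"
  and block_coeff_scale: "block_coeff w k (cscale c y) = c * block_coeff w k y"
  by (simp_all add: block_coeff_def add_divide_distrib)

lemma linear_comb:
  fixes v :: "cseq \<Rightarrow> cseq"
  assumes "\<And>y z. v (y + z) = v y + v z" "\<And>c y. v (cscale c y) = cscale c (v y)"
  shows "v (\<Sum>i\<in>I. cscale (c i) (y i)) = (\<Sum>i\<in>I. cscale (c i) (v (y i)))"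
proof -
  have "v 0 = 0"
    using assms(2)[of 0 0] by simp
  show ?thesis
  proof (induction I rule: infinite_finite_induct)
    case (infinite I)
    show ?case
      unfolding sum.infinite[OF infinite] by (rule \<open>v 0 = 0\<close>)
  next
    case empty
    show ?case
      unfolding sum.empty by (rule \<open>v 0 = 0\<close>)
  next
    case (insert i I)
    show ?case
      unfolding sum.insert[OF insert.hyps] assms insert.IH ..
  qed
qed

lemma block_proj_add: "block_proj w m (y + z) = block_proj w m y + block_proj w m z"
  and block_proj_scale: "block_proj w m (cscale c y) = cscale c (block_proj w m y)"
proof -
  show "block_proj w m (y + z) = block_proj w m y + block_proj w m z"
    unfolding block_proj_def block_coeff_add cseq.scale_left_distrib sum.distrib ..
  show "block_proj w m (cscale c y) = cscale c (block_proj w m y)"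
    unfolding block_proj_def block_coeff_scale cscale_sum by simp
qed

context
  fixes w :: "nat \<Rightarrow> cseq"
  assumes w: "block_sequence w"
begin

lemma block_index_supp: "block_index w k \<in> supp (w k)"
proof -
  have "\<exists>i. i \<in> supp (w k)"
    using w unfolding block_sequence_def block_vector_def supp_def by (auto simp: fun_eq_iff)
  then show ?thesis
    unfolding block_index_def by (rule someI_ex)
qed

lemma block_index_nz: "w k (block_index w k) \<noteq> 0"
  using block_index_supp by (simp add: supp_def)

lemma block_off: "i \<in> vrange (w k) \<Longrightarrow> j \<noteq> k \<Longrightarrow> w j i = 0"
  using block_sequence_disjoint[OF w, of i j k] vrange_supp[of "w j"] by (auto simp: supp_def)

lemma block_sum_apply:
  assumes "i \<in> vrange (w k)"
  shows "(\<Sum>j<m. cscale (a j) (w j)) i = (if k < m then a k * w k i else 0)"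
proof -
  have "(\<Sum>j<m. cscale (a j) (w j)) i = (\<Sum>j<m. if j = k then a k * w k i else 0)"
    unfolding sum_seq_apply by (intro sum.cong) (auto simp: block_off[OF assms])
  then show ?thesis
    by simp
qed

text \<open>The sequences proportional to \<open>w k\<close> on each range and zero elsewhere, that
  is, the formal infinite combinations of the blocks. These conditions survive coordinatewise
  limits, so they hold on the closure of the span.\<close>

definition block_pattern :: "cseq set" where
  "block_pattern = {y. (\<forall>k. \<forall>i\<in>vrange (w k). y i = block_coeff w k y * w k i) \<and>
     (\<forall>i. (\<forall>k. i \<notin> vrange (w k)) \<longrightarrow> y i = 0)}"

lemma span_block_pattern: "cseq.span (range w) \<subseteq> block_pattern"
proof (rule cseq.span_minimal)
  show "range w \<subseteq> block_pattern"
  proof safe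
    fix j
    have "w j i = block_coeff w k (w j) * w k i" if i: "i \<in> vrange (w k)" for k i
    proof (cases "j = k")
      case True
      then show ?thesis
        using block_index_nz by (simp add: block_coeff_def)
    next
      case False
      then show ?thesis
        using block_off[OF i False] block_off[of "block_index w k" k j] block_index_supp vrange_supp
        by (auto simp: block_coeff_def)
    qed
    moreover have "w j i = 0" if "\<forall>k. i \<notin> vrange (w k)" for i
      using that vrange_supp[of "w j"] by (auto simp: supp_def)
    ultimately show "w j \<in> block_pattern"
      by (simp add: block_pattern_def)
  qed
  show "cseq.subspace block_pattern"
    unfolding cseq.subspace_def block_pattern_def
    by (auto simp: block_coeff_add block_coeff_scale distrib_right) (simp add: block_coeff_def)
qed

text \<open>Distinct blocks have distinct indices, so a finite support contains only finitely many
  of them and all later coefficients vanish.\<close>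

lemma block_pattern_proj:
  assumes y: "y \<in> block_pattern" and fin: "finite (supp y)"
  shows "\<exists>m0. \<forall>m\<ge>m0. block_proj w m y = y"
proof -
  have "inj (block_index w)"
    using block_index_supp vrange_supp block_sequence_disjoint[OF w] by (intro injI) (metis subsetD)
  then have "finite (block_index w -` supp y)"
    by (rule finite_vimageI[OF fin])
  from finite_nat_bounded[OF this]
  obtain m0 where "block_index w -` supp y \<subseteq> {..<m0}" ..
  then have m0: "\<And>k. k \<in> block_index w -` supp y \<Longrightarrow> k < m0"
    by auto
  have "block_proj w m y i = y i" if m: "m \<ge> m0" for m i
  proof (cases "\<exists>k. i \<in> vrange (w k)")
    case True
    then obtain k where k: "i \<in> vrange (w k)"
      by blast
    then have yi: "y i = block_coeff w k y * w k i"
      using y by (simp add: block_pattern_def)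
    show ?thesis
    proof (cases "k < m")
      case False
      then have "k \<notin> block_index w -` supp y"
        using m0 m by fastforce
      then have "block_coeff w k y = 0"
        by (simp add: supp_def block_coeff_def)
      then show ?thesis
        unfolding block_proj_def block_sum_apply[OF k] yi by simp
    qed (simp add: block_proj_def block_sum_apply[OF k] yi)
  next
    case False
    then have "w k i = 0" for k
      using vrange_supp[of "w k"] by (auto simp: supp_def)
    moreover have "y i = 0"
      using y False by (simp add: block_pattern_def)
    ultimately show ?thesis
      by (simp add: block_proj_def sum_seq_apply)
  qed
  then show ?thesis
    by (auto simp: fun_eq_iff)
qed

end

text \<open>Block vectors in a closed block-subspace already lie in the algebraic span. This is why
  finite spans suffice for transferring triviality.\<close>

lemma (in mspace) closure_block_proj:
  assumes w: "block_sequence w" and y: "y \<in> norm_topology Y closure_of cseq.span (range w)"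
    and fin: "finite (supp y)"
  shows "\<exists>m0. \<forall>m\<ge>m0. block_proj w m y = y"
proof (rule block_pattern_proj[OF w _ fin])
  have yY: "y \<in> carr Y" and approx: "\<And>r. r > 0 \<Longrightarrow> \<exists>s\<in>cseq.span (range w). s \<in> M.mball y r"
    using y unfolding norm_topology_def M.metric_closure_of by auto
  have "\<exists>s\<in>cseq.span (range w). s \<in> carr Y \<and> nrm Y (s - y) < inverse (real (Suc n))" for n
    using approx[of "inverse (real (Suc n))"] nrm_minus_commute yY
    by (auto simp: M.in_mball sdist_def Bex_def)
  then obtain s where s: "\<And>n. s n \<in> cseq.span (range w)" "\<And>n. s n \<in> carr Y"
    "\<And>n. nrm Y (s n - y) < inverse (real (Suc n))"
    by metis
  have "tends Y s y sequentially"
    by (rule tendsI[OF yY _ _ LIMSEQ_inverse_real_of_nat])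
      (intro always_eventually allI s less_imp_le[OF s(3)])+
  note lim = tends_coord[OF this]
  have pat: "s n \<in> block_pattern w" for n
    using span_block_pattern[OF w] s(1) by blast
  have "y i = block_coeff w k y * w k i" if i: "i \<in> vrange (w k)" for i k
  proof -
    have "(\<lambda>n. s n i) \<longlonglongrightarrow> block_coeff w k y * w k i"
    proof -
      have "(\<lambda>n. block_coeff w k (s n) * w k i) \<longlonglongrightarrow> block_coeff w k y * w k i"
        unfolding block_coeff_def by (intro tendsto_intros lim block_index_nz[OF w])
      moreover have "s n i = block_coeff w k (s n) * w k i" for n
        using pat[of n] i by (simp add: block_pattern_def[OF w])
      ultimately show ?thesis
        by simp
    qed
    then show ?thesis
      using lim[of i] LIMSEQ_unique by blast
  qed
  moreover have "y i = 0" if "\<forall>k. i \<notin> vrange (w k)" for i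
  proof -
    have "s n i = 0" for n
      using pat[of n] that by (simp add: block_pattern_def[OF w])
    then have "(\<lambda>n. s n i) \<longlonglongrightarrow> 0"
      by simp
    then show ?thesis
      using lim[of i] LIMSEQ_unique by blast
  qed
  ultimately show "y \<in> block_pattern w"
    by (simp add: block_pattern_def[OF w])
qed


section \<open>Triviality on a subspace passes to a nearby block sequence\<close>

context selection
begin

lemma sum_half_powers_le: "(\<Sum>k<m. (1 / 2 :: real) ^ (k + 2)) \<le> 1 / 2"
proof -
  have "(\<Sum>k<m. (1 / 2 :: real) ^ (k + 2)) = 1 / 2 - (1 / 2) ^ (m + 1)"
    by (induction m) simp_all
  then show ?thesis
    by simp
qed

text \<open>The block \<open>w k\<close> is within \<open>1 / 2\<close> of a unit vector, so its
  norm is at least \<open>1 / 2\<close>; restricting \<open>y\<close> to its range costs a factor 2.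
  Together these give 4.\<close>

lemma block_coeff_bound:
  assumes w: "block_sequence w" and x: "\<And>i. x i \<in> carr X" "\<And>i. nrm X (x i) = 1"
    and wx: "\<And>i. nrm X (w i - x i) \<le> (1 / 2) ^ (i + 2)"
    and y: "block_proj w m y = y" and k: "k < m"
  shows "cmod (block_coeff w k y) \<le> 4 * nrm X y"
proof -
  have wX: "w i \<in> carr X" for i
    using w by (auto simp: block_sequence_def block_vector_def intro: X.finite_supp_mem)
  have "block_proj w m y \<in> carr X"
    unfolding block_proj_def by (intro X.sum_mem X.scale_mem wX)
  then have yX: "y \<in> carr X"
    unfolding y .
  have "(1 / 2 :: real) ^ (k + 2) \<le> (1 / 2) ^ 1"
    by (intro power_decreasing) auto
  moreover have "nrm X (x k) \<le> nrm X (w k) + nrm X (x k - w k)"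
    by (intro X.nrm_le_add_diff x wX)
  ultimately have "1 / 2 \<le> nrm X (w k)"
    using wx[of k] x(2)[of k] X.nrm_minus_commute[OF x(1)[of k] wX[of k]] by simp
  then have "cmod (block_coeff w k y) * (1 / 2) \<le> cmod (block_coeff w k y) * nrm X (w k)"
    by (intro mult_left_mono) auto
  also have "\<dots> = nrm X (restr (vrange (w k)) y)"
  proof -
    have "restr (vrange (w k)) y = cscale (block_coeff w k y) (w k)"
    proof
      fix i
      show "restr (vrange (w k)) y i = cscale (block_coeff w k y) (w k) i"
      proof (cases "i \<in> vrange (w k)")
        case True
        have "y i = block_proj w m y i"
          by (simp add: y)
        then show ?thesis
          using True k by (simp add: restr_def block_proj_def block_sum_apply[OF w True])
      next
        case False
        then show ?thesis
          using vrange_supp[of "w k"] by (auto simp: restr_def supp_def)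
      qed
    qed
    then show ?thesis
      by (simp add: X.nrm_scale wX)
  qed
  also have "\<dots> \<le> 2 * nrm X y"
    using vrange_interval[of "w k"] w X.nrm_restr_interval[OF yX] unfolding block_sequence_def by metis
  finally show ?thesis
    by simp
qed

text \<open>Replace each \<open>w k\<close> by \<open>x k\<close>, which lies in \<open>W\<close>,
  and correct by the derivatives belonging to the small differences. The coefficient bound 4 and the
  total tolerance \<open>1 / 2\<close> make the replacement error at most
  \<open>2 * nrm X y\<close>, hence \<open>nrm X (T y) \<le> 3 * nrm X y\<close>; this is the factor
  3 of \<open>D\<close>.\<close>

lemma trivial_transfer:
  assumes W: "cseq.subspace W" "W \<subseteq> carr X" and l: "linear_on W l"
    and triv: "\<And>x. x \<in> W \<Longrightarrow> \<Omega> x - l x \<in> carr X \<and> nrm X (\<Omega> x - l x) \<le> D * nrm X x" and D: "D \<ge> 0"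
    and w: "block_sequence w" and x: "\<And>i. x i \<in> W" "\<And>i. nrm X (x i) = 1"
    and wx: "\<And>i. nrm X (w i - x i) \<le> (1 / 2) ^ (i + 2)"
  shows "\<exists>v. (\<forall>y z. v (y + z) = v y + v z) \<and> (\<forall>c y. v (cscale c y) = cscale c (v y)) \<and>
    (\<forall>y. block_proj w m y = y \<longrightarrow>
      \<Omega> y - v y \<in> carr X \<and> nrm X (\<Omega> y - v y) \<le> (6 * C / \<delta> + 3 * D) * nrm X y)"
proof -
  have wX: "w i \<in> carr X" for i
    using w by (auto simp: block_sequence_def block_vector_def intro: X.finite_supp_mem)
  have xX: "x i \<in> carr X" for i
    using x W by blast
  define T where "T y = (\<Sum>k<m. cscale (block_coeff w k y) (x k))" for y
  define U where "U y = (\<Sum>k<m. cscale (block_coeff w k y) (\<Omega> (w k - x k)))" for y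
  \<comment> \<open>Although \<Omega> is not linear, \<open>U\<close> is: in \<open>U\<close> it is
    evaluated only at the fixed vectors \<open>w k - x k\<close>, with the coefficients
    outside.\<close>
  define v where "v y = l (T y) + U y" for y
  have T: "T y \<in> W" for y
    unfolding T_def by (intro cseq.subspace_sum[OF W(1)] cseq.subspace_scale[OF W(1)] x)
  have add: "T (y + z) = T y + T z" "U (y + z) = U y + U z" for y z
    unfolding T_def U_def block_coeff_add cseq.scale_left_distrib sum.distrib by (rule refl)+
  have scale: "T (cscale c y) = cscale c (T y)" "U (cscale c y) = cscale c (U y)" for c y
    unfolding T_def U_def block_coeff_scale cscale_sum by simp_all
  have v_add: "v (y + z) = v y + v z" for y z
  proof -
    have "l (T y + T z) = l (T y) + l (T z)"
      using l T unfolding linear_on_def by blast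
    then show ?thesis
      unfolding v_def add by (simp only: ac_simps)
  qed
  have v_scale: "v (cscale c y) = cscale c (v y)" for c y
  proof -
    have "l (cscale c (T y)) = cscale c (l (T y))"
      using l T unfolding linear_on_def by blast
    then show ?thesis
      unfolding v_def scale cscale_add by (simp only:)
  qed
  have close: "\<Omega> y - v y \<in> carr X \<and> nrm X (\<Omega> y - v y) \<le> (6 * C / \<delta> + 3 * D) * nrm X y"
    if y: "block_proj w m y = y" for y
  proof -
    let ?a = "\<lambda>k. block_coeff w k y"
    have a: "cmod (?a k) \<le> 4 * nrm X y" if "k < m" for k
      by (rule block_coeff_bound[OF w xX x(2) wx y that])
    have TX: "T y \<in> carr X"
      using T W by blast
    have dX: "w k - x k \<in> carr X" for k
      by (intro X.diff_mem wX xX)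
    have yT: "y - T y = (\<Sum>k<m. cscale (?a k) (w k - x k))"
      unfolding cscale_diff sum_subtractf T_def using y by (simp add: block_proj_def)
    have "block_proj w m y \<in> carr X"
      unfolding block_proj_def by (intro X.sum_mem X.scale_mem wX)
    then have yX: "y \<in> carr X"
      unfolding y .
    have y0: "nrm X y \<ge> 0"
      by (rule X.nrm_ge0[OF yX])
    have coef_sum: "(\<Sum>k<m. cmod (?a k) * nrm X (w k - x k)) \<le> 2 * nrm X y"
    proof -
      have "(\<Sum>k<m. cmod (?a k) * nrm X (w k - x k)) \<le> (\<Sum>k<m. 4 * nrm X y * (1 / 2) ^ (k + 2))"
        by (intro sum_mono mult_mono a wx X.nrm_ge0 dX) (use y0 in auto)
      also have "\<dots> = 4 * nrm X y * (\<Sum>k<m. (1 / 2) ^ (k + 2))"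
        by (simp only: sum_distrib_left)
      also have "\<dots> \<le> 4 * nrm X y * (1 / 2)"
        using y0 by (intro mult_left_mono sum_half_powers_le) auto
      finally show ?thesis
        by simp
    qed
    have "nrm X (y - T y) \<le> (\<Sum>k<m. nrm X (cscale (?a k) (w k - x k)))"
      unfolding yT by (intro X.nrm_sum X.scale_mem dX)
    also have "\<dots> = (\<Sum>k<m. cmod (?a k) * nrm X (w k - x k))"
      by (intro sum.cong refl X.nrm_scale dX)
    finally have T_le: "nrm X (T y) \<le> 3 * nrm X y"
      using coef_sum X.nrm_le_add_diff[OF TX yX] X.nrm_minus_commute[OF TX yX] by linarith
    define G where "G k z = cscale (?a k) (B (w k - x k) z)" for k z
    have G: "G k \<in> H" "Hnorm (G k) \<le> cmod (?a k) * (C * nrm X (w k - x k))"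
      "vderiv S (G k) \<Theta> = cscale (?a k) (\<Omega> (w k - x k))" for k
    proof -
      show "G k \<in> H"
        unfolding G_def by (intro H_scale B_H dX)
      have "Hnorm (G k) \<le> cmod (?a k) * Hnorm (B (w k - x k))"
        unfolding G_def by (intro H_scale B_H dX)
      also have "\<dots> \<le> cmod (?a k) * (C * nrm X (w k - x k))"
        by (intro mult_left_mono B_norm dX) simp
      finally show "Hnorm (G k) \<le> cmod (?a k) * (C * nrm X (w k - x k))" .
      show "vderiv S (G k) \<Theta> = cscale (?a k) (\<Omega> (w k - x k))"
        unfolding G_def Omega_def
        by (intro S.vderiv_eq has_deriv_scale H_has_deriv \<Theta>_interior B_H dX H_mem \<Theta>_strip)
    qed
    \<comment> \<open>An admissible function through \<open>y\<close> whose derivative at \<theta>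
      is \<open>\<Omega> (T y) + U y\<close>. Its norm is at most \<open>C * (3 + 2)\<close> times
      that of \<open>y\<close>; \<open>Omega_close\<close> adds one more \<open>C\<close>, which
      explains the constant \<open>6 * C / \<delta>\<close>.\<close>
    define V where "V z = B (T y) z + (\<Sum>k<m. G k z)" for z
    have sumG: "(\<lambda>z. \<Sum>k<m. G k z) \<in> H"
      by (intro H_sum(1) G finite_lessThan)
    have V: "V \<in> H"
      unfolding V_def by (intro H_add B_H TX sumG)
    have "(\<Sum>k<m. G k \<Theta>) = y - T y"
      unfolding yT G_def by (intro sum.cong refl) (simp add: B_\<Theta> dX)
    then have V\<Theta>: "V \<Theta> = y"
      unfolding V_def B_\<Theta>[OF TX] by simp
    have "has_deriv S (\<lambda>z. \<Sum>k<m. G k z) (\<Sum>k<m. vderiv S (G k) \<Theta>) \<Theta>"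
      by (intro H_sum(2) G finite_lessThan \<Theta>_interior)
    then have "has_deriv S (\<lambda>z. \<Sum>k<m. G k z) (U y) \<Theta>"
      unfolding G(3) U_def .
    then have dV: "has_deriv S V (\<Omega> (T y) + U y) \<Theta>"
      unfolding V_def Omega_def by (intro S.has_deriv_add H_has_deriv B_H TX \<Theta>_interior)
    have "Hnorm V \<le> Hnorm (B (T y)) + Hnorm (\<lambda>z. \<Sum>k<m. G k z)"
      unfolding V_def by (intro H_add B_H TX sumG)
    also have "\<dots> \<le> C * nrm X (T y) + (\<Sum>k<m. Hnorm (G k))"
      by (intro add_mono B_norm TX H_sum(3) G finite_lessThan)
    also have "\<dots> \<le> C * nrm X (T y) + (\<Sum>k<m. C * (cmod (?a k) * nrm X (w k - x k)))"
      by (intro add_left_mono sum_mono) (metis G(2) mult.left_commute)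
    also have "\<dots> = C * (nrm X (T y) + (\<Sum>k<m. cmod (?a k) * nrm X (w k - x k)))"
      by (simp only: sum_distrib_left distrib_left)
    also have "\<dots> \<le> C * (5 * nrm X y)"
      using T_le coef_sum C0 by (intro mult_left_mono) auto
    finally have HV: "Hnorm V \<le> C * (5 * nrm X y)" .
    note oc = Omega_close[OF V V\<Theta> dV]
    have "nrm X (\<Omega> y - (\<Omega> (T y) + U y)) \<le> (C * nrm X y + C * (5 * nrm X y)) / \<delta>"
      using oc(2) HV \<delta>_pos by (elim order.trans) (intro divide_right_mono, auto)
    then have 1: "nrm X (\<Omega> y - (\<Omega> (T y) + U y)) \<le> 6 * C / \<delta> * nrm X y"
      by (simp add: field_simps)
    have 2: "\<Omega> (T y) - l (T y) \<in> carr X" "nrm X (\<Omega> (T y) - l (T y)) \<le> D * (3 * nrm X y)"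
      using triv[OF T] mult_left_mono[OF T_le D] order_trans by blast+
    have eq: "\<Omega> y - v y = (\<Omega> y - (\<Omega> (T y) + U y)) + (\<Omega> (T y) - l (T y))"
      unfolding v_def by (rule ext) simp
    have "nrm X (\<Omega> y - v y) \<le> 6 * C / \<delta> * nrm X y + D * (3 * nrm X y)"
      unfolding eq using X.nrm_add[OF oc(1) 2(1)] 1 2(2) by linarith
    also have "\<dots> = (6 * C / \<delta> + 3 * D) * nrm X y"
      by (simp only: distrib_right mult.assoc mult.left_commute)
    finally show ?thesis
      unfolding eq using X.add_mem[OF oc(1) 2(1)] by blast
  qed
  show ?thesis
    using v_add v_scale close by blast
qed

end


section \<open>Sign averages and the final contradiction\<close>

section \<open>Averaging over signs\<close>

definition sgn_of :: "nat set \<Rightarrow> nat \<Rightarrow> complex" where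
  "sgn_of T i = (if i \<in> T then - 1 else 1)"

text \<open>Orthogonality of Rademacher functions: toggling the membership of \<open>i\<close> is an
  involution that negates every term when \<open>i\<close> and \<open>j\<close> differ.\<close>

lemma sgn_of_orthogonal:
  assumes "i \<in> {1..n}"
  shows "(\<Sum>T\<in>Pow {1..n}. sgn_of T i * sgn_of T j) = (if i = j then 2 ^ n else 0)"
proof (cases "i = j")
  case True
  have "(\<Sum>T\<in>Pow {1..n}. sgn_of T j * sgn_of T j) = (\<Sum>T\<in>Pow {1..n}. 1)"
    by (intro sum.cong) (auto simp: sgn_of_def)
  then show ?thesis
    using True by (simp add: card_Pow)
next
  case False
  let ?f = "\<lambda>T. sgn_of T i * sgn_of T j"
  let ?flip = "\<lambda>T. if i \<in> T then T - {i} else insert i T"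
  have "sum ?f (Pow {1..n}) = (\<Sum>T\<in>Pow {1..n}. - ?f T)"
    by (rule sum.reindex_bij_witness[of _ ?flip ?flip])
      (use assms False in \<open>auto simp: sgn_of_def insert_absorb split: if_splits\<close>)
  then have "sum ?f (Pow {1..n}) = - sum ?f (Pow {1..n})"
    by (simp only: sum_negf)
  then show ?thesis
    using False by simp
qed

lemma span_successive:
  fixes y :: "nat \<Rightarrow> cseq"
  assumes "z \<in> cseq.span (y ` {1..n})"
  obtains a where "z = (\<Sum>i=1..n. cscale (a i) (y i))"
proof -
  let ?V = "{z. \<exists>a. z = (\<Sum>i=1..n. cscale (a i) (y i))}"
  have "cseq.span (y ` {1..n}) \<subseteq> ?V"
  proof (rule cseq.span_minimal)
    show "y ` {1..n} \<subseteq> ?V"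
    proof safe
      fix i
      assume i: "i \<in> {1..n}"
      have "(\<Sum>j=1..n. cscale (if j = i then 1 else 0) (y j)) = (\<Sum>j\<in>{i}. cscale (if j = i then 1 else 0) (y j))"
        by (rule sum.mono_neutral_right) (use i in auto)
      then have "y i = (\<Sum>j=1..n. cscale (if j = i then 1 else 0) (y j))"
        by simp
      then show "\<exists>a. y i = (\<Sum>i=1..n. cscale (a i) (y i))"
        by (rule exI[of _ "\<lambda>j. if j = i then 1 else 0"])
    qed
    show "cseq.subspace ?V"
      unfolding cseq.subspace_def mem_Collect_eq
    proof (intro conjI allI ballI)
      show "\<exists>a. 0 = (\<Sum>i=1..n. cscale (a i) (y i))"
        by (rule exI[of _ "\<lambda>_. 0"]) simp
    next
      fix p q
      assume "p \<in> ?V" "q \<in> ?V"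
      then obtain a b where "p = (\<Sum>i=1..n. cscale (a i) (y i))" "q = (\<Sum>i=1..n. cscale (b i) (y i))"
        by blast
      then have "p + q = (\<Sum>i=1..n. cscale (a i + b i) (y i))"
        by (simp only: cseq.scale_left_distrib sum.distrib)
      then show "\<exists>a. p + q = (\<Sum>i=1..n. cscale (a i) (y i))"
        by (rule exI[of _ "\<lambda>i. a i + b i"])
    next
      fix c p
      assume "p \<in> ?V"
      then obtain a where "p = (\<Sum>i=1..n. cscale (a i) (y i))"
        by blast
      then have "cscale c p = (\<Sum>i=1..n. cscale (c * a i) (y i))"
        by (simp only: cscale_sum cscale_cscale)
      then show "\<exists>a. cscale c p = (\<Sum>i=1..n. cscale (a i) (y i))"
        by (rule exI[of _ "\<lambda>i. c * a i"])
    qed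
  qed
  then show thesis
    using assms that by blast
qed

lemma (in nspace) linear_on_sum:
  assumes P: "linear_on (carr Y) P" and "finite I" and "\<And>i. i \<in> I \<Longrightarrow> u i \<in> carr Y"
  shows "P (\<Sum>i\<in>I. cscale (c i) (u i)) = (\<Sum>i\<in>I. cscale (c i) (P (u i)))"
  using assms(2,3)
proof (induction I rule: finite_induct)
  case empty
  have "P (cscale 0 0) = cscale 0 (P 0)"
    using P zero_mem unfolding linear_on_def by blast
  then have "P 0 = 0"
    by simp
  then show ?case
    unfolding sum.empty .
next
  case (insert i I)
  have IH: "P (\<Sum>i\<in>I. cscale (c i) (u i)) = (\<Sum>i\<in>I. cscale (c i) (P (u i)))"
    using insert by blast
  have "P (cscale (c i) (u i) + (\<Sum>i\<in>I. cscale (c i) (u i)))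
      = P (cscale (c i) (u i)) + P (\<Sum>i\<in>I. cscale (c i) (u i))"
    using P insert.prems unfolding linear_on_def by (simp add: scale_mem sum_mem)
  moreover have "P (cscale (c i) (u i)) = cscale (c i) (P (u i))"
    using P insert.prems unfolding linear_on_def by simp
  ultimately have "P (cscale (c i) (u i) + (\<Sum>i\<in>I. cscale (c i) (u i)))
      = cscale (c i) (P (u i)) + (\<Sum>i\<in>I. cscale (c i) (P (u i)))"
    by (simp only: IH)
  then show ?case
    unfolding sum.insert[OF insert.hyps] .
qed

text \<open>Projecting onto the span of the \<open>y i\<close> and averaging over the signs keeps only the diagonal
  of the matrix of coefficients of the vectors \<open>P (v i)\<close>.\<close>

lemma (in nspace) diagonal_averaging:
  assumes y: "\<And>i. i \<in> {1..n} \<Longrightarrow> y i \<in> carr Y" and unc: "unconditional Y n y lam" and lam: "lam \<ge> 1"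
    and compl: "complemented Y (cseq.span (y ` {1..n})) M" and M: "M \<ge> 0"
    and v: "\<And>i. i \<in> {1..n} \<Longrightarrow> v i \<in> carr Y" "\<And>i. i \<in> {1..n} \<Longrightarrow> nrm Y (v i) \<le> K"
    and R: "\<And>T. nrm Y (cscale L (\<Sum>i=1..n. cscale (sgn_of T i) (y i)) - (\<Sum>i=1..n. cscale (sgn_of T i) (v i))) \<le> R"
  shows "\<exists>b. (\<forall>i\<in>{1..n}. cmod (b i) * nrm Y (y i) \<le> lam * M * K) \<and>
    nrm Y (\<Sum>i=1..n. cscale (L - b i) (y i)) \<le> lam * M * R"
proof -
  obtain P where P: "linear_on (carr Y) P" "P ` carr Y = cseq.span (y ` {1..n})"
    "\<And>x. x \<in> carr Y \<Longrightarrow> P (P x) = P x" "\<And>x. x \<in> carr Y \<Longrightarrow> nrm Y (P x) \<le> M * nrm Y x"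
    using compl unfolding complemented_def by blast
  have P_add: "P (a + b) = P a + P b" if "a \<in> carr Y" "b \<in> carr Y" for a b
    using P(1) that unfolding linear_on_def by blast
  have P_scale: "P (cscale c a) = cscale c (P a)" if "a \<in> carr Y" for a c
    using P(1) that unfolding linear_on_def by blast
  have Py: "P (y i) = y i" if i: "i \<in> {1..n}" for i
  proof -
    have "y i \<in> P ` carr Y"
      unfolding P(2) using i by (intro cseq.span_base) blast
    then show ?thesis
      using P(3) by auto
  qed
  have signs: "nrm Y (\<Sum>i=1..n. cscale (s i * a i) (y i)) \<le> lam * nrm Y (\<Sum>i=1..n. cscale (a i) (y i))"
    if "\<And>i. s i \<in> {-1, 1}" for s a
    using unc that unfolding unconditional_def by blast
  have "\<exists>a. P (v i) = (\<Sum>j=1..n. cscale (a j) (y j))" if "i \<in> {1..n}" for i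
  proof -
    have "P (v i) \<in> cseq.span (y ` {1..n})"
      using P(2) v(1)[OF that] by blast
    then show ?thesis
      by (rule span_successive) blast
  qed
  then obtain m where m: "\<And>i. i \<in> {1..n} \<Longrightarrow> P (v i) = (\<Sum>j=1..n. cscale (m i j) (y j))"
    by metis
  have comb: "(\<Sum>i=1..n. cscale (a i) (y i)) \<in> carr Y" for a
    by (intro sum_mem scale_mem y)
  have diag: "cmod (m i i) * nrm Y (y i) \<le> lam * M * K" if i: "i \<in> {1..n}" for i
  proof -
    \<comment> \<open>With sign 1 at \<open>i\<close> and -1 elsewhere, adding the signed vector to
      the original one isolates twice the diagonal entry. The resulting factor
      \<open>1 + lam\<close> is at most \<open>2 * lam\<close>.\<close>
    define s where "s j = (if j = i then 1 else - 1 :: complex)" for j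
    have s: "s j \<in> {-1, 1}" for j
      by (simp add: s_def)
    let ?p = "\<Sum>j=1..n. cscale (m i j) (y j)" and ?q = "\<Sum>j=1..n. cscale (s j * m i j) (y j)"
    have "?p + ?q = (\<Sum>j=1..n. cscale (m i j + s j * m i j) (y j))"
      by (simp only: cseq.scale_left_distrib sum.distrib)
    also have "\<dots> = (\<Sum>j\<in>{i}. cscale (m i j + s j * m i j) (y j))"
      by (rule sum.mono_neutral_right) (use i in \<open>auto simp: s_def\<close>)
    also have "\<dots> = cscale (2 * m i i) (y i)"
      by (simp add: s_def)
    finally have eq: "cscale (2 * m i i) (y i) = ?p + ?q" ..
    have "2 * (cmod (m i i) * nrm Y (y i)) = nrm Y (?p + ?q)"
      unfolding eq[symmetric] nrm_scale[OF y[OF i]] by (simp add: norm_mult)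
    also have "\<dots> \<le> nrm Y ?p + lam * nrm Y ?p"
      by (rule order.trans[OF nrm_add[OF comb comb] add_left_mono[OF signs[OF s]]])
    also have "\<dots> \<le> 2 * (lam * nrm Y ?p)"
      using mult_right_mono[OF lam nrm_ge0[OF comb], of "m i"] by simp
    also have "nrm Y ?p \<le> M * K"
      using P(4)[OF v(1)[OF i]] mult_left_mono[OF v(2)[OF i] M] unfolding m[OF i] by linarith
    finally show ?thesis
      using lam by (simp add: mult_left_mono mult.assoc)
  qed
  \<comment> \<open>The coefficients, with respect to the \<open>y j\<close>, of the projection of
    the signed combination bounded by \<open>R\<close>.\<close>
  define c where "c T j = L * sgn_of T j - (\<Sum>i=1..n. sgn_of T i * m i j)" for T j
  have c_le: "nrm Y (\<Sum>j=1..n. cscale (c T j) (y j)) \<le> M * R" for T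
  proof -
    let ?s = "\<Sum>i=1..n. cscale (sgn_of T i) (y i)" and ?t = "\<Sum>i=1..n. cscale (sgn_of T i) (v i)"
    have t: "?t \<in> carr Y"
      by (intro sum_mem scale_mem v)
    have s: "cscale L ?s \<in> carr Y"
      by (intro scale_mem comb)
    have Ps: "P (cscale L ?s) = (\<Sum>j=1..n. cscale (L * sgn_of T j) (y j))"
    proof -
      have "P (cscale L ?s) = cscale L (P ?s)"
        by (rule P_scale[OF comb])
      also have "P ?s = (\<Sum>j=1..n. cscale (sgn_of T j) (P (y j)))"
        by (rule linear_on_sum[OF P(1) finite_atLeastAtMost y])
      also have "\<dots> = ?s"
        by (intro sum.cong refl) (simp add: Py)
      finally show ?thesis
        by (simp only: cscale_sum cscale_cscale)
    qed
    have Pt: "P ?t = (\<Sum>j=1..n. cscale (\<Sum>i=1..n. sgn_of T i * m i j) (y j))"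
    proof -
      have "P ?t = (\<Sum>i=1..n. cscale (sgn_of T i) (P (v i)))"
        by (rule linear_on_sum[OF P(1) finite_atLeastAtMost v(1)])
      also have "\<dots> = (\<Sum>i=1..n. \<Sum>j=1..n. cscale (sgn_of T i * m i j) (y j))"
        by (intro sum.cong refl) (simp add: m cscale_sum)
      also have "\<dots> = (\<Sum>j=1..n. \<Sum>i=1..n. cscale (sgn_of T i * m i j) (y j))"
        by (rule sum.swap)
      finally show ?thesis
        by (simp only: cseq.scale_sum_left)
    qed
    have minus: "p - q = p + cscale (-1) q" for p q :: cseq
      by (rule ext) simp
    have "P (cscale L ?s - ?t) = P (cscale L ?s + cscale (-1) ?t)"
      by (rule arg_cong[OF minus])
    also have "\<dots> = P (cscale L ?s) + cscale (-1) (P ?t)"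
      unfolding P_add[OF s scale_mem[OF t]] P_scale[OF t] ..
    also have "\<dots> = (\<Sum>j=1..n. cscale (c T j) (y j))"
      unfolding Ps Pt c_def cseq.scale_left_diff_distrib sum_subtractf by (rule minus[symmetric])
    finally have "nrm Y (\<Sum>j=1..n. cscale (c T j) (y j)) \<le> M * nrm Y (cscale L ?s - ?t)"
      using P(4)[OF diff_mem[OF s t]] by simp
    also have "\<dots> \<le> M * R"
      by (intro mult_left_mono R M)
    finally show ?thesis .
  qed
  have avg: "(\<Sum>T\<in>Pow {1..n}. sgn_of T j * c T j) = 2 ^ n * (L - m j j)" if j: "j \<in> {1..n}" for j
  proof -
    have "sgn_of T j * c T j = L * (sgn_of T j * sgn_of T j) - (\<Sum>i=1..n. m i j * (sgn_of T i * sgn_of T j))" for T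
      by (simp add: c_def algebra_simps sum_distrib_left)
    then have "(\<Sum>T\<in>Pow {1..n}. sgn_of T j * c T j)
        = L * (\<Sum>T\<in>Pow {1..n}. sgn_of T j * sgn_of T j)
          - (\<Sum>T\<in>Pow {1..n}. \<Sum>i=1..n. m i j * (sgn_of T i * sgn_of T j))"
      by (simp only: sum_subtractf sum_distrib_left)
    also have "(\<Sum>T\<in>Pow {1..n}. \<Sum>i=1..n. m i j * (sgn_of T i * sgn_of T j))
        = (\<Sum>i=1..n. m i j * (\<Sum>T\<in>Pow {1..n}. sgn_of T i * sgn_of T j))"
      by (subst sum.swap) (simp only: sum_distrib_left)
    also have "\<dots> = (\<Sum>i=1..n. if i = j then m i j * 2 ^ n else 0)"
      by (intro sum.cong refl) (subst sgn_of_orthogonal, auto)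
    also have "\<dots> = m j j * 2 ^ n"
      using j by simp
    finally show ?thesis
      using sgn_of_orthogonal[OF j, of j] by (simp add: algebra_simps)
  qed
  let ?d = "\<Sum>j=1..n. cscale (L - m j j) (y j)"
  \<comment> \<open>Multiplying the coefficients once more by the same signs and summing over all
    sign patterns cancels the off-diagonal entries. Each summand costs a factor \<open>lam\<close>,
    and the number \<open>2 ^ n\<close> of patterns cancels in the end.\<close>
  have "cscale (2 ^ n) ?d = (\<Sum>j=1..n. \<Sum>T\<in>Pow {1..n}. cscale (sgn_of T j * c T j) (y j))"
    unfolding cscale_sum cscale_cscale
    by (intro sum.cong refl) (simp only: avg[symmetric] cseq.scale_sum_left)
  also have "\<dots> = (\<Sum>T\<in>Pow {1..n}. \<Sum>j=1..n. cscale (sgn_of T j * c T j) (y j))"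
    by (rule sum.swap)
  finally have "2 ^ n * nrm Y ?d = nrm Y (\<Sum>T\<in>Pow {1..n}. \<Sum>j=1..n. cscale (sgn_of T j * c T j) (y j))"
    using nrm_scale[OF comb, of "2 ^ n" "\<lambda>j. L - m j j"] by (simp add: norm_power)
  also have "\<dots> \<le> (\<Sum>T\<in>Pow {1..n}. nrm Y (\<Sum>j=1..n. cscale (sgn_of T j * c T j) (y j)))"
    by (intro nrm_sum comb)
  also have "\<dots> \<le> (\<Sum>T\<in>Pow {1..n}. lam * (M * R))"
  proof (rule sum_mono)
    fix T
    have "nrm Y (\<Sum>j=1..n. cscale (sgn_of T j * c T j) (y j)) \<le> lam * nrm Y (\<Sum>j=1..n. cscale (c T j) (y j))"
      by (rule signs) (simp add: sgn_of_def)
    also have "\<dots> \<le> lam * (M * R)"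
      using lam by (intro mult_left_mono c_le) simp
    finally show "nrm Y (\<Sum>j=1..n. cscale (sgn_of T j * c T j) (y j)) \<le> lam * (M * R)" .
  qed
  also have "\<dots> = 2 ^ n * (lam * M * R)"
    by (simp add: card_Pow)
  finally have "nrm Y ?d \<le> lam * M * R"
    by simp
  then show ?thesis
    using diag by (intro exI[of _ "\<lambda>i. m i i"]) blast
qed


section \<open>Singularity\<close>

lemma (in nspace) unconditional_ge_1:
  assumes unc: "unconditional Y n y lam" and y: "successive_beyond n y" "n \<ge> 1"
    and mem: "\<And>i. i \<in> {1..n} \<Longrightarrow> y i \<in> carr Y"
  shows "lam \<ge> 1"
proof -
  have "nrm Y (\<Sum>i=1..n. cscale (1 * 1) (y i)) \<le> lam * nrm Y (\<Sum>i=1..n. cscale 1 (y i))"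
    using unc[unfolded unconditional_def, rule_format, of "\<lambda>_. 1" "\<lambda>_. 1"] by blast
  moreover have "nrm Y (\<Sum>i=1..n. y i) > 0"
    by (intro nrm_pos sum_mem mem successive_sum_nonzero y)
  ultimately show ?thesis
    by simp
qed

lemma (in nspace) complemented_ge_1:
  assumes "complemented Y V M" "z \<in> V" "z \<noteq> 0"
  shows "M \<ge> 1"
proof -
  obtain P where P: "P ` carr Y = V" "V \<subseteq> carr Y" "\<And>x. x \<in> carr Y \<Longrightarrow> P (P x) = P x"
    "\<And>x. x \<in> carr Y \<Longrightarrow> nrm Y (P x) \<le> M * nrm Y x"
    using assms(1) unfolding complemented_def by blast
  have z: "z \<in> carr Y"
    using P(2) assms(2) by blast
  have "P z = z"
    using P(1,3) assms(2) by auto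
  then have "nrm Y z \<le> M * nrm Y z"
    using P(4)[OF z] by simp
  then show ?thesis
    using nrm_pos[OF z assms(3)] by simp
qed

text \<open>After averaging, the logarithmic term splits into combinations of the \<open>y i\<close>
  with coefficients \<open>L - b i\<close> and \<open>b i\<close>. The former is bounded by
  \<open>diagonal_averaging\<close>, the latter by \<open>successive_estimate\<close>, and both
  bounds are multiples of \<open>A\<close>.\<close>

lemma (in selection) log_bound:
  assumes v_add: "\<And>y z. v (y + z) = v y + v z" and v_scale: "\<And>c y. v (cscale c y) = cscale c (v y)"
    and v: "\<And>y. block_proj w m y = y \<Longrightarrow> \<Omega> y - v y \<in> carr X \<and> nrm X (\<Omega> y - v y) \<le> D * nrm X y"
    and D: "D \<ge> 0" and y: "successive_beyond n y" and n: "n \<ge> 1"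
    and y1: "\<And>i. i \<in> {1..n} \<Longrightarrow> nrm X (y i) \<le> 1" and yw: "\<And>i. i \<in> {1..n} \<Longrightarrow> block_proj w m (y i) = y i"
    and unc: "unconditional X n y lam" and compl: "complemented X (cseq.span (y ` {1..n})) M"
  defines "A \<equiv> A_fun X0 n powr (1 - \<theta>) * A_fun X1 n powr \<theta>"
    and "L \<equiv> ln (A_fun X0 n / A_fun X1 n)"
  shows "lam \<ge> 1" "M \<ge> 1"
    and "\<bar>L\<bar> * nrm X (\<Sum>i=1..n. y i)
      \<le> lam * M * (D * (2 * C) + (C + 1) * (2 * C) / \<delta> + 2 * C * (3 * C / \<delta> + D)) * A"
proof -
  have bv: "block_vector (y i)" if "i \<in> {1..n}" for i
    using y that by (simp add: successive_beyond_def)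
  have yX: "y i \<in> carr X" if "i \<in> {1..n}" for i
    using bv[OF that] by (auto simp: block_vector_def intro: X.finite_supp_mem)
  show lam: "lam \<ge> 1"
    by (rule X.unconditional_ge_1[OF unc y n yX])
  show M: "M \<ge> 1"
  proof (rule X.complemented_ge_1[OF compl])
    show "y 1 \<in> cseq.span (y ` {1..n})"
      using n by (intro cseq.span_base) auto
    show "y 1 \<noteq> 0"
      using bv[of 1] n by (simp add: block_vector_def)
  qed
  define u where "u i = v (y i) - local_deriv (y i)" for i
  define K where "K = 3 * C / \<delta> + D"
  have K0: "K \<ge> 0"
    unfolding K_def using C0 D \<delta>_pos by simp
  have u: "u i \<in> carr X" "nrm X (u i) \<le> K" if i: "i \<in> {1..n}" for i
  proof -
    note p = local_lift(5,6)[OF bv[OF i]]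
    note q = conjunct1[OF v[OF yw[OF i]]] conjunct2[OF v[OF yw[OF i]]]
    have eq: "u i = (\<Omega> (y i) - local_deriv (y i)) - (\<Omega> (y i) - v (y i))"
      unfolding u_def by simp
    show "u i \<in> carr X"
      unfolding eq by (rule X.diff_mem[OF p(1) q(1)])
    have "nrm X (u i) \<le> 3 * C / \<delta> * nrm X (y i) + D * nrm X (y i)"
      unfolding eq using X.nrm_diff[OF p(1) q(1)] p(2) q(2) by linarith
    also have "\<dots> = K * nrm X (y i)"
      unfolding K_def by (rule distrib_right[symmetric])
    also have "\<dots> \<le> K * 1"
      by (intro mult_left_mono y1 i K0)
    finally show "nrm X (u i) \<le> K"
      by simp
  qed
  define R where "R = D * (2 * C * A) + (C + 1) * (2 * C * A) / \<delta>"
  have R: "nrm X (cscale (of_real L) (\<Sum>i=1..n. cscale (sgn_of T i) (y i))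
      - (\<Sum>i=1..n. cscale (sgn_of T i) (u i))) \<le> R" for T
  proof -
    define s where "s = (\<Sum>i=1..n. cscale (sgn_of T i) (y i))"
    have "cmod (sgn_of T i) * nrm X (y i) \<le> 1" if "i \<in> {1..n}" for i
      using y1[OF that] by (simp add: sgn_of_def)
    note est = successive_estimate[OF y n this zero_le_one, folded A_def L_def s_def]
    have s_le: "nrm X s \<le> 2 * C * A"
      using est(1) by simp
    have "block_proj w m s = (\<Sum>i=1..n. cscale (sgn_of T i) (block_proj w m (y i)))"
      unfolding s_def by (rule linear_comb[OF block_proj_add block_proj_scale])
    also have "\<dots> = s"
      unfolding s_def by (intro sum.cong refl) (simp add: yw)
    finally have vs: "\<Omega> s - v s \<in> carr X" "nrm X (\<Omega> s - v s) \<le> D * nrm X s"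
      using v by auto
    have v_sum: "v s = (\<Sum>i=1..n. cscale (sgn_of T i) (v (y i)))"
      unfolding s_def by (rule linear_comb[OF v_add v_scale])
    \<comment> \<open>The non-linear term \<open>\<Omega> s\<close> cancels between the two
      estimates, leaving a comparison of \<open>L\<close> times the sum with linear expressions in
      the signs.\<close>
    have rearrange: "p - (a - b) = (q - a) - (q - (b + p))" for p q a b :: cseq
      by (rule ext) simp
    have eq: "cscale (of_real L) s - (\<Sum>i=1..n. cscale (sgn_of T i) (u i))
      = (\<Omega> s - v s) - (\<Omega> s - ((\<Sum>i=1..n. cscale (sgn_of T i) (local_deriv (y i))) + cscale (of_real L) s))"
      unfolding v_sum u_def cscale_diff sum_subtractf by (rule rearrange)
    have "nrm X (cscale (of_real L) s - (\<Sum>i=1..n. cscale (sgn_of T i) (u i)))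
        \<le> D * nrm X s + (C + 1) * (2 * C * 1 * A) / \<delta>"
      unfolding eq using X.nrm_diff[OF vs(1) est(2)] vs(2) est(3) by linarith
    also have "\<dots> \<le> R"
      unfolding R_def using mult_left_mono[OF s_le D] by simp
    finally show ?thesis
      unfolding s_def .
  qed
  have "\<exists>b. (\<forall>i\<in>{1..n}. cmod (b i) * nrm X (y i) \<le> lam * M * K) \<and>
      nrm X (\<Sum>i=1..n. cscale (of_real L - b i) (y i)) \<le> lam * M * R"
    by (rule X.diagonal_averaging[OF yX unc lam compl _ u R]) (use M in simp_all)
  then obtain b where b: "\<And>i. i \<in> {1..n} \<Longrightarrow> cmod (b i) * nrm X (y i) \<le> lam * M * K"
    "nrm X (\<Sum>i=1..n. cscale (of_real L - b i) (y i)) \<le> lam * M * R"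
    by blast
  have "lam * M * K \<ge> 0"
    using lam M K0 by simp
  \<comment> \<open>The \<open>y i\<close> may have small norm, so the coefficients
    \<open>b i\<close> alone are not controlled; the products
    \<open>cmod (b i) * nrm X (y i)\<close> are, and this is the form that
    \<open>successive_estimate\<close> accepts.\<close>
  note diag = successive_estimate(1)[OF y n b(1) this, folded A_def]
  have mem: "(\<Sum>i=1..n. cscale (a i) (y i)) \<in> carr X" for a
    by (intro X.sum_mem X.scale_mem yX)
  have s: "(\<Sum>i=1..n. y i) \<in> carr X"
    by (intro X.sum_mem yX)
  have "\<bar>L\<bar> * nrm X (\<Sum>i=1..n. y i) = nrm X (cscale (of_real L) (\<Sum>i=1..n. y i))"
    unfolding X.nrm_scale[OF s] by simp
  also have "cscale (of_real L) (\<Sum>i=1..n. y i)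
      = (\<Sum>i=1..n. cscale (of_real L - b i) (y i)) + (\<Sum>i=1..n. cscale (b i) (y i))"
    by (simp only: cscale_sum sum.distrib[symmetric] cseq.scale_left_distrib[symmetric] diff_add_cancel)
  also have "nrm X \<dots> \<le> lam * M * R + 2 * C * (lam * M * K) * A"
    using X.nrm_add[OF mem mem, of "\<lambda>i. of_real L - b i" b] b(2) diag by linarith
  also have "\<dots> = lam * M * (D * (2 * C) + (C + 1) * (2 * C) / \<delta> + 2 * C * (3 * C / \<delta> + D)) * A"
    unfolding R_def K_def by (simp add: algebra_simps add_divide_distrib)
  finally show "\<bar>L\<bar> * nrm X (\<Sum>i=1..n. y i)
      \<le> lam * M * (D * (2 * C) + (C + 1) * (2 * C) / \<delta> + 2 * C * (3 * C / \<delta> + D)) * A" .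
qed

text \<open>Since \<open>lam \<ge> 1\<close>, the linear factor \<open>lam\<close> may be replaced
  by its cube. For \<open>L = 0\<close> the quotient of extended reals is infinite, because the
  numerator is positive, so the bound persists.\<close>

lemma ratio_lower_bound:
  fixes lam M eps L D :: real
  assumes "lam \<ge> 1" "M \<ge> 1" "eps > 0" "D > 0" and le: "\<bar>L\<bar> * eps \<le> lam * M * D"
  shows "ereal (1 / D) \<le> ereal (lam ^ 3 * M) / ereal (eps * \<bar>L\<bar>)"
proof (cases "L = 0")
  case True
  have "lam \<noteq> 0" "M \<noteq> 0" "lam ^ 3 * M > 0"
    using assms by auto
  with True show ?thesis
    by (simp add: divide_ereal_def)
next
  case False
  have "lam ^ 1 \<le> lam ^ 3"
    by (rule power_increasing) (use assms in auto)
  then have "lam * M * D \<le> lam ^ 3 * M * D"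
    using assms by (intro mult_right_mono) auto
  then have "eps * \<bar>L\<bar> \<le> lam ^ 3 * M * D"
    using le by (simp add: mult.commute)
  then have "1 / D \<le> lam ^ 3 * M / (eps * \<bar>L\<bar>)"
    using False assms by (simp add: field_simps)
  then show ?thesis
    using False assms by simp
qed

theorem proposition5p8:
  fixes X0 X1 :: cspace and \<theta> :: real and B :: "cseq \<Rightarrow> complex \<Rightarrow> cseq"
  assumes "monotone_basis_space X0" and "monotone_basis_space X1"
    and "0 < \<theta>" and "\<theta> < 1"
    and "bounded_selection X0 X1 \<theta> B"
    and "\<And>W. block_subspace (interp_space X0 X1 \<theta>) W \<Longrightarrow>
      \<exists>(y :: nat \<Rightarrow> nat \<Rightarrow> cseq) (eps :: nat \<Rightarrow> real) (lam :: nat \<Rightarrow> real) (M :: nat \<Rightarrow> real).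
        (\<forall>n. successive_beyond n (y n) \<and>
             (\<forall>i\<in>{1..n}. y n i \<in> W \<and> nrm (interp_space X0 X1 \<theta>) (y n i) \<le> 1) \<and>
             eps n > 0 \<and>
             nrm (interp_space X0 X1 \<theta>) (\<Sum>i=1..n. y n i)
               \<ge> eps n * A_fun X0 n powr (1 - \<theta>) * A_fun X1 n powr \<theta> \<and>
             unconditional (interp_space X0 X1 \<theta>) n (y n) (lam n) \<and>
             complemented (interp_space X0 X1 \<theta>) (cseq.span (y n ` {1..n})) (M n)) \<and>
        liminf (\<lambda>n. ereal (lam n ^ 3 * M n)
                    / ereal (eps n * \<bar>ln (A_fun X0 n / A_fun X1 n)\<bar>)) = 0"
  shows "singular (interp_space X0 X1 \<theta>) (sum_space X0 X1) (Omega X0 X1 \<theta> B)"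
proof -
  interpret couple X0 X1 \<theta>
    using assms(1-4) by (intro couple.intro bspace_monotone_basis couple_axioms.intro)
  obtain C0 where B: "\<And>x. x \<in> carr X \<Longrightarrow> B x \<in> H \<and> B x \<Theta> = x"
    "\<And>x. x \<in> carr X \<Longrightarrow> Hnorm (B x) \<le> C0 * nrm X x"
    using assms(5) unfolding bounded_selection_def by blast
  \<comment> \<open>\<open>bounded_selection\<close> puts no sign condition on its constant, whereas
    the estimates multiply inequalities by it.\<close>
  define C where "C = max C0 0"
  interpret selection X0 X1 \<theta> B C
  proof
    fix x
    assume x: "x \<in> carr X"
    show "B x \<in> H" "B x \<Theta> = x"
      using B(1)[OF x] by auto
    show "Hnorm (B x) \<le> C * nrm X x"
      by (rule order.trans[OF B(2)[OF x] mult_right_mono[OF _ X.nrm_ge0[OF x]]]) (simp add: C_def)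
  qed (simp add: C_def)
  show ?thesis
    unfolding singular_def
  proof (intro allI impI notI)
    fix W
    assume W: "closed_subspace X W \<and> infinite_dim W" and triv: "trivial_on X S \<Omega> W"
    then have W1: "cseq.subspace W" "W \<subseteq> carr X" "infinite_dim W"
      by (simp_all add: closed_subspace_def)
    obtain l D0 where l: "linear_on W l"
      "\<And>x. x \<in> W \<Longrightarrow> \<Omega> x - l x \<in> carr X \<and> nrm X (\<Omega> x - l x) \<le> D0 * nrm X x"
      using triv unfolding trivial_on_def by blast
    define D1 where "D1 = max D0 0"
    have D1: "\<Omega> x - l x \<in> carr X \<and> nrm X (\<Omega> x - l x) \<le> D1 * nrm X x" if "x \<in> W" for x
      using l(2)[OF that] mult_right_mono[OF _ X.nrm_ge0, of D0 D1 x] that W1(2)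
      unfolding D1_def by fastforce
    obtain x w where w: "block_sequence w" and x: "\<And>i. x i \<in> W" "\<And>i. nrm X (x i) = 1"
      and wx: "\<And>i. nrm X (w i - x i) \<le> (1 / 2) ^ (i + 2)"
      by (rule X.block_sequence_approximation[OF W1]) (rule that)
    \<comment> \<open>The hypothesis concerns block-subspaces, so it is applied to the closed span
      of the approximating blocks. This space need not lie in \<open>W\<close>;
      \<open>trivial_transfer\<close> makes the connection.\<close>
    define W' where "W' = norm_topology X closure_of cseq.span (range w)"
    have "block_subspace X W'"
      unfolding block_subspace_def W'_def using w unfolding block_sequence_def by blast
    from assms(6)[OF this] obtain y eps lam M where
      y: "\<And>n. successive_beyond n (y n)" "\<And>n i. i \<in> {1..n} \<Longrightarrow> y n i \<in> W' \<and> nrm X (y n i) \<le> 1"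
      and eps: "\<And>n. eps n > 0"
        "\<And>n. nrm X (\<Sum>i=1..n. y n i) \<ge> eps n * A_fun X0 n powr (1 - \<theta>) * A_fun X1 n powr \<theta>"
      and unc: "\<And>n. unconditional X n (y n) (lam n)"
      and compl: "\<And>n. complemented X (cseq.span (y n ` {1..n})) (M n)"
      and lim: "liminf (\<lambda>n. ereal (lam n ^ 3 * M n) / ereal (eps n * \<bar>ln (A_fun X0 n / A_fun X1 n)\<bar>)) = 0"
      by blast
    define D where "D = 6 * C / \<delta> + 3 * D1"
    have D: "D \<ge> 0"
      unfolding D_def using C0 \<delta>_pos by (simp add: D1_def)
    \<comment> \<open>All terms except the final 1 contain the factor \<open>C\<close> and may
      vanish; adding 1 keeps \<open>1 / E\<close> meaningful and positive.\<close>
    define E where "E = D * (2 * C) + (C + 1) * (2 * C) / \<delta> + 2 * C * (3 * C / \<delta> + D) + 1"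
    have E: "E > 0"
      unfolding E_def using D C0 \<delta>_pos by (intro add_nonneg_pos add_nonneg_nonneg) auto
    have bound: "ereal (1 / E) \<le> ereal (lam n ^ 3 * M n) / ereal (eps n * \<bar>ln (A_fun X0 n / A_fun X1 n)\<bar>)"
      if n: "n \<ge> 1" for n
    proof -
      have "\<exists>m0. \<forall>m\<ge>m0. block_proj w m (y n i) = y n i" if "i \<in> {1..n}" for i
        using y(1)[of n] y(2)[OF that] that unfolding W'_def successive_beyond_def block_vector_def
        by (intro X.closure_block_proj[OF w]) auto
      then obtain m0 where m0: "\<And>i m. i \<in> {1..n} \<Longrightarrow> m \<ge> m0 i \<Longrightarrow> block_proj w m (y n i) = y n i"
        by metis
      \<comment> \<open>One span containing all of \<open>y n 1\<close>, ..., \<open>y n n\<close>.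
        Both \<open>m\<close> and the map \<open>v\<close> obtained from it depend on
        \<open>n\<close>, but \<open>D\<close> and \<open>E\<close> do not.\<close>
      define m where "m = Max (m0 ` {1..n})"
      have yw: "block_proj w m (y n i) = y n i" if "i \<in> {1..n}" for i
        unfolding m_def by (rule m0[OF that]) (intro Max_ge finite_imageI finite_atLeastAtMost imageI that)
      obtain v where v: "\<And>y z. v (y + z) = v y + v z" "\<And>c y. v (cscale c y) = cscale c (v y)"
        "\<And>y. block_proj w m y = y \<Longrightarrow> \<Omega> y - v y \<in> carr X \<and> nrm X (\<Omega> y - v y) \<le> D * nrm X y"
        using trivial_transfer[OF W1(1,2) l(1) D1 _ w x wx, of m] unfolding D_def[symmetric]
        by (auto simp: D1_def)
      define A where "A = A_fun X0 n powr (1 - \<theta>) * A_fun X1 n powr \<theta>"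
      have A: "A > 0"
        using X0.A_fun_pos[OF y(1) n] X1.A_fun_pos[OF y(1) n] by (simp add: A_def)
      note log = log_bound[OF v D y(1) n conjunct2[OF y(2)] yw unc compl, folded A_def]
      define L where "L = ln (A_fun X0 n / A_fun X1 n)"
      have "\<bar>L\<bar> * (eps n * A) \<le> \<bar>L\<bar> * nrm X (\<Sum>i=1..n. y n i)"
        using eps(2)[of n] by (intro mult_left_mono) (simp_all add: A_def mult.assoc)
      also have "\<dots> \<le> lam n * M n * (E - 1) * A"
        using log(3) unfolding E_def L_def by simp
      also have "\<dots> \<le> lam n * M n * E * A"
        using log(1,2) A by (intro mult_right_mono mult_left_mono) auto
      finally have "\<bar>L\<bar> * eps n * A \<le> lam n * M n * E * A"
        by (simp add: mult.assoc)
      then have "\<bar>L\<bar> * eps n \<le> lam n * M n * E"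
        using A by simp
      then show ?thesis
        unfolding L_def by (intro ratio_lower_bound[OF log(1,2) eps(1) E])
    qed
    have "ereal (1 / E) \<le> liminf (\<lambda>n. ereal (lam n ^ 3 * M n) / ereal (eps n * \<bar>ln (A_fun X0 n / A_fun X1 n)\<bar>))"
      by (rule Liminf_bounded) (use bound eventually_sequentially in blast)
    then show False
      using E unfolding lim by simp
  qed
qed

end
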